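(* Let $k$ be an algebraically closed field of characteristic $p>0$ and let $n$ be a positive integer with $p\mid n$. For generic $c\in k$ (i.e. for all $c\in k$ outside some finite subset of $k$), the polynomials $f_1,\ldots,f_{n-1}\in A$ are linearly independent over $k$ and generate (as an ideal of $A$) the maximal proper graded submodule $J_c$ of the polynomial representation $A=\operatorname{Sym}(\mathfrak{h}^* )$ of the rational Cherednik algebra $\mathcal{H}_{1,c}(\mathfrak{h})$. Moreover, the irreducible quotient $L=A/J_c$ is a complete intersection, with Hilbert series $$h_L(t)=\left(\frac{1-t^p}{1-t}\right)^{n-1}.$$
   Context: Let $V=k^n$ be the permutation representation of the symmetric group $S_n$ with basis $y_1,\ldots,y_n$, let $x_1,\ldots,x_n$ be the dual basis of $V^*$, and let $s_{ij}\in S_n$ be the transposition of $i$ and $j$. Set $\mathfrak{h}=\operatorname{span}\{y_i-y_j\mid i\ne j\}\subset V$ and $\mathfrak{h}^*=V^*/(x_1+\cdots+x_n)$; these are mutually dual $(n-1)$-dimensional $S_n$-representations, with pairing induced by $\langle y_i,x_j\rangle=\delta_{ij}$. The images of the $x_i$ in $\mathfrak{h}^*$ are still denoted $x_i$. $A=\operatorname{Sym}(\mathfrak{h}^* )=k[x_1,\ldots,x_n]/(x_1+\cdots+x_n)$, a polynomial ring in $n-1$ variables, graded with $\deg x_i=1$. Rational Cherednik algebra: for $c\in k$, $\mathcal{H}_{1,c}(\mathfrak{h})$ is the quotient of $k[S_n]\ltimes T(\mathfrak{h}\oplus\mathfrak{h}^* )$ ($T$ denotes the tensor algebra) by the relations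 $[x_i,x_j]=0$, $[y_i-y_j,y_l-y_m]=0$, $[y_i-y_j,x_i]=1-cs_{ij}-c\sum_{t\ne i}s_{it}$, $[y_i-y_j,x_l]=cs_{il}-cs_{jl}$, for all $1\le i,j,l,m\le n$ with $i,j,l$ distinct and $l\neq m$. It is $\mathbb{Z}$-graded with $\deg x=1$ for $x\in\mathfrak{h}^*$, $\deg y=-1$ for $y\in\mathfrak{h}$, $\deg g=0$ for $g\in k[S_n]$. Polynomial representation: $\mathcal{H}_{1,c}(\mathfrak{h})$ acts on $A$, with $\operatorname{Sym}(\mathfrak{h}^* )$ acting by multiplication, $S_n$ acting by permuting the $x_i$, and $y\in\mathfrak{h}$ acting by the Dunkl operator $$D_y=\partial_y-\sum_{m<l}c\,\langle y,x_m-x_l\rangle\frac{1-s_{ml}}{x_m-x_l},$$ where $\partial_y$ is the $k$-linear derivation of $A$ with $\partial_y(x)=\langle y,x\rangle$ for $x\in\mathfrak{h}^*$, and $\frac{1-s_{ml}}{x_m-x_l}$ is the divided-difference operator on $A$ (induced from the operator $f\mapsto\frac{f-s_{ml}f}{x_m-x_l}$ on $k[x_1,\ldots,x_n]$, which preserves the ideal generated by $x_1+\cdots+x_n$). $J_c\subset A$ is the unique maximal proper graded $\mathcal{H}_{1,c}(\mathfrak{h})$-submodule of $A$. The quotient $L=A/J_c$ inherits a $\mathbb{Z}_{\ge0}$-grading $L=\bigoplus_{j\ge0}L_j$, and its Hilbert series is $h_L(t)=\sum_{j\ge0}\dim_k L_j\,t^j$. Definition of the $f_i$: for a formal power series $r(z)$,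 $[z^l]r(z)$ denotes the coefficient of $z^l$. Rational functions in $z$ are expanded around $z=0$. In $A[[z]]$ put, for $i=1,\ldots,n-1$, $$F_i(z)=\frac{1}{1-x_iz}\sum_{m=0}^{p-1}\binom{c}{m}\left(\prod_{j=1}^n(1-x_jz)-1\right)^m,\qquad \binom{c}{m}=\frac{c(c-1)\cdots(c-m+1)}{m!}\in k,$$ and $f_i=[z^p]F_i(z)\in A$. Complete intersection: for a homogeneous ideal $I\subset k[X_0,\ldots,X_m]$ with a minimal set of generators of size $l$, the quotient $k[X_0,\ldots,X_m]/I$ is called a complete intersection if the closed projective subvariety of $\mathbb{P}^m$ defined by $I$ has dimension $m-l$ (the empty variety having dimension $-1$). Here this is applied to $A$ viewed as a polynomial ring in $n-1$ variables ($m=n-2$). *)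

theory Defs
  imports
    "HOL-Combinatorics.Perm"
    "HOL-Algebra.Algebraic_Closure_Type"
    "HOL-Algebra.QuotRing"
    "HOL-Algebra.Embedded_Algebras"
    "HOL-Computational_Algebra.Computational_Algebra"
    "HOL-Library.Poly_Mapping"
    "HOL-Library.Cardinality"
begin

unbundle permutation_syntax

section \<open>Polynomials\<close>

type_synonym ('v, 'k) mpoly = "('v \<Rightarrow>\<^sub>0 nat) \<Rightarrow>\<^sub>0 'k"

abbreviation PConst :: "'k \<Rightarrow> ('v, 'k::comm_ring_1) mpoly" where
  "PConst \<equiv> Poly_Mapping.single 0"

definition PVar :: "'v \<Rightarrow> ('v, 'k::comm_ring_1) mpoly" where
  "PVar i = Poly_Mapping.single (Poly_Mapping.single i 1) 1"

text \<open>Evaluation of a polynomial with coefficients mapped by \<open>h\<close> and the variable \<open>i\<close>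
  replaced by \<open>g i\<close>.\<close>

definition peval ::
    "('k::comm_ring_1 \<Rightarrow> 'r::comm_ring_1) \<Rightarrow> ('v \<Rightarrow> 'r) \<Rightarrow> ('v, 'k) mpoly \<Rightarrow> 'r" where
  "peval h g f = (\<Sum>m\<in>Poly_Mapping.keys f. h (Poly_Mapping.lookup f m) * (\<Prod>i\<in>Poly_Mapping.keys m. g i ^ Poly_Mapping.lookup m i))"

definition homogeneous :: "nat \<Rightarrow> ('v, 'k::comm_ring_1) mpoly \<Rightarrow> bool" where
  "homogeneous d f \<longleftrightarrow> (\<forall>m\<in>Poly_Mapping.keys f. (\<Sum>i\<in>Poly_Mapping.keys m. Poly_Mapping.lookup m i) = d)"

lemma peval_superset:
  assumes "finite K" "Poly_Mapping.keys f \<subseteq> K" "h 0 = 0"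
  shows "peval h g f = (\<Sum>m\<in>K. h (Poly_Mapping.lookup f m) * (\<Prod>i\<in>Poly_Mapping.keys m. g i ^ Poly_Mapping.lookup m i))"
  unfolding peval_def
  by (rule sum.mono_neutral_left) (use assms in \<open>auto simp: in_keys_iff\<close>)

lemma monom_superset:
  fixes g :: "'v \<Rightarrow> 'r::comm_ring_1"
  assumes "finite K" "Poly_Mapping.keys m \<subseteq> K"
  shows "(\<Prod>i\<in>Poly_Mapping.keys m. g i ^ Poly_Mapping.lookup m i) = (\<Prod>i\<in>K. g i ^ Poly_Mapping.lookup m i)"
  by (rule prod.mono_neutral_left) (use assms in \<open>auto simp: in_keys_iff\<close>)

lemma monom_add:
  fixes g :: "'v \<Rightarrow> 'r::comm_ring_1"
  shows "(\<Prod>i\<in>Poly_Mapping.keys (m + m'). g i ^ Poly_Mapping.lookup (m + m') i) =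
    (\<Prod>i\<in>Poly_Mapping.keys m. g i ^ Poly_Mapping.lookup m i) * (\<Prod>i\<in>Poly_Mapping.keys m'. g i ^ Poly_Mapping.lookup m' i)"
proof -
  let ?K = "Poly_Mapping.keys m \<union> Poly_Mapping.keys m'"
  have "(\<Prod>i\<in>Poly_Mapping.keys (m + m'). g i ^ Poly_Mapping.lookup (m + m') i) = (\<Prod>i\<in>?K. g i ^ Poly_Mapping.lookup (m + m') i)"
    by (rule monom_superset) (auto dest: subsetD[OF Poly_Mapping.keys_add])
  also have "\<dots> = (\<Prod>i\<in>?K. g i ^ Poly_Mapping.lookup m i) * (\<Prod>i\<in>?K. g i ^ Poly_Mapping.lookup m' i)"
    by (simp add: lookup_add power_add prod.distrib)
  also have "(\<Prod>i\<in>?K. g i ^ Poly_Mapping.lookup m i) = (\<Prod>i\<in>Poly_Mapping.keys m. g i ^ Poly_Mapping.lookup m i)"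
    by (rule monom_superset[symmetric]) auto
  also have "(\<Prod>i\<in>?K. g i ^ Poly_Mapping.lookup m' i) = (\<Prod>i\<in>Poly_Mapping.keys m'. g i ^ Poly_Mapping.lookup m' i)"
    by (rule monom_superset[symmetric]) auto
  finally show ?thesis .
qed

lemma update_eq_add:
  fixes f :: "'a \<Rightarrow>\<^sub>0 'b::comm_monoid_add"
  assumes "a \<notin> Poly_Mapping.keys f"
  shows "Poly_Mapping.update a b f = Poly_Mapping.single a b + f"
  using assms
  by (intro poly_mapping_eqI) (auto simp: lookup_update lookup_add lookup_single in_keys_iff when_def)

lemma mpoly_induct [case_names const var add mult]:
  fixes f :: "('v, 'k::comm_ring_1) mpoly"
  assumes const: "\<And>a. P (PConst a)" and var: "\<And>i. P (PVar i)"
    and add: "\<And>f g. P f \<Longrightarrow> P g \<Longrightarrow> P (f + g)" and mult: "\<And>f g. P f \<Longrightarrow> P g \<Longrightarrow> P (f * g)"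
  shows "P f"
proof -
  have pow: "P (Poly_Mapping.single (Poly_Mapping.single i n) 1)" for i n
  proof (induction n)
    case 0
    show ?case using const[of 1] by simp
  next
    case (Suc n)
    have "(Poly_Mapping.single (Poly_Mapping.single i (Suc n)) 1 :: ('v, 'k) mpoly)
        = PVar i * Poly_Mapping.single (Poly_Mapping.single i n) 1"
      by (simp add: PVar_def mult_single flip: single_add)
    then show ?case using mult[OF var Suc] by simp
  qed
  have mon: "P (Poly_Mapping.single m 1)" for m
  proof (induction m rule: update_induct)
    case const
    show ?case using assms(1)[of 1] by simp
  next
    case (update m i n)
    have "(Poly_Mapping.single (Poly_Mapping.update i n m) 1 :: ('v, 'k) mpoly)
        = Poly_Mapping.single (Poly_Mapping.single i n) 1 * Poly_Mapping.single m 1"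
      using update by (simp add: update_eq_add mult_single)
    then show ?case using mult[OF pow update(3)] by simp
  qed
  show ?thesis
  proof (induction f rule: update_induct)
    case const
    show ?case using assms(1)[of 0] by simp
  next
    case (update f m a)
    have "Poly_Mapping.update m a f = PConst a * Poly_Mapping.single m 1 + f"
      using update by (simp add: update_eq_add mult_single)
    then show ?case using add[OF mult[OF assms(1) mon] update(3)] by simp
  qed
qed

locale coeff_hom =
  fixes h :: "'k::comm_ring_1 \<Rightarrow> 'r::comm_ring_1"
  assumes h_0: "h 0 = 0" and h_1: "h 1 = 1"
    and h_add: "h (a + b) = h a + h b" and h_mult: "h (a * b) = h a * h b"
begin

lemma peval_single: "peval h g (Poly_Mapping.single m a) = h a * (\<Prod>i\<in>Poly_Mapping.keys m. g i ^ Poly_Mapping.lookup m i)"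
  by (subst peval_superset[of "{m}"]) (auto simp: h_0)

lemma peval_const: "peval h g (PConst a) = h a"
  by (simp add: peval_single)

lemma peval_var: "peval h g (PVar i) = g i"
  by (simp add: PVar_def peval_single h_1)

lemma peval_add: "peval h g (f + f') = peval h g f + peval h g f'"
proof -
  let ?K = "Poly_Mapping.keys f \<union> Poly_Mapping.keys f'"
  have "peval h g (f + f') = (\<Sum>m\<in>?K. h (Poly_Mapping.lookup (f + f') m) * (\<Prod>i\<in>Poly_Mapping.keys m. g i ^ Poly_Mapping.lookup m i))"
    by (rule peval_superset) (auto simp: h_0 dest: subsetD[OF Poly_Mapping.keys_add])
  also have "\<dots> = peval h g f + peval h g f'"
    by (simp add: lookup_add h_add distrib_right sum.distrib peval_superset[of ?K] h_0)
  finally show ?thesis .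
qed

lemma peval_mult: "peval h g (f * f') = peval h g f * peval h g f'"
proof (induction f rule: update_induct)
  case const
  show ?case by (simp add: peval_def)
next
  case (update f m a)
  have "peval h g (Poly_Mapping.single m a * f') = peval h g (Poly_Mapping.single m a) * peval h g f'"
  proof (induction f' rule: update_induct)
    case const
    show ?case by (simp add: peval_def)
  next
    case (update f' m' a')
    then show ?case
      by (simp add: update_eq_add distrib_left peval_add mult_single peval_single monom_add h_mult mult_ac)
  qed
  with update show ?case
    by (simp add: update_eq_add distrib_right peval_add)
qed

lemma peval_0: "peval h g 0 = 0"
  by (simp add: peval_def)

lemma peval_diff: "peval h g (f - f') = peval h g f - peval h g f'"
  by (metis add_diff_cancel_right' diff_add_cancel peval_add)

lemma peval_sum: "peval h g (sum F S) = (\<Sum>s\<in>S. peval h g (F s))"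
  by (induction S rule: infinite_finite_induct) (auto simp: peval_0 peval_add)

end

interpretation coeff_hom_PConst: coeff_hom "PConst :: 'k::comm_ring_1 \<Rightarrow> ('v, 'k) mpoly"
  by unfold_locales (simp_all add: single_add mult_single)

section \<open>The algebra \<open>A\<close>\<close>

text \<open>The index set \<open>{1, \<dots>, n}\<close> is a finite linearly ordered type \<open>'n\<close> with
  \<open>n = CARD('n)\<close>; the type \<open>symh\<close> is
  \<open>A = Sym \<hh>\<^sup>* = k[x\<^sub>1, \<dots>, x\<^sub>n]/(x\<^sub>1 + \<dots> + x\<^sub>n)\<close>.\<close>

definition var_sum :: "('n::finite, 'k::comm_ring_1) mpoly" where
  "var_sum = (\<Sum>i\<in>UNIV. PVar i)"

quotient_type (overloaded) ('n, 'k) symh =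
  "('n::{finite, linorder}, 'k::field) mpoly" / "\<lambda>f g. var_sum dvd f - g"
proof (rule equivpI)
  show "symp (\<lambda>f g. (var_sum :: ('n, 'k) mpoly) dvd f - g)"
  proof (rule sympI)
    fix f g :: "('n, 'k) mpoly"
    assume "var_sum dvd f - g"
    then have "var_sum dvd - (f - g)" by (simp only: dvd_minus_iff)
    then show "var_sum dvd g - f" by (simp only: minus_diff_eq)
  qed
  show "transp (\<lambda>f g. (var_sum :: ('n, 'k) mpoly) dvd f - g)"
  proof (rule transpI)
    fix f g h :: "('n, 'k) mpoly"
    assume "var_sum dvd f - g" "var_sum dvd g - h"
    then have "var_sum dvd (f - g) + (g - h)" by (rule dvd_add)
    then show "var_sum dvd f - h" by simp
  qed
qed (simp add: reflp_def)

lemma dvd_diff_eqI: "a = b \<Longrightarrow> d dvd a - b" for a b d :: "'a::comm_ring_1"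
  by simp

instantiation symh :: ("{finite, linorder}", field) comm_ring_1
begin

lift_definition zero_symh :: "('a, 'b) symh" is 0 .
lift_definition one_symh :: "('a, 'b) symh" is 1 .
lift_definition plus_symh :: "('a, 'b) symh \<Rightarrow> ('a, 'b) symh \<Rightarrow> ('a, 'b) symh" is "(+)"
  by (simp only: add_diff_add dvd_add)
lift_definition minus_symh :: "('a, 'b) symh \<Rightarrow> ('a, 'b) symh \<Rightarrow> ('a, 'b) symh" is "(-)"
proof -
  fix a b c d :: "('a, 'b) mpoly"
  assume "var_sum dvd a - b" "var_sum dvd c - d"
  then have "var_sum dvd (a - b) - (c - d)" by (rule dvd_diff)
  then show "var_sum dvd a - c - (b - d)" by (simp add: algebra_simps)
qed
lift_definition uminus_symh :: "('a, 'b) symh \<Rightarrow> ('a, 'b) symh" is uminus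
  by (simp only: minus_diff_minus dvd_minus_iff)
lift_definition times_symh :: "('a, 'b) symh \<Rightarrow> ('a, 'b) symh \<Rightarrow> ('a, 'b) symh" is "(*)"
proof -
  fix a b c d :: "('a, 'b) mpoly"
  assume "var_sum dvd a - b" "var_sum dvd c - d"
  then have "var_sum dvd (a - b) * c + b * (c - d)"
    by (intro dvd_add dvd_mult dvd_mult2)
  then show "var_sum dvd a * c - b * d" by (simp add: algebra_simps)
qed

instance
proof
  have "\<not> (var_sum :: ('a, 'b) mpoly) dvd 0 - 1"
  proof
    assume "(var_sum :: ('a, 'b) mpoly) dvd 0 - 1"
    then obtain q where q: "0 - 1 = (var_sum :: ('a, 'b) mpoly) * q" by (elim dvdE)
    interpret coeff_hom "id :: 'b \<Rightarrow> 'b" by unfold_locales simp_all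
    have "peval id (\<lambda>_. 0) (var_sum :: ('a, 'b) mpoly) = 0"
      by (simp add: var_sum_def peval_sum peval_var)
    then have "peval id (\<lambda>_. 0) (0 - 1 :: ('a, 'b) mpoly) = 0"
      unfolding q by (simp add: peval_mult)
    moreover have "peval id (\<lambda>_. 0) (1 :: ('a, 'b) mpoly) = 1"
      using peval_const[of "\<lambda>_. 0" 1] by simp
    ultimately show False
      by (metis diff_zero eq_iff_diff_eq_0 peval_0 peval_diff zero_neq_one)
  qed
  then show "(0 :: ('a, 'b) symh) \<noteq> 1"
    by transfer
qed (transfer, rule dvd_diff_eqI, simp add: algebra_simps)+

end

lift_definition symh_var :: "'n \<Rightarrow> ('n::{finite, linorder}, 'k::field) symh" is PVar .

lift_definition symh_const :: "'k \<Rightarrow> ('n::{finite, linorder}, 'k::field) symh" is PConst .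

definition symh_scale :: "'k \<Rightarrow> ('n::{finite, linorder}, 'k::field) symh \<Rightarrow> ('n, 'k) symh" where
  "symh_scale r a = symh_const r * a"

definition symh_degree :: "nat \<Rightarrow> ('n::{finite, linorder}, 'k::field) symh set" where
  "symh_degree j = abs_symh ` {f. homogeneous j f}"

lemma symh_scale_simps:
  "symh_const (r + s) = symh_const r + symh_const s"
  "symh_const (r * s) = symh_const r * symh_const s"
  "symh_const 0 = 0" "symh_const 1 = 1"
  by (transfer; simp add: single_add mult_single)+

lemma sum_symh_var: "(\<Sum>i\<in>UNIV. symh_var i :: ('a::{finite, linorder}, 'b::field) symh) = 0"
proof -
  have "(\<Sum>i\<in>S. symh_var i) = abs_symh (\<Sum>i\<in>S. PVar i :: ('a, 'b) mpoly)" for S :: "'a set"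
    by (induction S rule: infinite_finite_induct)
       (simp_all add: zero_symh_def symh_var_def plus_symh.abs_eq)
  then have "(\<Sum>i\<in>UNIV. symh_var i) = abs_symh (var_sum :: ('a, 'b) mpoly)"
    by (simp add: var_sum_def)
  also have "\<dots> = 0"
    by (simp add: zero_symh_def symh.abs_eq_iff)
  finally show ?thesis .
qed

lemma symh_induct [case_names const var add mult]:
  fixes a :: "('n::{finite, linorder}, 'k::field) symh"
  assumes "\<And>r. P (symh_const r)" "\<And>i. P (symh_var i)"
    and "\<And>a b. P a \<Longrightarrow> P b \<Longrightarrow> P (a + b)" "\<And>a b. P a \<Longrightarrow> P b \<Longrightarrow> P (a * b)"
  shows "P a"
proof -
  obtain f where f: "a = abs_symh f"
    by (metis Quotient3_abs_rep Quotient3_symh)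
  show ?thesis
    unfolding f
  proof (induction f rule: mpoly_induct)
    case (const r) show ?case using assms(1) by (simp add: symh_const_def)
  next
    case (var i) show ?case using assms(2) by (simp add: symh_var_def)
  next
    case (add f g) then show ?case using assms(3) by (metis plus_symh.abs_eq)
  next
    case (mult f g) then show ?case using assms(4) by (metis times_symh.abs_eq)
  qed
qed

section \<open>The operators of the polynomial representation\<close>

lift_definition symh_perm ::
    "'n perm \<Rightarrow> ('n::{finite, linorder}, 'k::field) symh \<Rightarrow> ('n, 'k) symh"
  is "\<lambda>\<sigma>. peval PConst (\<lambda>i. PVar (\<sigma> \<langle>$\<rangle> i))"
proof -
  fix \<sigma> :: "'n perm" and f g :: "('n, 'k) mpoly"
  let ?s = "peval PConst (\<lambda>i. PVar (\<sigma> \<langle>$\<rangle> i)) :: ('n, 'k) mpoly \<Rightarrow> ('n, 'k) mpoly"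
  have "?s var_sum = (\<Sum>i\<in>UNIV. PVar (\<sigma> \<langle>$\<rangle> i))"
    by (simp add: var_sum_def coeff_hom_PConst.peval_sum coeff_hom_PConst.peval_var)
  also have "\<dots> = var_sum"
    unfolding var_sum_def by (rule sum.reindex_bij_betw) (rule bij_apply)
  finally have e: "?s var_sum = var_sum" .
  assume "var_sum dvd f - g"
  then obtain q where "f - g = var_sum * q" by (elim dvdE)
  then have "?s f - ?s g = var_sum * ?s q"
    by (metis e coeff_hom_PConst.peval_diff coeff_hom_PConst.peval_mult)
  then show "var_sum dvd ?s f - ?s g" by simp
qed

definition poly_swap ::
    "'n \<Rightarrow> 'n \<Rightarrow> ('n::{finite, linorder}, 'k::field) mpoly \<Rightarrow> ('n, 'k) mpoly" where
  "poly_swap m l = peval PConst (\<lambda>i. PVar (\<langle>m \<leftrightarrow> l\<rangle> \<langle>$\<rangle> i))"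

text \<open>The quotient is unique because the polynomial ring is a domain; its existence is
  \<open>ddiff_poly_eq\<close> below.\<close>

definition ddiff_poly ::
    "'n \<Rightarrow> 'n \<Rightarrow> ('n::{finite, linorder}, 'k::field) mpoly \<Rightarrow> ('n, 'k) mpoly" where
  "ddiff_poly m l f = (THE g. (PVar m - PVar l) * g = f - poly_swap m l f)"

lemma PVar_inj:
  assumes "m \<noteq> l"
  shows "PVar m - PVar l \<noteq> (0 :: ('n, 'k::field) mpoly)"
proof
  assume "PVar m - PVar l = (0 :: ('n, 'k) mpoly)"
  then have "(1::'k) = 0"
    using assms by (metis PVar_def eq_iff_diff_eq_0 lookup_single_eq lookup_single_not_eq inj_single
      injD one_neq_zero)
  then show False by simp
qed

lemma ddiff_poly_ex: "\<exists>g. (PVar m - PVar l) * g = f - poly_swap m l f"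
proof (induction f rule: mpoly_induct)
  case (const a)
  show ?case by (rule exI[of _ 0]) (simp add: poly_swap_def coeff_hom_PConst.peval_const)
next
  case (var i)
  consider "i = m" "m \<noteq> l" | "i = l" "m \<noteq> l" | "\<langle>m \<leftrightarrow> l\<rangle> \<langle>$\<rangle> i = i"
    by (metis apply_swap_same apply_swap_simp(1) apply_swap_eq_iff)
  then show ?case
  proof cases
    case 1
    then show ?thesis by (intro exI[of _ 1]) (simp add: poly_swap_def coeff_hom_PConst.peval_var)
  next
    case 2
    then show ?thesis by (intro exI[of _ "- 1"]) (simp add: poly_swap_def coeff_hom_PConst.peval_var)
  next
    case 3
    then show ?thesis by (intro exI[of _ 0]) (simp add: poly_swap_def coeff_hom_PConst.peval_var)
  qed
next
  case (add f g)
  then obtain u v where "(PVar m - PVar l) * u = f - poly_swap m l f"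
    "(PVar m - PVar l) * v = g - poly_swap m l g" by blast
  then show ?case
    by (intro exI[of _ "u + v"]) (simp add: poly_swap_def coeff_hom_PConst.peval_add distrib_left)
next
  case (mult f g)
  then obtain u v where uv: "(PVar m - PVar l) * u = f - poly_swap m l f"
    "(PVar m - PVar l) * v = g - poly_swap m l g" by blast
  have "(PVar m - PVar l) * (u * g + poly_swap m l f * v)
      = ((PVar m - PVar l) * u) * g + poly_swap m l f * ((PVar m - PVar l) * v)"
    by (simp add: algebra_simps)
  also have "\<dots> = f * g - poly_swap m l (f * g)"
    unfolding uv by (simp add: poly_swap_def coeff_hom_PConst.peval_mult algebra_simps)
  finally show ?case by blast
qed

lemma ddiff_poly_eqI:
  assumes "m \<noteq> l" "(PVar m - PVar l) * g = f - poly_swap m l f"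
  shows "ddiff_poly m l f = g"
  unfolding ddiff_poly_def
proof (rule the_equality)
  fix g' assume "(PVar m - PVar l) * g' = f - poly_swap m l f"
  with assms show "g' = g" by (metis PVar_inj mult_left_cancel)
qed (rule assms)

lemma ddiff_poly_eq:
  assumes "m \<noteq> l"
  shows "(PVar m - PVar l) * ddiff_poly m l f = f - poly_swap m l f"
  using ddiff_poly_ex[of m l f] ddiff_poly_eqI[OF assms] by blast

lift_definition ddiff ::
    "'n \<Rightarrow> 'n \<Rightarrow> ('n::{finite, linorder}, 'k::field) symh \<Rightarrow> ('n, 'k) symh"
  is ddiff_poly
proof -
  fix m l :: 'n and f g :: "('n, 'k) mpoly"
  assume fg: "var_sum dvd f - g"
  show "var_sum dvd ddiff_poly m l f - ddiff_poly m l g"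
  proof (cases "m = l")
    case True
    have "poly_swap l l h = h" for h :: "('n, 'k) mpoly"
      by (induction h rule: mpoly_induct)
        (simp_all add: poly_swap_def coeff_hom_PConst.peval_const coeff_hom_PConst.peval_var
          coeff_hom_PConst.peval_add coeff_hom_PConst.peval_mult)
    then show ?thesis using True by (simp add: ddiff_poly_def)
  next
    case False
    have e: "poly_swap m l var_sum = (var_sum :: ('n, 'k) mpoly)"
      unfolding poly_swap_def var_sum_def
      by (simp add: coeff_hom_PConst.peval_sum coeff_hom_PConst.peval_var)
        (rule sum.reindex_bij_betw, rule bij_apply)
    from fg obtain q where q: "f - g = var_sum * q" by (elim dvdE)
    have "(PVar m - PVar l) * (ddiff_poly m l g + var_sum * ddiff_poly m l q)
        = (PVar m - PVar l) * ddiff_poly m l g + var_sum * ((PVar m - PVar l) * ddiff_poly m l q)"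
      by (simp add: algebra_simps)
    also have "\<dots> = (g + var_sum * q) - poly_swap m l (g + var_sum * q)"
      using e unfolding ddiff_poly_eq[OF False]
      by (simp add: poly_swap_def coeff_hom_PConst.peval_mult coeff_hom_PConst.peval_add algebra_simps)
    also have "g + var_sum * q = f" by (simp flip: q)
    finally have "ddiff_poly m l f = ddiff_poly m l g + var_sum * ddiff_poly m l q"
      by (rule ddiff_poly_eqI[OF False])
    then show ?thesis by simp
  qed
qed

definition is_derivation ::
    "(('n::{finite, linorder}, 'k::field) symh \<Rightarrow> ('n, 'k) symh) \<Rightarrow> bool" where
  "is_derivation D \<longleftrightarrow>
     (\<forall>a b. D (a + b) = D a + D b) \<and> (\<forall>r a. D (symh_scale r a) = symh_scale r (D a)) \<and>
     (\<forall>a b. D (a * b) = D a * b + a * D b)"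

text \<open>A vector \<open>\<Sum>i. u\<^sub>i y\<^sub>i\<close> of \<open>V\<close> is given by its coordinate function \<open>u\<close>, so that its
  pairing with \<open>x\<^sub>i\<close> is \<open>u i\<close>. It lies in \<open>\<hh>\<close> exactly if its coordinates add up to zero;
  only then does the derivation \<open>dir_deriv u\<close> exist (\<open>dir_deriv_ex1\<close>).\<close>

definition y_diff :: "'n \<Rightarrow> 'n \<Rightarrow> 'n \<Rightarrow> 'k::field" where
  "y_diff i j = (\<lambda>t. of_bool (t = i) - of_bool (t = j))"

definition dir_deriv ::
    "('n \<Rightarrow> 'k) \<Rightarrow> ('n::{finite, linorder}, 'k::field) symh \<Rightarrow> ('n, 'k) symh" where
  "dir_deriv u = (THE D. is_derivation D \<and> (\<forall>i. D (symh_var i) = symh_const (u i)))"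

lemma dir_deriv_ex1:
  fixes u :: "'n::{finite, linorder} \<Rightarrow> 'k::field"
  assumes u: "sum u UNIV = 0"
  shows "\<exists>!D. is_derivation D \<and> (\<forall>i. D (symh_var i) = symh_const (u i))"
proof -
  let ?h = "\<lambda>r. fps_const (symh_const r :: ('n, 'k) symh)"
  let ?g = "\<lambda>i. fps_const (symh_var i) + fps_const (symh_const (u i)) * fps_X"
  interpret coeff_hom ?h
    by unfold_locales (simp_all add: symh_scale_simps flip: fps_const_add fps_const_mult)
  have sum_const: "(\<Sum>i\<in>S. symh_const (u i)) = (symh_const (sum u S) :: ('n, 'k) symh)" for S
    by (induction S rule: infinite_finite_induct) (simp_all add: symh_scale_simps)
  have fps_sum: "(\<Sum>i\<in>S. fps_const (a i)) = fps_const (sum a S)"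
    for a :: "'n \<Rightarrow> ('n, 'k) symh" and S
    by (induction S rule: infinite_finite_induct) simp_all
  have "peval ?h ?g var_sum = (\<Sum>i\<in>UNIV. ?g i)"
    by (simp only: var_sum_def peval_sum peval_var)
  also have "\<dots> = 0"
    by (simp only: sum.distrib fps_sum sum_symh_var sum_const u symh_scale_simps
        fps_const_0_eq_0 mult_zero_left add_0_left flip: sum_distrib_right)
  finally have "peval ?h ?g var_sum = 0" .
  then have dvd: "peval ?h ?g f = peval ?h ?g g" if "var_sum dvd f - g" for f g
  proof -
    from that obtain q where "f - g = var_sum * q" by (elim dvdE)
    then have "peval ?h ?g f - peval ?h ?g g = peval ?h ?g var_sum * peval ?h ?g q"
      by (simp only: flip: peval_diff peval_mult)
    then show ?thesis by (simp add: \<open>peval ?h ?g var_sum = 0\<close>)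
  qed
  define E where "E a = peval ?h ?g (rep_symh a)" for a
  have E_abs: "E (abs_symh f) = peval ?h ?g f" for f
    unfolding E_def
    by (rule dvd) (simp only: flip: symh.abs_eq_iff, rule Quotient3_abs_rep[OF Quotient3_symh])
  have E_add: "E (a + b) = E a + E b" for a b
    by (induction a rule: symh.abs_induct, induction b rule: symh.abs_induct)
      (simp add: E_abs plus_symh.abs_eq peval_add)
  have E_mult: "E (a * b) = E a * E b" for a b
    by (induction a rule: symh.abs_induct, induction b rule: symh.abs_induct)
      (simp add: E_abs times_symh.abs_eq peval_mult)
  have E_const: "E (symh_const r) = ?h r" for r
    using E_abs[of "PConst r"] by (simp only: peval_const symh_const.abs_eq[symmetric])
  have E_var: "E (symh_var i) = ?g i" for i
    using E_abs[of "PVar i"] by (simp only: peval_var symh_var.abs_eq[symmetric])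
  have E_0: "E a $ 0 = a" for a
    by (induction a rule: symh_induct) (simp_all add: E_const E_var E_add E_mult)
  let ?D = "\<lambda>a. E a $ 1"
  show ?thesis
  proof (rule ex1I[of _ ?D])
    show "is_derivation ?D \<and> (\<forall>i. ?D (symh_var i) = symh_const (u i))"
      by (simp add: is_derivation_def symh_scale_def E_add E_mult E_const E_var E_0 fps_mult_nth_1
          mult_ac add_ac)
  next
    fix D :: "('n, 'k) symh \<Rightarrow> ('n, 'k) symh"
    assume D: "is_derivation D \<and> (\<forall>i. D (symh_var i) = symh_const (u i))"
    have "D 1 = D 1 * 1 + 1 * D 1"
      using D unfolding is_derivation_def by (metis mult_1)
    then have "D 1 = 0" by simp
    then have D_const: "D (symh_const r) = 0" for r
      using D unfolding is_derivation_def symh_scale_def by (metis mult.right_neutral mult_zero_right)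
    have "D a = ?D a" for a
      by (induction a rule: symh_induct)
        (use D in \<open>simp_all add: D_const is_derivation_def E_add E_mult E_const E_var E_0
          fps_mult_nth_1 mult_ac add_ac\<close>)
    then show "D = ?D" by blast
  qed
qed

definition dunkl ::
    "'k \<Rightarrow> ('n \<Rightarrow> 'k) \<Rightarrow> ('n::{finite, linorder}, 'k::field) symh \<Rightarrow> ('n, 'k) symh" where
  "dunkl c u a = dir_deriv u a -
     (\<Sum>(m, l) | m < l. symh_scale (c * (u m - u l)) (ddiff m l a))"

section \<open>The rational Cherednik algebra\<close>

text \<open>Words, with concatenation as addition, so that \<open>'a wrd \<Rightarrow>\<^sub>0 'k\<close> with the
  convolution product is the free associative unital algebra on \<open>'a\<close>.\<close>

datatype 'a wrd = Wrd (letters: "'a list")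

instantiation wrd :: (type) monoid_add
begin

definition "0 = Wrd []"
definition "v + w = Wrd (letters v @ letters w)"

instance
  by standard (simp_all add: zero_wrd_def plus_wrd_def)

end

text \<open>\<open>LX i\<close> stands for \<open>x\<^sub>i \<in> \<hh>\<^sup>*\<close>, \<open>LY i j\<close> for \<open>y\<^sub>i - y\<^sub>j \<in> \<hh>\<close>, and \<open>LG \<sigma>\<close> for \<open>\<sigma> \<in> S\<^sub>n\<close>.\<close>

datatype 'n letter = LX 'n | LY 'n 'n | LG "'n perm"

type_synonym ('n, 'k) free_alg = "'n letter wrd \<Rightarrow>\<^sub>0 'k"

definition gen :: "'n letter \<Rightarrow> ('n, 'k::field) free_alg" where
  "gen s = Poly_Mapping.single (Wrd [s]) 1"

abbreviation "gX i \<equiv> gen (LX i)"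
abbreviation "gY i j \<equiv> gen (LY i j)"
abbreviation "gG \<sigma> \<equiv> gen (LG \<sigma>)"

abbreviation scal :: "'k \<Rightarrow> ('n, 'k::field) free_alg" where
  "scal \<equiv> Poly_Mapping.single 0"

definition commutator :: "'a::ring \<Rightarrow> 'a \<Rightarrow> 'a" where
  "commutator a b = a * b - b * a"

text \<open>The relations presenting \<open>k[S\<^sub>n] \<ltimes> T(\<hh> \<oplus> \<hh>\<^sup>*)\<close>: the group law, the linear
  relations between the spanning vectors \<open>x\<^sub>i\<close> of \<open>\<hh>\<^sup>*\<close> and between the spanning vectors
  \<open>y\<^sub>i - y\<^sub>j\<close> of \<open>\<hh>\<close>, and \<open>\<sigma> v = (\<sigma> \<cdot> v) \<sigma>\<close>.\<close>

definition smash_relations :: "('n::finite, 'k::field) free_alg set" where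
  "smash_relations =
     {gG 1 - 1} \<union>
     {gG \<sigma> * gG \<tau> - gG (\<sigma> * \<tau>) | \<sigma> \<tau>. True} \<union>
     {\<Sum>i\<in>UNIV. gX i} \<union>
     {gY i j + gY j l - gY i l | i j l. True} \<union>
     {gG \<sigma> * gX i - gX (\<sigma> \<langle>$\<rangle> i) * gG \<sigma> | \<sigma> i. True} \<union>
     {gG \<sigma> * gY i j - gY (\<sigma> \<langle>$\<rangle> i) (\<sigma> \<langle>$\<rangle> j) * gG \<sigma> | \<sigma> i j. True}"

definition cherednik_relations :: "'k \<Rightarrow> ('n::finite, 'k::field) free_alg set" where
  "cherednik_relations c =
     {commutator (gX i) (gX j) | i j. True} \<union>
     {commutator (gY i j) (gY l m) | i j l m. True} \<union>
     {commutator (gY i j) (gX i) -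
        (1 - scal c * gG \<langle>i \<leftrightarrow> j\<rangle> - scal c * (\<Sum>t | t \<noteq> i. gG \<langle>i \<leftrightarrow> t\<rangle>)) | i j. i \<noteq> j} \<union>
     {commutator (gY i j) (gX l) -
        (scal c * gG \<langle>i \<leftrightarrow> l\<rangle> - scal c * gG \<langle>j \<leftrightarrow> l\<rangle>) | i j l. i \<noteq> j \<and> i \<noteq> l \<and> j \<noteq> l}"

definition cherednik :: "'k \<Rightarrow> (('n::finite, 'k::field) free_alg set) ring" where
  "cherednik c = ring_of_type_algebra Quot
     (Idl\<^bsub>ring_of_type_algebra\<^esub> (smash_relations \<union> cherednik_relations c))"

primrec letter_act ::
    "'k \<Rightarrow> 'n letter \<Rightarrow> ('n::{finite, linorder}, 'k::field) symh \<Rightarrow> ('n, 'k) symh" where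
  "letter_act c (LX i) a = symh_var i * a"
| "letter_act c (LY i j) a = dunkl c (y_diff i j) a"
| "letter_act c (LG \<sigma>) a = symh_perm \<sigma> a"

definition free_act ::
    "'k \<Rightarrow> ('n, 'k) free_alg \<Rightarrow> ('n::{finite, linorder}, 'k::field) symh \<Rightarrow> ('n, 'k) symh" where
  "free_act c w a =
     (\<Sum>v\<in>Poly_Mapping.keys w.
        symh_scale (Poly_Mapping.lookup w v) (foldr (letter_act c) (letters v) a))"

text \<open>An element of \<open>cherednik c\<close> is a coset of the ideal of relations. The operators satisfy
  the relations, so all elements of a coset act in the same way.\<close>

definition cherednik_act ::
    "'k \<Rightarrow> ('n, 'k) free_alg set \<Rightarrow> ('n::{finite, linorder}, 'k::field) symh \<Rightarrow> ('n, 'k) symh" where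
  "cherednik_act c H a = the_elem ((\<lambda>w. free_act c w a) ` H)"

section \<open>The maximal proper graded submodule and its quotient\<close>

definition cherednik_submodule ::
    "'k \<Rightarrow> ('n::{finite, linorder}, 'k::field) symh set \<Rightarrow> bool" where
  "cherednik_submodule c M \<longleftrightarrow>
     0 \<in> M \<and> (\<forall>a\<in>M. \<forall>b\<in>M. a + b \<in> M) \<and>
     (\<forall>H\<in>carrier (cherednik c). \<forall>a\<in>M. cherednik_act c H a \<in> M)"

definition graded_subset :: "('n::{finite, linorder}, 'k::field) symh set \<Rightarrow> bool" where
  "graded_subset M \<longleftrightarrow>
     (\<forall>a\<in>M. \<exists>N b. (\<forall>j<N. b j \<in> M \<inter> symh_degree j) \<and> a = (\<Sum>j<N. b j))"

definition proper_graded_submodule ::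
    "'k \<Rightarrow> ('n::{finite, linorder}, 'k::field) symh set \<Rightarrow> bool" where
  "proper_graded_submodule c M \<longleftrightarrow> cherednik_submodule c M \<and> graded_subset M \<and> M \<noteq> UNIV"

definition max_graded_submodule ::
    "'k \<Rightarrow> ('n::{finite, linorder}, 'k::field) symh set" where
  "max_graded_submodule c =
     (THE J. proper_graded_submodule c J \<and>
        (\<forall>M. proper_graded_submodule c M \<longrightarrow> J \<subseteq> M \<longrightarrow> M = J))"

text \<open>The Hilbert series of \<open>A/J\<close> for a homogeneous ideal \<open>J\<close>; the field \<open>k\<close> and the
  graded pieces of \<open>A/J\<close> are the images of \<open>k\<close> and of the graded pieces of \<open>A\<close>.\<close>

definition quotient_hilbert_series ::
    "('n::{finite, linorder}, 'k::field) symh set \<Rightarrow> rat fps" where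
  "quotient_hilbert_series J =
     (let A = ring_of_type_algebra; q = (\<lambda>a. J +>\<^bsub>A\<^esub> a)
      in Abs_fps (\<lambda>j. of_nat (ring.dim (A Quot J) (q ` range symh_const) (q ` symh_degree j))))"

section \<open>The polynomials \<open>f\<^sub>i\<close>\<close>

text \<open>The library's \<open>gchoose\<close> needs characteristic zero; the denominator below is
  invertible for \<open>m < p\<close>.\<close>

definition binom :: "'k::field \<Rightarrow> nat \<Rightarrow> 'k" where
  "binom c m = (\<Prod>i<m. c - of_nat i) / of_nat (fact m)"

definition F_series ::
    "nat \<Rightarrow> 'k \<Rightarrow> 'n \<Rightarrow> ('n::{finite, linorder}, 'k::field) symh fps" where
  "F_series p c i =
     fps_right_inverse (1 - fps_const (symh_var i) * fps_X) 1 *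
     (\<Sum>m<p. fps_const (symh_const (binom c m)) *
        ((\<Prod>j\<in>UNIV. 1 - fps_const (symh_var j) * fps_X) - 1) ^ m)"

definition f_poly ::
    "nat \<Rightarrow> 'k \<Rightarrow> 'n \<Rightarrow> ('n::{finite, linorder}, 'k::field) symh" where
  "f_poly p c i = F_series p c i $ p"

section \<open>Complete intersections\<close>

text \<open>For a finite set \<open>W\<close> of variables, \<open>poly_ring W\<close> is the polynomial ring in the variables
  \<open>W\<close>, and \<open>proj_space W\<close> is the projective space of dimension \<open>card W - 1\<close> with
  homogeneous coordinates indexed by \<open>W\<close>.\<close>

definition poly_ring :: "'v set \<Rightarrow> ('v, 'k::field) mpoly ring" where
  "poly_ring W = ring_of_type_algebra
     \<lparr>carrier := {f. \<forall>m\<in>Poly_Mapping.keys f. Poly_Mapping.keys m \<subseteq> W}\<rparr>"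

definition proj_space :: "'v set \<Rightarrow> ('v \<Rightarrow> 'k::field) set set" where
  "proj_space W =
     {{(\<lambda>i. t * v i) | t. t \<noteq> 0} | v. (\<forall>i. i \<notin> W \<longrightarrow> v i = 0) \<and> (\<exists>i\<in>W. v i \<noteq> 0)}"

definition proj_zeros :: "'v set \<Rightarrow> ('v, 'k::field) mpoly set \<Rightarrow> ('v \<Rightarrow> 'k) set set" where
  "proj_zeros W S = {P \<in> proj_space W. \<forall>f\<in>S. \<forall>v\<in>P. peval id v f = 0}"

definition proj_closed :: "'v set \<Rightarrow> ('v \<Rightarrow> 'k::field) set set \<Rightarrow> bool" where
  "proj_closed W Z \<longleftrightarrow>
     (\<exists>S \<subseteq> carrier (poly_ring W). (\<forall>f\<in>S. \<exists>d. homogeneous d f) \<and> Z = proj_zeros W S)"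

definition proj_irreducible :: "'v set \<Rightarrow> ('v \<Rightarrow> 'k::field) set set \<Rightarrow> bool" where
  "proj_irreducible W Z \<longleftrightarrow> proj_closed W Z \<and> Z \<noteq> {} \<and>
     (\<forall>Z1 Z2. proj_closed W Z1 \<longrightarrow> proj_closed W Z2 \<longrightarrow> Z = Z1 \<union> Z2 \<longrightarrow> Z = Z1 \<or> Z = Z2)"

text \<open>\<open>Z\<^sub>0 \<subset> \<dots> \<subset> Z\<^sub>d\<close> is a list of length \<open>d + 1\<close>; for empty \<open>V\<close> only the empty list
  remains, which gives dimension \<open>-1\<close>.\<close>

definition proj_chain :: "'v set \<Rightarrow> ('v \<Rightarrow> 'k::field) set set \<Rightarrow> ('v \<Rightarrow> 'k) set set list \<Rightarrow> bool" where
  "proj_chain W V Zs \<longleftrightarrow> sorted_wrt (\<subset>) Zs \<and> (\<forall>Z\<in>set Zs. proj_irreducible W Z \<and> Z \<subseteq> V)"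

definition proj_has_dim :: "'v set \<Rightarrow> ('v \<Rightarrow> 'k::field) set set \<Rightarrow> int \<Rightarrow> bool" where
  "proj_has_dim W V d \<longleftrightarrow>
     (\<exists>Zs. proj_chain W V Zs \<and> d = int (length Zs) - 1) \<and>
     (\<forall>Zs. proj_chain W V Zs \<longrightarrow> int (length Zs) - 1 \<le> d)"

text \<open>Minimal sets of generators are taken to consist of homogeneous polynomials; all of them
  then have the same size.\<close>

definition complete_intersection :: "'v set \<Rightarrow> ('v, 'k::field) mpoly set \<Rightarrow> bool" where
  "complete_intersection W I \<longleftrightarrow>
     (\<exists>S. finite S \<and> S \<subseteq> carrier (poly_ring W) \<and> (\<forall>f\<in>S. \<exists>d. homogeneous d f) \<and>
        I = Idl\<^bsub>poly_ring W\<^esub> S \<and> (\<forall>T. T \<subset> S \<longrightarrow> Idl\<^bsub>poly_ring W\<^esub> T \<noteq> I) \<and>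
        proj_has_dim W (proj_zeros W I) (int (card W) - 1 - int (card S)))"

text \<open>The isomorphism of \<open>A\<close> with the polynomial ring in \<open>x\<^sub>1, \<dots>, x\<^sub>n\<^sub>-\<^sub>1\<close>, which sends
  \<open>x\<^sub>n\<close> to \<open>-x\<^sub>1 - \<dots> - x\<^sub>n\<^sub>-\<^sub>1\<close>.\<close>

definition initial_indices :: "'n::{finite, linorder} set" where
  "initial_indices = {i. i < Max UNIV}"

lift_definition elim_last :: "('n::{finite, linorder}, 'k::field) symh \<Rightarrow> ('n, 'k) mpoly"
  is "peval PConst (\<lambda>i. if i \<in> initial_indices then PVar i else - (\<Sum>j\<in>initial_indices. PVar j))"
proof -
  let ?g = "\<lambda>i::'n. if i \<in> initial_indices then PVar i else
      - (\<Sum>j\<in>initial_indices. PVar j) :: ('n, 'k) mpoly"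
  fix f g :: "('n, 'k) mpoly"
  have UNIV_eq: "insert (Max UNIV) (initial_indices :: 'n set) = UNIV"
    by (auto simp: initial_indices_def order.not_eq_order_implies_strict)
  have not_in: "Max UNIV \<notin> (initial_indices :: 'n set)"
    by (simp add: initial_indices_def)
  have "sum ?g (insert (Max UNIV) initial_indices) = ?g (Max UNIV) + sum ?g initial_indices"
    by (rule sum.insert) (simp_all add: not_in)
  then have "sum ?g UNIV = ?g (Max UNIV) + sum ?g initial_indices"
    by (simp only: UNIV_eq)
  also have "\<dots> = 0"
    using not_in by simp
  finally have var_sum_0: "peval PConst ?g var_sum = 0"
    by (simp only: var_sum_def coeff_hom_PConst.peval_sum coeff_hom_PConst.peval_var)
  assume "var_sum dvd f - g"
  then obtain q where "f - g = var_sum * q" by (elim dvdE)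
  then have "peval PConst ?g f - peval PConst ?g g = peval PConst ?g var_sum * peval PConst ?g q"
    by (simp only: flip: coeff_hom_PConst.peval_diff coeff_hom_PConst.peval_mult)
  then show "peval PConst ?g f = peval PConst ?g g"
    by (simp add: var_sum_0)
qed

end

theory Submission
  imports Defs
begin

text \<open>
  Write \<open>I\<^sub>c\<close> for the ideal generated by the \<open>f\<^sub>i\<close>, and call a monomial in \<open>x\<^sub>1, \<dots>, x\<^sub>n\<^sub>-\<^sub>1\<close> reduced if all
  its exponents are less than \<open>p\<close>. Three facts carry the proof.

  First, the \<open>f\<^sub>i\<close> are singular vectors for every \<open>c\<close> (\<open>dunkl_f_poly\<close>). The series \<open>F\<^sub>i\<close> is
  \<open>1/(1 - x\<^sub>i z)\<close> times a truncation of \<open>P\<^sup>c\<close> with \<open>P = \<Prod>\<^sub>j (1 - x\<^sub>j z)\<close>. Since \<open>\<Sum>\<^sub>j x\<^sub>j = 0\<close>, the series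
  \<open>P - 1\<close> is divisible by \<open>z\<^sup>2\<close>, and derivations do not notice the truncation up to order \<open>z\<^sup>p\<close>
  (\<open>deriv_trunc_power\<close>). A direct computation, which uses \<open>n = 0\<close> in \<open>k\<close>, then gives
  \<open>D\<^sub>y F\<^sub>i = \<langle>y, x\<^sub>i\<rangle> z (z d/dz + 1) F\<^sub>i\<close> modulo \<open>z\<^sup>p\<^sup>+\<^sup>1\<close>, where the coefficient of \<open>z\<^sup>p\<close> on the right is a
  multiple of \<open>p\<close> (\<open>fps_op_dunkl_F_series\<close>). Therefore \<open>I\<^sub>c\<close> is a proper graded submodule for
  \<open>c \<noteq> 0\<close> (\<open>proper_graded_f_ideal\<close>).

  Second, everything is transparent at \<open>c = 0\<close>: there \<open>f\<^sub>i = x\<^sub>i\<^sup>p\<close> and \<open>D\<^sub>y = \<partial>\<^sub>y\<close>, the reduced monomials are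
  a basis of \<open>A/I\<^sub>0\<close>, and the pairing that sends \<open>(b, a)\<close> to the constant term of \<open>D\<^sup>b x\<^sup>a\<close> is diagonal
  on reduced exponents, with nonzero entries \<open>\<Prod>\<^sub>i a\<^sub>i!\<close>. For general \<open>c\<close> the matrices in question have
  entries that are polynomial in \<open>c\<close>; being invertible at \<open>c = 0\<close>, they are invertible outside a
  finite set (\<open>generic_solvable\<close>). So for generic \<open>c\<close> the reduced monomials span \<open>A\<close> modulo
  \<open>I\<^sub>c\<close> (\<open>generic_span\<close>), the pairing on them is nondegenerate (\<open>generic_pairing\<close>), and the \<open>f\<^sub>i\<close>
  are linearly independent (\<open>generic_f_poly_independent\<close>).

  Third, these properties determine \<open>J\<^sub>c\<close>. A proper graded submodule \<open>M\<close> has no element with a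
  nonzero constant term (\<open>augmentation_proper_graded\<close>), and it is stable under all \<open>D\<^sup>b\<close>. Modulo \<open>I\<^sub>c\<close>
  an element of \<open>M\<close> is a combination of reduced monomials that is orthogonal to all \<open>D\<^sup>b\<close>, hence
  zero. So \<open>M \<subseteq> I\<^sub>c\<close>, which means \<open>J\<^sub>c = I\<^sub>c\<close> (\<open>max_graded_submodule_eq\<close>). The same argument
  shows that the reduced monomials are a basis of \<open>A/J\<^sub>c\<close>, and counting them by degree gives the
  Hilbert series. There are finitely many of them, so \<open>I\<^sub>c\<close> contains a power of every variable and
  has no projective zeros, as required for a complete intersection with \<open>n - 1\<close> minimal generators in
  \<open>n - 1\<close> variables.

  That the Dunkl operators define an action of the Cherednik algebra at all is part of the
  proof, because the algebra is given by generators and relations. The point is the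
  commutativity of the Dunkl operators (\<open>dunkl_commute\<close>).\<close>

abbreviation lookup :: "('a \<Rightarrow>\<^sub>0 'b::zero) \<Rightarrow> 'a \<Rightarrow> 'b" where
  "lookup \<equiv> Poly_Mapping.lookup"

abbreviation keys :: "('a \<Rightarrow>\<^sub>0 'b::zero) \<Rightarrow> 'a set" where
  "keys \<equiv> Poly_Mapping.keys"

abbreviation single :: "'a \<Rightarrow> 'b \<Rightarrow> 'a \<Rightarrow>\<^sub>0 'b::zero" where
  "single \<equiv> Poly_Mapping.single"

section \<open>Operators on the algebra\<close>

lemma symh_const_diff: "symh_const (r - s) = symh_const r - symh_const s"
  by (metis add_diff_cancel_right' diff_add_cancel symh_scale_simps(1))

lemma symh_const_minus: "symh_const (- s) = - symh_const s"
  by (metis diff_0 symh_const_diff symh_scale_simps(3))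

lemma symh_const_power: "symh_const (r ^ k) = symh_const r ^ k"
  by (induction k) (simp_all add: symh_scale_simps)

lemma symh_const_sum: "symh_const (sum f S) = (\<Sum>s\<in>S. symh_const (f s))"
  by (induction S rule: infinite_finite_induct) (simp_all add: symh_scale_simps)

lemma symh_const_of_nat: "symh_const (of_nat k) = of_nat k"
  by (induction k) (simp_all add: symh_scale_simps)

lemmas symh_const_hom = symh_scale_simps symh_const_diff symh_const_minus symh_const_power
  symh_const_sum symh_const_of_nat

lemma symh_perm_const [simp]: "symh_perm \<sigma> (symh_const r) = symh_const r"
  by transfer (rule dvd_diff_eqI, rule coeff_hom_PConst.peval_const)

lemma symh_perm_var [simp]: "symh_perm \<sigma> (symh_var i) = symh_var (\<sigma> \<langle>$\<rangle> i)"
  by transfer (rule dvd_diff_eqI, rule coeff_hom_PConst.peval_var)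

lemma symh_perm_add [simp]: "symh_perm \<sigma> (a + b) = symh_perm \<sigma> a + symh_perm \<sigma> b"
  by transfer (rule dvd_diff_eqI, rule coeff_hom_PConst.peval_add)

lemma symh_perm_mult [simp]: "symh_perm \<sigma> (a * b) = symh_perm \<sigma> a * symh_perm \<sigma> b"
  by transfer (rule dvd_diff_eqI, rule coeff_hom_PConst.peval_mult)

lemma symh_perm_0 [simp]: "symh_perm \<sigma> 0 = 0"
  by (metis add_cancel_right_right symh_perm_add)

lemma symh_perm_1 [simp]: "symh_perm \<sigma> 1 = 1"
  by (metis symh_perm_const symh_scale_simps(4))

lemma symh_perm_diff [simp]: "symh_perm \<sigma> (a - b) = symh_perm \<sigma> a - symh_perm \<sigma> b"
  by (metis add_diff_cancel_right' diff_add_cancel symh_perm_add)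

lemma symh_perm_sum [simp]: "symh_perm \<sigma> (sum f S) = (\<Sum>s\<in>S. symh_perm \<sigma> (f s))"
  by (induction S rule: infinite_finite_induct) simp_all

lemma symh_perm_scale [simp]: "symh_perm \<sigma> (symh_scale r a) = symh_scale r (symh_perm \<sigma> a)"
  by (simp add: symh_scale_def)

lemma symh_perm_id [simp]: "symh_perm 1 a = a"
  by (induction a rule: symh_induct) simp_all

lemma symh_perm_comp: "symh_perm \<sigma> (symh_perm \<tau> a) = symh_perm (\<sigma> * \<tau>) a"
  by (induction a rule: symh_induct) (simp_all add: apply_times)

lemma symh_scale_add_right: "symh_scale r (a + b) = symh_scale r a + symh_scale r b"
  by (simp add: symh_scale_def algebra_simps)

lemma symh_scale_diff_right: "symh_scale r (a - b) = symh_scale r a - symh_scale r b"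
  by (simp add: symh_scale_def algebra_simps)

lemma symh_scale_add_left: "symh_scale (r + s) a = symh_scale r a + symh_scale s a"
  by (simp add: symh_scale_def symh_const_hom algebra_simps)

lemma symh_scale_scale: "symh_scale r (symh_scale s a) = symh_scale (r * s) a"
  by (simp add: symh_scale_def symh_const_hom algebra_simps)

lemma symh_scale_0 [simp]: "symh_scale 0 a = 0" "symh_scale r 0 = 0"
  by (simp_all add: symh_scale_def symh_const_hom)

lemma symh_scale_1 [simp]: "symh_scale 1 a = a"
  by (simp add: symh_scale_def symh_const_hom)

lemma symh_scale_sum: "symh_scale r (sum f S) = (\<Sum>s\<in>S. symh_scale r (f s))"
  by (simp add: symh_scale_def sum_distrib_left)

lemma symh_scale_mult_right: "a * symh_scale r b = symh_scale r (a * b)"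
  by (simp add: symh_scale_def mult_ac)

subsection \<open>Divided differences\<close>

lemma poly_swap_add: "poly_swap m l (f + g) = poly_swap m l f + poly_swap m l g"
  by (simp add: poly_swap_def coeff_hom_PConst.peval_add)

lemma poly_swap_mult: "poly_swap m l (f * g) = poly_swap m l f * poly_swap m l g"
  by (simp add: poly_swap_def coeff_hom_PConst.peval_mult)

context
  fixes m l :: "'n::{finite, linorder}"
  assumes ml: "m \<noteq> l"
begin

lemma ddiff_add: "ddiff m l (a + b :: ('n, 'k::field) symh) = ddiff m l a + ddiff m l b"
proof (transfer fixing: m l, rule dvd_diff_eqI)
  fix f g :: "('n, 'k) mpoly"
  have "(PVar m - PVar l) * (ddiff_poly m l f + ddiff_poly m l g)
     = f + g - poly_swap m l (f + g)"
    unfolding distrib_left ddiff_poly_eq[OF ml] by (simp add: poly_swap_add)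
  then show "ddiff_poly m l (f + g) = ddiff_poly m l f + ddiff_poly m l g"
    by (rule ddiff_poly_eqI[OF ml])
qed

text \<open>The divided difference is a derivation twisted by the transposition. On \<open>A\<close> this rule and
  the values on constants and variables determine \<open>ddiff\<close>; the quotient
  \<open>(f - s f)/(x\<^sub>m - x\<^sub>l)\<close> does not, since \<open>x\<^sub>m - x\<^sub>l\<close> can be a zero divisor in \<open>A\<close>: for
  \<open>n = 2\<close> in characteristic 2 it is zero. Hence these rules are proved for polynomials.\<close>

lemma ddiff_mult:
  "ddiff m l (a * b :: ('n, 'k::field) symh) = ddiff m l a * b + symh_perm \<langle>m \<leftrightarrow> l\<rangle> a * ddiff m l b"
proof (transfer fixing: m l, fold poly_swap_def, rule dvd_diff_eqI)
  fix f g :: "('n, 'k) mpoly"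
  have "(PVar m - PVar l) * (ddiff_poly m l f * g + poly_swap m l f * ddiff_poly m l g)
     = ((PVar m - PVar l) * ddiff_poly m l f) * g +
       poly_swap m l f * ((PVar m - PVar l) * ddiff_poly m l g)"
    by (simp add: algebra_simps)
  also have "\<dots> = f * g - poly_swap m l (f * g)"
    unfolding ddiff_poly_eq[OF ml] by (simp add: poly_swap_mult algebra_simps)
  finally show "ddiff_poly m l (f * g) = ddiff_poly m l f * g + poly_swap m l f * ddiff_poly m l g"
    by (rule ddiff_poly_eqI[OF ml])
qed

lemma ddiff_const [simp]: "ddiff m l (symh_const r :: ('n, 'k::field) symh) = 0"
  by (transfer fixing: m l, rule dvd_diff_eqI, rule ddiff_poly_eqI[OF ml])
    (simp add: poly_swap_def coeff_hom_PConst.peval_const)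

lemma ddiff_var:
  "ddiff m l (symh_var i :: ('n, 'k::field) symh) = of_bool (i = m) - of_bool (i = l)"
proof -
  have "ddiff_poly m l (PVar i :: ('n, 'k) mpoly) = of_bool (i = m) - of_bool (i = l)"
  proof (rule ddiff_poly_eqI[OF ml])
    show "(PVar m - PVar l) * (of_bool (i = m) - of_bool (i = l)) =
      PVar i - poly_swap m l (PVar i :: ('n, 'k) mpoly)"
      using ml by (cases "i = m"; cases "i = l")
        (simp_all add: poly_swap_def coeff_hom_PConst.peval_var)
  qed
  moreover have "abs_symh (of_bool P - of_bool Q) = (of_bool P - of_bool Q :: ('n, 'k) symh)" for P Q
    by (cases P; cases Q)
      (simp_all add: zero_symh_def one_symh_def minus_symh.abs_eq uminus_symh.abs_eq)
  ultimately show ?thesis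
    by (simp add: symh_var_def ddiff.abs_eq)
qed

lemma ddiff_0 [simp]: "ddiff m l (0 :: ('n, 'k::field) symh) = 0"
  by (metis ddiff_const symh_scale_simps(3))

lemma ddiff_1 [simp]: "ddiff m l (1 :: ('n, 'k::field) symh) = 0"
  by (metis ddiff_const symh_scale_simps(4))

lemma ddiff_scale: "ddiff m l (symh_scale r a :: ('n, 'k::field) symh) = symh_scale r (ddiff m l a)"
  by (simp add: symh_scale_def ddiff_mult)

end

lemma perm_apply_eq_iff [simp]: "\<sigma> \<langle>$\<rangle> a = \<sigma> \<langle>$\<rangle> b \<longleftrightarrow> a = b"
  using bij_is_inj[OF bij_apply, of \<sigma>] by (simp add: inj_eq)

lemma perm_inverse_apply [simp]:
  "inverse \<sigma> \<langle>$\<rangle> (\<sigma> \<langle>$\<rangle> a) = a" "\<sigma> \<langle>$\<rangle> (inverse \<sigma> \<langle>$\<rangle> a) = a"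
  by (simp_all add: apply_inverse bij_is_inj[OF bij_apply] bij_is_surj[OF bij_apply] surj_f_inv_f)

lemma perm_swap_conj: "\<sigma> * \<langle>m \<leftrightarrow> l\<rangle> = \<langle>\<sigma> \<langle>$\<rangle> m \<leftrightarrow> \<sigma> \<langle>$\<rangle> l\<rangle> * \<sigma>"
proof (rule perm_eqI)
  fix a
  show "(\<sigma> * \<langle>m \<leftrightarrow> l\<rangle>) \<langle>$\<rangle> a = (\<langle>\<sigma> \<langle>$\<rangle> m \<leftrightarrow> \<sigma> \<langle>$\<rangle> l\<rangle> * \<sigma>) \<langle>$\<rangle> a"
    by (cases "a = m"; cases "a = l") (simp_all add: apply_times)
qed

lemma symh_perm_ddiff:
  assumes "m \<noteq> l"
  shows "symh_perm \<sigma> (ddiff m l a) = ddiff (\<sigma> \<langle>$\<rangle> m) (\<sigma> \<langle>$\<rangle> l) (symh_perm \<sigma> a)"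
proof -
  have ne: "\<sigma> \<langle>$\<rangle> m \<noteq> \<sigma> \<langle>$\<rangle> l" using assms by simp
  have b: "symh_perm \<sigma> (of_bool P) = of_bool P" for P by (cases P) simp_all
  show ?thesis
  proof (induction a rule: symh_induct)
    case (mult a b)
    then show ?case
      by (simp add: ddiff_mult assms ne symh_perm_comp perm_swap_conj)
  qed (simp_all add: assms ne ddiff_var ddiff_add b)
qed

lemma ddiff_swap:
  assumes "m \<noteq> l"
  shows "ddiff l m a = - ddiff m l a"
  by (induction a rule: symh_induct)
    (simp_all add: assms assms[symmetric] ddiff_var ddiff_add ddiff_mult swap_sym[of l m])

subsection \<open>Directional derivatives\<close>

context
  fixes u :: "'n::{finite, linorder} \<Rightarrow> 'k::field"
  assumes u: "sum u UNIV = 0"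
begin

lemma dir_deriv_spec:
  "is_derivation (dir_deriv u :: ('n, 'k) symh \<Rightarrow> _)" "dir_deriv u (symh_var i) = symh_const (u i)"
  using theI'[OF dir_deriv_ex1[OF u]] by (auto simp: dir_deriv_def)

lemma dir_deriv_add: "dir_deriv u (a + b) = dir_deriv u a + dir_deriv u b"
  using dir_deriv_spec(1) by (simp add: is_derivation_def)

lemma dir_deriv_scale: "dir_deriv u (symh_scale r a) = symh_scale r (dir_deriv u a)"
  using dir_deriv_spec(1) by (simp add: is_derivation_def)

lemma dir_deriv_mult: "dir_deriv u (a * b) = dir_deriv u a * b + a * dir_deriv u b"
  using dir_deriv_spec(1) by (simp add: is_derivation_def)

lemma dir_deriv_1 [simp]: "dir_deriv u 1 = 0"
proof -
  have "dir_deriv u (1 * 1) = dir_deriv u 1 * 1 + 1 * dir_deriv u 1"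
    by (rule dir_deriv_mult)
  then show ?thesis by simp
qed

lemma dir_deriv_const [simp]: "dir_deriv u (symh_const r) = 0"
  using dir_deriv_scale[of r 1] by (simp add: symh_scale_def)

lemma dir_deriv_0 [simp]: "dir_deriv u 0 = 0"
  by (metis dir_deriv_const symh_scale_simps(3))

end

lemma dir_deriv_perm:
  fixes u :: "'n::{finite, linorder} \<Rightarrow> 'k::field"
  assumes u: "sum u UNIV = 0"
  shows "symh_perm \<sigma> (dir_deriv u a) = dir_deriv (\<lambda>i. u (inverse \<sigma> \<langle>$\<rangle> i)) (symh_perm \<sigma> a)"
proof -
  have u': "(\<Sum>i\<in>UNIV. u (inverse \<sigma> \<langle>$\<rangle> i)) = 0"
    using u sum.reindex_bij_betw[OF bij_apply, of u "inverse \<sigma>"] by simp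
  show ?thesis
    by (induction a rule: symh_induct)
      (simp_all add: dir_deriv_spec dir_deriv_add dir_deriv_mult u u')
qed

lemma dir_deriv_add_vec:
  fixes u v :: "'n::{finite, linorder} \<Rightarrow> 'k::field"
  assumes "sum u UNIV = 0" "sum v UNIV = 0"
  shows "dir_deriv (\<lambda>i. u i + r * v i) a = dir_deriv u a + symh_scale r (dir_deriv v a)"
proof -
  have uv: "(\<Sum>i\<in>UNIV. u i + r * v i) = 0"
    using assms by (simp add: sum.distrib flip: sum_distrib_left)
  show ?thesis
    by (induction a rule: symh_induct)
      (simp_all add: dir_deriv_spec dir_deriv_add dir_deriv_mult uv assms symh_scale_def
        symh_const_hom algebra_simps)
qed

section \<open>The Dunkl operators satisfy the Cherednik relations\<close>

text \<open>The sum in the Dunkl operator runs over unordered pairs, each written with its smaller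
  entry first. A permutation need not respect this choice, so the summand has to be
  symmetric. Summing over all ordered pairs and halving would fail in characteristic 2.\<close>

lemma sum_pairs_perm:
  fixes G :: "'n::{finite, linorder} \<Rightarrow> 'n \<Rightarrow> 'a::comm_monoid_add"
  assumes sym: "\<And>m l. m \<noteq> l \<Longrightarrow> G m l = G l m"
  shows "(\<Sum>(m, l) | m < l. G (\<sigma> \<langle>$\<rangle> m) (\<sigma> \<langle>$\<rangle> l)) = (\<Sum>(m, l) | m < l. G m l)"
proof -
  let ?ord = "\<lambda>\<tau> (m, l). if \<tau> \<langle>$\<rangle> m < \<tau> \<langle>$\<rangle> l then (\<tau> \<langle>$\<rangle> m, \<tau> \<langle>$\<rangle> l) else (\<tau> \<langle>$\<rangle> l, \<tau> \<langle>$\<rangle> m :: 'n)"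
  show ?thesis
  proof (rule sum.reindex_bij_witness[where i = "?ord (inverse \<sigma>)" and j = "?ord \<sigma>"])
  fix x :: "'n \<times> 'n" assume x: "x \<in> {(m, l). m < l}"
  then obtain m l where ml: "x = (m, l)" "m < l" by auto
  have ne: "\<tau> \<langle>$\<rangle> m \<noteq> \<tau> \<langle>$\<rangle> l" for \<tau> :: "'n perm" using ml by simp
  have less: "\<tau> \<langle>$\<rangle> m < \<tau> \<langle>$\<rangle> l \<or> \<tau> \<langle>$\<rangle> l < \<tau> \<langle>$\<rangle> m" for \<tau> :: "'n perm"
    using ne[of \<tau>] by (simp only: linorder_neq_iff)
  show "?ord (inverse \<sigma>) (?ord \<sigma> x) = x"
    using ml by (auto simp: not_less)
  show "?ord \<sigma> (?ord (inverse \<sigma>) x) = x"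
    using ml by (auto simp: not_less)
  show "?ord \<sigma> x \<in> {(m, l). m < l}" "?ord (inverse \<sigma>) x \<in> {(m, l). m < l}"
    using ml less[of \<sigma>] less[of "inverse \<sigma>"] by auto
  show "(case ?ord \<sigma> x of (m, l) \<Rightarrow> G m l) = (case x of (m, l) \<Rightarrow> G (\<sigma> \<langle>$\<rangle> m) (\<sigma> \<langle>$\<rangle> l))"
    using ml ne[of \<sigma>] sym by auto
  qed
qed

text \<open>For a variable \<open>x\<^sub>i\<close> or the series \<open>1/(1 - x\<^sub>i z)\<close>, only the reflections that move
  \<open>i\<close> contribute to the Dunkl operator.\<close>

lemma sum_pairs_at:
  fixes G :: "'n::{finite, linorder} \<Rightarrow> 'n \<Rightarrow> 'a::comm_monoid_add"
  assumes sym: "\<And>m l. m \<noteq> l \<Longrightarrow> G m l = G l m"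
    and zero: "\<And>m l. m \<noteq> i \<Longrightarrow> l \<noteq> i \<Longrightarrow> G m l = 0"
  shows "(\<Sum>(m, l) | m < l. G m l) = (\<Sum>t | t \<noteq> i. G i t)"
proof -
  have "(\<Sum>(m, l) | m < l. G m l) = (\<Sum>(m, l) \<in> (\<lambda>t. (min i t, max i t)) ` {t. t \<noteq> i}. G m l)"
  proof (rule sum.mono_neutral_right)
    show "(\<lambda>t. (min i t, max i t)) ` {t. t \<noteq> i} \<subseteq> {(m, l). m < l}"
      by (auto simp: min_def max_def)
    show "\<forall>x\<in>{(m, l). m < l} - (\<lambda>t. (min i t, max i t)) ` {t. t \<noteq> i}. (case x of (m, l) \<Rightarrow> G m l) = 0"
    proof
      fix x assume x: "x \<in> {(m, l). m < l} - (\<lambda>t. (min i t, max i t)) ` {t. t \<noteq> i}"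
      then obtain m l where ml: "x = (m, l)" "m < l" by auto
      have "(min i t, max i t) \<noteq> (m, l)" if "t \<noteq> i" for t
        using x ml that by (metis (mono_tags, lifting) DiffD2 imageI mem_Collect_eq)
      from this[of l] this[of m] have "m \<noteq> i" "l \<noteq> i"
        using ml(2) by (auto simp: min_def max_def less_le split: if_splits)
      then show "(case x of (m, l) \<Rightarrow> G m l) = 0" using ml zero by simp
    qed
  qed simp
  also have "\<dots> = (\<Sum>t | t \<noteq> i. case (min i t, max i t) of (m, l) \<Rightarrow> G m l)"
    by (rule sum.reindex_cong[OF _ refl refl]) (auto simp: inj_on_def min_def max_def split: if_splits)
  also have "\<dots> = (\<Sum>t | t \<noteq> i. G i t)"
    by (rule sum.cong) (use sym in \<open>auto simp: min_def max_def\<close>)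
  finally show ?thesis .
qed

context
  fixes c :: "'k::field"
begin

lemma dunkl_add:
  fixes a b :: "('n::{finite, linorder}, 'k) symh"
  assumes "sum u UNIV = 0"
  shows "dunkl c u (a + b) = dunkl c u a + dunkl c u b"
proof -
  have "(\<Sum>(m, l) | m < l. symh_scale (c * (u m - u l)) (ddiff m l (a + b)))
    = (\<Sum>(m, l) | m < l. symh_scale (c * (u m - u l)) (ddiff m l a)) +
      (\<Sum>(m, l) | m < l. symh_scale (c * (u m - u l)) (ddiff m l b))"
    unfolding sum.distrib[symmetric]
    by (rule sum.cong) (auto simp: ddiff_add symh_scale_add_right)
  then show ?thesis
    by (simp add: dunkl_def dir_deriv_add assms)
qed

lemma dunkl_scale:
  fixes a :: "('n::{finite, linorder}, 'k) symh"
  assumes "sum u UNIV = 0"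
  shows "dunkl c u (symh_scale r a) = symh_scale r (dunkl c u a)"
proof -
  have "(\<Sum>(m, l) | m < l. symh_scale (c * (u m - u l)) (ddiff m l (symh_scale r a)))
    = symh_scale r (\<Sum>(m, l) | m < l. symh_scale (c * (u m - u l)) (ddiff m l a))"
    unfolding symh_scale_sum
    by (rule sum.cong) (auto simp: ddiff_scale symh_scale_scale mult_ac)
  then show ?thesis
    by (simp add: dunkl_def dir_deriv_scale assms symh_scale_diff_right)
qed

lemma dunkl_0 [simp]:
  assumes "sum u UNIV = 0"
  shows "dunkl c u (0 :: ('n::{finite, linorder}, 'k) symh) = 0"
  using dunkl_scale[OF assms, of 0 0] by simp

lemma dunkl_diff:
  fixes a b :: "('n::{finite, linorder}, 'k) symh"
  assumes "sum u UNIV = 0"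
  shows "dunkl c u (a - b) = dunkl c u a - dunkl c u b"
  by (metis add_diff_cancel_right' diff_add_cancel dunkl_add[OF assms])

lemma dunkl_sum:
  fixes f :: "'s \<Rightarrow> ('n::{finite, linorder}, 'k) symh"
  assumes "sum u UNIV = 0"
  shows "dunkl c u (sum f S) = (\<Sum>s\<in>S. dunkl c u (f s))"
  by (induction S rule: infinite_finite_induct) (simp_all add: assms dunkl_add)

text \<open>With the two factors exchanged in the twisted product rule, the reflections act on \<open>b\<close> only
  and \<open>a\<close> stands untouched in front of \<open>D\<^sub>u b\<close>. This is the form that is needed both for \<open>a = x\<^sub>i\<close>
  and for a singular vector \<open>b\<close>.\<close>

lemma dunkl_mult:
  fixes a b :: "('n::{finite, linorder}, 'k) symh"
  assumes "sum u UNIV = 0"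
  shows "dunkl c u (a * b) = a * dunkl c u b + dir_deriv u a * b -
    (\<Sum>(m, l) | m < l. symh_scale (c * (u m - u l)) (ddiff m l a * symh_perm \<langle>m \<leftrightarrow> l\<rangle> b))"
proof -
  have "(\<Sum>(m, l) | m < l. symh_scale (c * (u m - u l)) (ddiff m l (a * b)))
    = (\<Sum>(m, l) | m < l. a * symh_scale (c * (u m - u l)) (ddiff m l b)) +
      (\<Sum>(m, l) | m < l. symh_scale (c * (u m - u l)) (ddiff m l a * symh_perm \<langle>m \<leftrightarrow> l\<rangle> b))"
    unfolding sum.distrib[symmetric]
  proof (rule sum.cong[OF refl], clarify)
    fix m l :: 'n assume "m < l"
    then have "ddiff m l (b * a) = ddiff m l b * a + symh_perm \<langle>m \<leftrightarrow> l\<rangle> b * ddiff m l a"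
      by (simp add: ddiff_mult)
    then show "symh_scale (c * (u m - u l)) (ddiff m l (a * b)) =
      a * symh_scale (c * (u m - u l)) (ddiff m l b) +
      symh_scale (c * (u m - u l)) (ddiff m l a * symh_perm \<langle>m \<leftrightarrow> l\<rangle> b)"
      unfolding mult.commute[of a b] by (simp add: symh_scale_def algebra_simps)
  qed
  also have "(\<Sum>(m, l) | m < l. a * symh_scale (c * (u m - u l)) (ddiff m l b)) =
    a * (\<Sum>(m, l) | m < l. symh_scale (c * (u m - u l)) (ddiff m l b))"
    unfolding sum_distrib_left by (rule sum.cong) auto
  finally show ?thesis
    by (simp add: dunkl_def dir_deriv_mult assms algebra_simps)
qed

text \<open>The commutation relation between \<open>\<hh>\<close> and \<open>\<hh>\<^sup>*\<close> in the form that does not depend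
  on the chosen spanning vectors: both relations of the Cherednik algebra between some
  \<open>y\<^sub>i - y\<^sub>j\<close> and some \<open>x\<^sub>l\<close> are special cases.\<close>

lemma dunkl_var_mult:
  fixes a :: "('n::{finite, linorder}, 'k) symh"
  assumes "sum u UNIV = 0"
  shows "dunkl c u (symh_var i * a) = symh_var i * dunkl c u a + symh_scale (u i) a -
    (\<Sum>t | t \<noteq> i. symh_scale (c * (u i - u t)) (symh_perm \<langle>i \<leftrightarrow> t\<rangle> a))"
proof -
  define d :: "'n \<Rightarrow> 'n \<Rightarrow> ('n, 'k) symh" where "d m l = of_bool (i = m) - of_bool (i = l)" for m l
  let ?G = "\<lambda>m l. symh_scale (c * (u m - u l)) (d m l * symh_perm \<langle>m \<leftrightarrow> l\<rangle> a)"
  have "(\<Sum>(m, l) | m < l. symh_scale (c * (u m - u l)) (ddiff m l (symh_var i) * symh_perm \<langle>m \<leftrightarrow> l\<rangle> a))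
    = (\<Sum>(m, l) | m < l. ?G m l)"
    by (rule sum.cong) (auto simp: ddiff_var d_def)
  also have "\<dots> = (\<Sum>t | t \<noteq> i. ?G i t)"
  proof (rule sum_pairs_at)
    fix m l :: 'n
    show "?G m l = ?G l m"
      by (simp add: d_def swap_sym[of l m] symh_scale_def symh_const_hom algebra_simps)
  qed (simp add: d_def)
  also have "\<dots> = (\<Sum>t | t \<noteq> i. symh_scale (c * (u i - u t)) (symh_perm \<langle>i \<leftrightarrow> t\<rangle> a))"
    by (rule sum.cong) (auto simp: d_def)
  finally show ?thesis
    by (simp add: dunkl_mult assms dir_deriv_spec symh_scale_def)
qed

lemma symh_perm_dunkl:
  fixes a :: "('n::{finite, linorder}, 'k) symh"
  assumes u: "sum u UNIV = 0"
  shows "symh_perm \<sigma> (dunkl c u a) = dunkl c (\<lambda>i. u (inverse \<sigma> \<langle>$\<rangle> i)) (symh_perm \<sigma> a)"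
proof -
  let ?u' = "\<lambda>i. u (inverse \<sigma> \<langle>$\<rangle> i)"
  let ?G = "\<lambda>m l. symh_scale (c * (?u' m - ?u' l)) (ddiff m l (symh_perm \<sigma> a))"
  have "(\<Sum>(m, l) | m < l. symh_perm \<sigma> (symh_scale (c * (u m - u l)) (ddiff m l a)))
    = (\<Sum>(m, l) | m < l. ?G (\<sigma> \<langle>$\<rangle> m) (\<sigma> \<langle>$\<rangle> l))"
    by (rule sum.cong) (auto simp: symh_perm_ddiff)
  also have "\<dots> = (\<Sum>(m, l) | m < l. ?G m l)"
  proof (rule sum_pairs_perm)
    fix m l :: 'n assume "m \<noteq> l"
    then show "?G m l = ?G l m"
      by (simp add: ddiff_swap[of l m] symh_scale_def symh_const_hom algebra_simps)
  qed
  finally show ?thesis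
    by (simp add: dunkl_def dir_deriv_perm u case_prod_unfold)
qed

lemma dunkl_add_vec:
  fixes u v :: "'n::{finite, linorder} \<Rightarrow> 'k" and a :: "('n::{finite, linorder}, 'k) symh"
  assumes "sum u UNIV = 0" "sum v UNIV = 0"
  shows "dunkl c (\<lambda>i. u i + r * v i) a = dunkl c u a + symh_scale r (dunkl c v a)"
proof -
  have "(\<Sum>(m, l) | m < l. symh_scale (c * (u m + r * v m - (u l + r * v l))) (ddiff m l a))
    = (\<Sum>(m, l) | m < l. symh_scale (c * (u m - u l)) (ddiff m l a)) +
      symh_scale r (\<Sum>(m, l) | m < l. symh_scale (c * (v m - v l)) (ddiff m l a))"
    unfolding symh_scale_sum sum.distrib[symmetric]
    by (rule sum.cong) (auto simp: symh_scale_def symh_const_hom algebra_simps)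
  then show ?thesis
    by (simp add: dunkl_def dir_deriv_add_vec assms symh_scale_diff_right)
qed

lemma sum_y_diff: "sum (y_diff i j :: 'n::finite \<Rightarrow> 'k) UNIV = 0"
proof -
  have "sum (y_diff i j :: 'n \<Rightarrow> 'k) UNIV = (\<Sum>t\<in>UNIV. of_bool (t = i)) - (\<Sum>t\<in>UNIV. of_bool (t = j))"
    by (simp add: y_diff_def sum_subtractf)
  also have "\<dots> = 0"
    by (simp only: of_bool_def sum.delta finite) simp
  finally show ?thesis .
qed

text \<open>A reflection \<open>s\<close> maps \<open>v\<close> to \<open>v - \<langle>v, \<alpha>\<^sub>s\<rangle> \<alpha>\<^sub>s\<^sup>\<or>\<close>, which makes the commutator of \<open>s\<close> with
  \<open>D\<^sub>v\<close> explicit.\<close>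

lemma swap_dunkl:
  fixes a :: "('n::{finite, linorder}, 'k) symh"
  assumes v: "sum v UNIV = 0"
  shows "symh_perm \<langle>i \<leftrightarrow> t\<rangle> (dunkl c v a) = dunkl c v (symh_perm \<langle>i \<leftrightarrow> t\<rangle> a) -
    symh_scale (v i - v t) (dunkl c (y_diff i t) (symh_perm \<langle>i \<leftrightarrow> t\<rangle> a))"
proof -
  have "v (\<langle>i \<leftrightarrow> t\<rangle> \<langle>$\<rangle> s) = v s + - (v i - v t) * y_diff i t s" for s
    by (cases "s = i"; cases "s = t") (simp_all add: y_diff_def)
  then have "symh_perm \<langle>i \<leftrightarrow> t\<rangle> (dunkl c v a) =
      dunkl c (\<lambda>s. v s + - (v i - v t) * y_diff i t s) (symh_perm \<langle>i \<leftrightarrow> t\<rangle> a)"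
    by (simp add: symh_perm_dunkl v)
  also have "\<dots> = dunkl c v (symh_perm \<langle>i \<leftrightarrow> t\<rangle> a) +
      symh_scale (- (v i - v t)) (dunkl c (y_diff i t) (symh_perm \<langle>i \<leftrightarrow> t\<rangle> a))"
    by (rule dunkl_add_vec[OF v sum_y_diff])
  finally show ?thesis
    by (simp add: symh_scale_def symh_const_hom algebra_simps)
qed

lemma dunkl_1 [simp]:
  assumes "sum u UNIV = 0"
  shows "dunkl c u (1 :: ('n::{finite, linorder}, 'k) symh) = 0"
proof -
  have "(\<Sum>(m, l) | m < l. symh_scale (c * (u m - u l)) (ddiff m l (1 :: ('n, 'k) symh))) = 0"
    by (rule sum.neutral) auto
  then show ?thesis by (simp add: dunkl_def assms)
qed

text \<open>The commutator of two Dunkl operators commutes with multiplication by each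
  \<open>x\<^sub>i\<close>, hence with multiplication by all of \<open>A\<close>; since it kills the constant \<open>1\<close>, it
  vanishes.\<close>

lemma dunkl_commute:
  fixes a :: "('n::{finite, linorder}, 'k) symh"
  assumes u: "sum u UNIV = 0" and v: "sum v UNIV = 0"
  shows "dunkl c u (dunkl c v a) = dunkl c v (dunkl c u a)"
proof -
  define K :: "('n, 'k) symh \<Rightarrow> ('n, 'k) symh"
    where "K a = dunkl c u (dunkl c v a) - dunkl c v (dunkl c u a)" for a
  have K_add: "K (a + b) = K a + K b" for a b
    by (simp add: K_def dunkl_add u v)
  have K_scale: "K (symh_scale r a) = symh_scale r (K a)" for r a
    by (simp add: K_def dunkl_scale u v symh_scale_diff_right)
  have K_var: "K (symh_var i * a) = symh_var i * K a" for i a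
  proof -
    let ?s = "\<lambda>t. symh_perm \<langle>i \<leftrightarrow> t\<rangle>"
    have *: "dunkl c u (dunkl c v (symh_var i * a)) = symh_var i * dunkl c u (dunkl c v a)
        + symh_scale (u i) (dunkl c v a) + symh_scale (v i) (dunkl c u a)
        - (\<Sum>t | t \<noteq> i. symh_scale (c * (u i - u t)) (?s t (dunkl c v a)) +
             symh_scale (c * (v i - v t)) (dunkl c u (?s t a)))"
      if u: "sum u UNIV = 0" and v: "sum v UNIV = 0" for u v
      by (simp add: dunkl_var_mult[OF v] dunkl_var_mult[OF u] dunkl_add[OF u] dunkl_diff[OF u]
          dunkl_sum[OF u] dunkl_scale[OF u] sum.distrib; simp add: algebra_simps)
    have "(\<Sum>t | t \<noteq> i. symh_scale (c * (u i - u t)) (?s t (dunkl c v a)) +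
             symh_scale (c * (v i - v t)) (dunkl c u (?s t a))) =
      (\<Sum>t | t \<noteq> i. symh_scale (c * (v i - v t)) (?s t (dunkl c u a)) +
             symh_scale (c * (u i - u t)) (dunkl c v (?s t a)))"
      by (rule sum.cong[OF refl]) (simp add: swap_dunkl u v symh_scale_def symh_const_hom algebra_simps)
    then show ?thesis
      unfolding K_def *[OF u v] *[OF v u] by (simp add: algebra_simps)
  qed
  have "K (a * b) = a * K b" for a b
    by (induction a arbitrary: b rule: symh_induct)
      (use K_scale in \<open>simp_all add: symh_scale_def K_var K_add distrib_right mult.assoc\<close>)
  from this[of a 1] have "K a = a * K 1" by simp
  also have "K 1 = 0" by (simp add: K_def u v)
  finally show ?thesis by (simp add: K_def)
qed

end

section \<open>The action of the Cherednik algebra\<close>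

lemma letter_act_add: "letter_act c s (a + b) = letter_act c s a + letter_act c s b"
  by (cases s) (simp_all add: distrib_left dunkl_add sum_y_diff)

lemma letter_act_scale: "letter_act c s (symh_scale r a) = symh_scale r (letter_act c s a)"
  by (cases s) (simp_all add: symh_scale_mult_right dunkl_scale sum_y_diff)

lemma word_act_add:
  "foldr (letter_act c) v (a + b) = foldr (letter_act c) v a + foldr (letter_act c) v b"
  by (induction v) (simp_all add: letter_act_add)

lemma word_act_scale:
  "foldr (letter_act c) v (symh_scale r a) = symh_scale r (foldr (letter_act c) v a)"
  by (induction v) (simp_all add: letter_act_scale)

lemma free_act_superset:
  assumes "finite K" "keys w \<subseteq> K"
  shows "free_act c w a =
    (\<Sum>v\<in>K. symh_scale (lookup w v) (foldr (letter_act c) (letters v) a))"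
  unfolding free_act_def
  by (rule sum.mono_neutral_left) (use assms in \<open>auto simp: in_keys_iff\<close>)

lemma free_act_single:
  "free_act c (single v r) a = symh_scale r (foldr (letter_act c) (letters v) a)"
  by (subst free_act_superset[of "{v}"]) auto

lemma free_act_0 [simp]: "free_act c 0 a = 0"
  by (simp add: free_act_def)

lemma free_act_plus: "free_act c (w + w') a = free_act c w a + free_act c w' a"
proof -
  let ?K = "keys w \<union> keys w'"
  have "free_act c (w + w') a =
    (\<Sum>v\<in>?K. symh_scale (lookup (w + w') v) (foldr (letter_act c) (letters v) a))"
    by (rule free_act_superset) (auto dest: subsetD[OF Poly_Mapping.keys_add])
  also have "\<dots> = free_act c w a + free_act c w' a"
    by (simp add: lookup_add symh_scale_add_left sum.distrib free_act_superset[of ?K])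
  finally show ?thesis .
qed

lemma free_act_minus: "free_act c (w - w') a = free_act c w a - free_act c w' a"
  by (metis add_diff_cancel_right' diff_add_cancel free_act_plus)

lemma free_act_sum: "free_act c (sum f S) a = (\<Sum>s\<in>S. free_act c (f s) a)"
  by (induction S rule: infinite_finite_induct) (simp_all add: free_act_plus)

lemma free_act_add: "free_act c w (a + b) = free_act c w a + free_act c w b"
  by (simp add: free_act_def word_act_add symh_scale_add_right sum.distrib)

lemma free_act_zero [simp]: "free_act c w 0 = 0"
  by (metis add_cancel_right_right free_act_add)

text \<open>The words act from the right end: concatenation of words becomes composition of operators.\<close>

lemma free_act_mult: "free_act c (w * w') a = free_act c w (free_act c w' a)"
proof (induction w rule: update_induct)
  case const
  show ?case by simp
next
  case (update w v r)
  have "free_act c (single v r * w') a = free_act c (single v r) (free_act c w' a)"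
  proof (induction w' rule: update_induct)
    case const
    show ?case by simp
  next
    case (update w' v' r')
    then show ?case
      by (simp add: update_eq_add distrib_left free_act_plus free_act_add mult_single
          free_act_single plus_wrd_def word_act_scale symh_scale_scale)
  qed
  with update show ?case
    by (simp add: update_eq_add distrib_right free_act_plus)
qed

lemma free_act_gen: "free_act c (gen s) a = letter_act c s a"
  by (simp add: gen_def free_act_single)

lemma free_act_scal: "free_act c (scal r) a = symh_scale r a"
  by (simp add: free_act_single zero_wrd_def)

lemma free_act_1: "free_act c 1 a = a"
  using free_act_scal[of c 1 a] by simp

lemmas free_act_simps = free_act_plus free_act_minus free_act_sum free_act_mult free_act_gen
  free_act_scal free_act_1

lemma free_act_smash_relations:
  assumes "w \<in> smash_relations"
  shows "free_act c w a = 0"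
proof -
  have y_diff_perm: "(\<lambda>t. y_diff i j (inverse \<sigma> \<langle>$\<rangle> t)) = y_diff (\<sigma> \<langle>$\<rangle> i) (\<sigma> \<langle>$\<rangle> j)" for \<sigma> i j
  proof
    fix t
    have "inverse \<sigma> \<langle>$\<rangle> t = s \<longleftrightarrow> t = \<sigma> \<langle>$\<rangle> s" for s
      by (metis perm_inverse_apply)
    then show "y_diff i j (inverse \<sigma> \<langle>$\<rangle> t) = y_diff (\<sigma> \<langle>$\<rangle> i) (\<sigma> \<langle>$\<rangle> j) t"
      by (simp add: y_diff_def)
  qed
  have y_diff_add: "dunkl c (y_diff i j) a + dunkl c (y_diff j l) a = dunkl c (y_diff i l) a" for i j l
  proof -
    have "y_diff i l = (\<lambda>t. y_diff i j t + 1 * y_diff j l t :: 'b)"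
      by (simp add: y_diff_def fun_eq_iff)
    then show ?thesis
      by (simp only: dunkl_add_vec sum_y_diff symh_scale_1)
  qed
  have "(\<Sum>i\<in>UNIV. symh_var i * a) = 0"
    by (simp add: sum_symh_var flip: sum_distrib_right)
  then show ?thesis
    using assms unfolding smash_relations_def
    by (auto simp: free_act_simps symh_perm_comp symh_perm_dunkl sum_y_diff y_diff_perm y_diff_add)
qed

lemma free_act_cherednik_relations:
  fixes a :: "('n::{finite, linorder}, 'k::field) symh"
  assumes "w \<in> cherednik_relations c"
  shows "free_act c w a = 0"
proof -
  have xy: "free_act c (commutator (gY i j) (gX l)) a = symh_scale (y_diff i j l) a -
      (\<Sum>t | t \<noteq> l. symh_scale (c * (y_diff i j l - y_diff i j t)) (symh_perm \<langle>l \<leftrightarrow> t\<rangle> a))" for i j l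
    by (simp add: commutator_def free_act_simps dunkl_var_mult sum_y_diff)
  consider (xx) i j where "w = commutator (gX i) (gX j)"
    | (yy) i j l m where "w = commutator (gY i j) (gY l m)"
    | (yx) i j where "i \<noteq> j" "w = commutator (gY i j) (gX i) -
        (1 - scal c * gG \<langle>i \<leftrightarrow> j\<rangle> - scal c * (\<Sum>t | t \<noteq> i. gG \<langle>i \<leftrightarrow> t\<rangle>))"
    | (yxl) i j l where "i \<noteq> j" "i \<noteq> l" "j \<noteq> l" "w = commutator (gY i j) (gX l) -
        (scal c * gG \<langle>i \<leftrightarrow> l\<rangle> - scal c * gG \<langle>j \<leftrightarrow> l\<rangle>)"
    using assms unfolding cherednik_relations_def by blast
  then show ?thesis
  proof cases
    case xx
    then show ?thesis by (simp add: commutator_def free_act_simps mult_ac)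
  next
    case yy
    then show ?thesis by (simp add: commutator_def free_act_simps dunkl_commute sum_y_diff)
  next
    case yx
    let ?s = "\<lambda>t. symh_scale c (symh_perm \<langle>i \<leftrightarrow> t\<rangle> a)"
    have "(\<Sum>t | t \<noteq> i. symh_scale (c * (y_diff i j i - y_diff i j t)) (symh_perm \<langle>i \<leftrightarrow> t\<rangle> a))
      = (\<Sum>t | t \<noteq> i. ?s t + (if t = j then ?s j else 0))"
      using yx(1) by (intro sum.cong) (auto simp: y_diff_def symh_scale_def symh_const_hom algebra_simps)
    (* the reflection s_ij counts twice: the pairing of y_i - y_j with x_i - x_j is 2 *)
    also have "\<dots> = (\<Sum>t | t \<noteq> i. ?s t) + ?s j"
      using yx(1) by (simp add: sum.distrib)
    finally show ?thesis
      using yx(1) by (simp add: yx(2) free_act_simps xy symh_scale_sum) (simp add: y_diff_def)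
  next
    case yxl
    let ?s = "\<lambda>t. symh_scale c (symh_perm \<langle>l \<leftrightarrow> t\<rangle> a)"
    have "(\<Sum>t | t \<noteq> l. symh_scale (c * (y_diff i j l - y_diff i j t)) (symh_perm \<langle>l \<leftrightarrow> t\<rangle> a))
      = (\<Sum>t | t \<noteq> l. (if t = j then ?s j else 0) - (if t = i then ?s i else 0))"
      using yxl(1-3) by (intro sum.cong) (auto simp: y_diff_def symh_scale_def symh_const_hom algebra_simps)
    also have "\<dots> = ?s j - ?s i"
      using yxl(1-3) by (simp add: sum_subtractf)
    finally show ?thesis
      using yxl(1-3) by (simp add: yxl(4) free_act_simps xy swap_sym[of l])
        (simp add: y_diff_def)
  qed
qed

lemma ring_of_type_algebra_simps [simp]:
  "carrier ring_of_type_algebra = UNIV"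
  "x \<otimes>\<^bsub>ring_of_type_algebra\<^esub> y = x * y" "x \<oplus>\<^bsub>ring_of_type_algebra\<^esub> y = x + y"
  "\<one>\<^bsub>ring_of_type_algebra\<^esub> = 1" "\<zero>\<^bsub>ring_of_type_algebra\<^esub> = 0"
  by (simp_all add: ring_of_type_algebra_def)

lemma ring_ring_of_type_algebra: "ring (ring_of_type_algebra :: 'a::ring_1 ring)"
proof -
  have "\<exists>y. x + y = 0" for x :: 'a
    using add.right_inverse by blast
  thus ?thesis
    unfolding ring_of_type_algebra_def using add.right_inverse
    by unfold_locales (auto simp: algebra_simps Units_def)
qed

lemma a_inv_ring_of_type_algebra [simp]: "\<ominus>\<^bsub>ring_of_type_algebra\<^esub> (x :: 'a::ring_1) = - x"
proof -
  interpret ring "ring_of_type_algebra :: 'a ring" by (rule ring_ring_of_type_algebra)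
  show ?thesis by (rule minus_equality) simp_all
qed

lemma ideal_of_type_algebra_iff:
  fixes I :: "'a::ring_1 set"
  shows "ideal I ring_of_type_algebra \<longleftrightarrow>
    0 \<in> I \<and> (\<forall>x\<in>I. \<forall>y\<in>I. x + y \<in> I) \<and> (\<forall>x\<in>I. \<forall>r. r * x \<in> I \<and> x * r \<in> I)"
    (is "?L \<longleftrightarrow> ?R")
proof
  assume ?L
  then interpret ideal I ring_of_type_algebra .
  show ?R
    using additive_subgroup.zero_closed[OF is_additive_subgroup]
      additive_subgroup.a_closed[OF is_additive_subgroup] I_l_closed I_r_closed by auto
next
  assume R: ?R
  interpret ring "ring_of_type_algebra :: 'a ring" by (rule ring_ring_of_type_algebra)
  have neg: "- x \<in> I" if "x \<in> I" for x
    using R that by (metis mult_minus1)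
  show ?L
  proof (rule idealI)
    show "subgroup I (add_monoid ring_of_type_algebra)"
      by (rule add.subgroupI) (use R neg in \<open>auto simp flip: a_inv_def\<close>)
  qed (use R ring_ring_of_type_algebra in auto)
qed

text \<open>All relations act by zero, so a coset of the ideal they generate acts as any of its
  elements does, and submodules over the Cherednik algebra are the subgroups that are
  invariant under the free algebra.\<close>

lemma free_act_ideal_relations:
  assumes "w \<in> Idl\<^bsub>ring_of_type_algebra\<^esub> (smash_relations \<union> cherednik_relations c)"
  shows "free_act c w a = 0"
proof -
  let ?K = "{w. \<forall>a. free_act c w a = 0}"
  have "ideal ?K ring_of_type_algebra"
    by (auto simp: ideal_of_type_algebra_iff free_act_plus free_act_mult)
  moreover have "smash_relations \<union> cherednik_relations c \<subseteq> ?K"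
    using free_act_smash_relations free_act_cherednik_relations by auto
  ultimately show ?thesis
    using assms unfolding genideal_def by blast
qed

text \<open>The image of a coset under \<open>w \<mapsto> free_act c w a\<close> is a singleton, so that \<open>the_elem\<close> in
  the definition of the action picks the expected value.\<close>

lemma cherednik_act_coset:
  fixes c :: "'k::field" and w :: "('n::{finite, linorder}, 'k) free_alg"
  defines "R \<equiv> ring_of_type_algebra :: ('n, 'k) free_alg ring"
  defines "I \<equiv> Idl\<^bsub>R\<^esub> (smash_relations \<union> cherednik_relations c)"
  shows "cherednik_act c (I +>\<^bsub>R\<^esub> w) a = free_act c w a"
proof -
  interpret ring R unfolding R_def by (rule ring_ring_of_type_algebra)
  have I: "ideal I R"
    unfolding I_def by (rule genideal_ideal) (simp add: R_def)
  have coset: "I +>\<^bsub>R\<^esub> w = {h + w | h. h \<in> I}"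
    by (auto simp: a_r_coset_def' R_def)
  have "0 \<in> I"
    using I additive_subgroup.zero_closed[of I R] ideal.axioms(1)[OF I] by (simp add: R_def)
  have "(\<lambda>w. free_act c w a) ` (I +>\<^bsub>R\<^esub> w) = {free_act c w a}"
    using free_act_ideal_relations[of _ c a] \<open>0 \<in> I\<close>
    unfolding coset by (force simp: free_act_plus I_def R_def)
  then show ?thesis by (simp add: cherednik_act_def)
qed

lemma carrier_cherednik:
  "carrier (cherednik c) = range (\<lambda>w. Idl\<^bsub>ring_of_type_algebra\<^esub>
    (smash_relations \<union> cherednik_relations c) +>\<^bsub>ring_of_type_algebra\<^esub> w)"
  by (auto simp: cherednik_def FactRing_def A_RCOSETS_def' )

lemma cherednik_submodule_iff:
  "cherednik_submodule c M \<longleftrightarrow>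
    0 \<in> M \<and> (\<forall>a\<in>M. \<forall>b\<in>M. a + b \<in> M) \<and> (\<forall>w. \<forall>a\<in>M. free_act c w a \<in> M)"
  by (simp add: cherednik_submodule_def carrier_cherednik cherednik_act_coset)

text \<open>Closure under multiplication by all of \<open>A\<close> covers the scalars and the letters \<open>x\<^sub>i\<close>.\<close>

lemma cherednik_submoduleI:
  assumes "0 \<in> M" "\<And>a b. a \<in> M \<Longrightarrow> b \<in> M \<Longrightarrow> a + b \<in> M"
    "\<And>r a. a \<in> M \<Longrightarrow> r * a \<in> M"
    "\<And>i j a. a \<in> M \<Longrightarrow> dunkl c (y_diff i j) a \<in> M"
    "\<And>\<sigma> a. a \<in> M \<Longrightarrow> symh_perm \<sigma> a \<in> M"
  shows "cherednik_submodule c M"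
proof -
  have letter: "letter_act c s a \<in> M" if "a \<in> M" for s a
    using that assms by (cases s) auto
  have word: "foldr (letter_act c) v a \<in> M" if "a \<in> M" for v a
    using that letter by (induction v) auto
  have sum: "sum f S \<in> M" if "\<And>s. s \<in> S \<Longrightarrow> f s \<in> M" for f :: "'n letter wrd \<Rightarrow> _" and S
    using that assms(1,2) by (induction S rule: infinite_finite_induct) auto
  have "free_act c w a \<in> M" if "a \<in> M" for w a
    unfolding free_act_def symh_scale_def using that by (intro sum assms(3) word)
  with assms(1,2) show ?thesis by (auto simp: cherednik_submodule_iff)
qed

lemma cherednik_submoduleD:
  assumes M: "cherednik_submodule c M" and a: "a \<in> M"
  shows "r * a \<in> M" "dunkl c (y_diff i j) a \<in> M"
proof -
  note M' = M[unfolded cherednik_submodule_iff]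
  have "free_act c (gY i j) a \<in> M" using M' a by blast
  then show "dunkl c (y_diff i j) a \<in> M" by (simp add: free_act_simps)
  have const: "symh_const r * a \<in> M" if "a \<in> M" for r a
  proof -
    have "free_act c (scal r) a \<in> M" using M' that by blast
    then show ?thesis by (simp add: free_act_simps symh_scale_def)
  qed
  have var: "symh_var i * a \<in> M" if "a \<in> M" for i a
  proof -
    have "free_act c (gX i) a \<in> M" using M' that by blast
    then show ?thesis by (simp add: free_act_simps)
  qed
  show "r * a \<in> M"
    using a by (induction r arbitrary: a rule: symh_induct)
      (use M' in \<open>simp_all add: const var distrib_right mult.assoc\<close>)
qed

section \<open>The polynomials are singular vectors\<close>

subsection \<open>Coefficientwise operators on power series\<close>

text \<open>Operators on \<open>A\<close> are applied to the generating series \<open>F\<^sub>i(z)\<close> coefficient by coefficient;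
  product rules are inherited.\<close>

definition fps_op :: "('a \<Rightarrow> 'b) \<Rightarrow> 'a fps \<Rightarrow> 'b fps" where
  "fps_op L F = Abs_fps (\<lambda>k. L (F $ k))"

lemma fps_op_nth [simp]: "fps_op L F $ k = L (F $ k)"
  by (simp add: fps_op_def)

lemma fps_op_add:
  assumes "\<And>a b. L (a + b) = L a + L b"
  shows "fps_op L (F + G) = fps_op L F + fps_op L G"
  by (rule fps_ext) (simp add: assms)

lemma fps_op_twisted_mult:
  fixes L s :: "'a::comm_ring_1 \<Rightarrow> 'a"
  assumes L: "\<And>a b. L (a + b) = L a + L b" "\<And>a b. L (a * b) = L a * b + s a * L b"
  shows "fps_op L (F * G) = fps_op L F * G + fps_op s F * fps_op L G"
proof (rule fps_ext)
  fix k
  have L0: "L 0 = 0" using L(1)[of 0 0] by simp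
  have "L (\<Sum>i\<in>S. h i) = (\<Sum>i\<in>S. L (h i))" for h and S :: "nat set"
    by (induction S rule: infinite_finite_induct) (simp_all add: L0 L)
  then show "fps_op L (F * G) $ k = (fps_op L F * G + fps_op s F * fps_op L G) $ k"
    by (simp add: fps_mult_nth L sum.distrib)
qed

lemma fps_op_hom_mult:
  fixes s :: "'a::comm_ring_1 \<Rightarrow> 'b::comm_ring_1"
  assumes s: "s 0 = 0" "\<And>a b. s (a + b) = s a + s b" "\<And>a b. s (a * b) = s a * s b"
  shows "fps_op s (F * G) = fps_op s F * fps_op s G"
proof (rule fps_ext)
  fix k
  have "s (\<Sum>i\<in>S. h i) = (\<Sum>i\<in>S. s (h i))" for h and S :: "nat set"
    by (induction S rule: infinite_finite_induct) (simp_all add: s)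
  then show "fps_op s (F * G) $ k = (fps_op s F * fps_op s G) $ k"
    by (simp add: fps_mult_nth s)
qed

subsection \<open>Derivations of a truncated power\<close>

text \<open>The truncation of \<open>(1 + Y)\<^sup>c\<close> at degree \<open>N\<close> satisfies the differential equation
  \<open>(1 + Y) g' = c g\<close> up to one term of degree \<open>N\<close>. The hypothesis is the recursion of the
  binomial coefficients; it is what survives in characteristic \<open>p\<close> for \<open>N < p\<close>.\<close>

lemma truncated_binomial_deriv:
  fixes Y :: "'a::comm_ring_1"
  assumes "\<And>m. m < N \<Longrightarrow> of_nat (Suc m) * b (Suc m) = (c - of_nat m) * b m"
  shows "(1 + Y) * (\<Sum>m<Suc N. of_nat m * b m * Y ^ (m - 1)) =
    c * (\<Sum>m<Suc N. b m * Y ^ m) - (c - of_nat N) * b N * Y ^ N"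
  using assms
proof (induction N)
  case 0
  show ?case by simp
next
  case (Suc N)
  have IH: "(1 + Y) * (\<Sum>m<Suc N. of_nat m * b m * Y ^ (m - 1)) =
    c * (\<Sum>m<Suc N. b m * Y ^ m) - (c - of_nat N) * b N * Y ^ N"
    using Suc by simp
  have rec: "of_nat (Suc N) * b (Suc N) = (c - of_nat N) * b N"
    using Suc.prems by simp
  have "(1 + Y) * (\<Sum>m<Suc (Suc N). of_nat m * b m * Y ^ (m - 1)) =
     c * (\<Sum>m<Suc N. b m * Y ^ m) - (c - of_nat N) * b N * Y ^ N +
     (of_nat (Suc N) * b (Suc N)) * Y ^ N + of_nat (Suc N) * b (Suc N) * Y ^ Suc N"
    unfolding sum.lessThan_Suc[of _ "Suc N"] distrib_left[of "1 + Y"] IH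
    by (simp add: algebra_simps)
  also have "\<dots> = c * (\<Sum>m<Suc N. b m * Y ^ m) + of_nat (Suc N) * b (Suc N) * Y ^ Suc N"
    unfolding rec by simp
  also have "\<dots> = c * (\<Sum>m<Suc (Suc N). b m * Y ^ m) - (c - of_nat (Suc N)) * b (Suc N) * Y ^ Suc N"
    unfolding sum.lessThan_Suc[of _ "Suc N"] by (simp only: algebra_simps)
  finally show ?case .
qed

locale derivation =
  fixes E :: "'a::comm_ring_1 \<Rightarrow> 'a"
  assumes E_add: "E (a + b) = E a + E b" and E_mult: "E (a * b) = E a * b + a * E b"
begin

lemma E_0 [simp]: "E 0 = 0" using E_add[of 0 0] by simp
lemma E_1 [simp]: "E 1 = 0" using E_mult[of 1 1] by simp
lemma E_minus: "E (- a) = - E a"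
  using E_add[of a "- a"] by (simp add: eq_neg_iff_add_eq_0 add.commute)
lemma E_diff: "E (a - b) = E a - E b"
  using E_add[of a "- b"] by (simp add: E_minus)
lemma E_sum: "E (sum f S) = (\<Sum>s\<in>S. E (f s))"
  by (induction S rule: infinite_finite_induct) (simp_all add: E_add)

lemma E_power: "E (a ^ m) = of_nat m * a ^ (m - 1) * E a"
proof (induction m)
  case (Suc m)
  then show ?case by (cases m) (simp_all add: E_mult algebra_simps)
qed simp

lemma E_inverse:
  assumes "w * v = 1"
  shows "E v = - (v ^ 2 * E w)"
proof -
  have "0 = E w * v + w * E v" using E_mult[of w v] assms by simp
  then have "0 = v * (E w * v + w * E v)" by simp
  also have "\<dots> = v ^ 2 * E w + (w * v) * E v" by (simp add: algebra_simps power2_eq_square)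
  finally show ?thesis using assms by (simp add: eq_neg_iff_add_eq_0 add.commute)
qed

lemma E_prod:
  assumes "finite S" "\<And>j. j \<in> S \<Longrightarrow> w j * v j = 1"
  shows "E (\<Prod>j\<in>S. w j) = (\<Prod>j\<in>S. w j) * (\<Sum>j\<in>S. v j * E (w j))"
  using assms
proof (induction S rule: finite_induct)
  case (insert j S)
  have IH: "E (\<Prod>j\<in>S. w j) = (\<Prod>j\<in>S. w j) * (\<Sum>j\<in>S. v j * E (w j))"
    using insert by simp
  have "E (\<Prod>j\<in>insert j S. w j) = (w j * v j) * E (w j) * (\<Prod>j\<in>S. w j) + w j * E (\<Prod>j\<in>S. w j)"
    using insert by (simp add: E_mult)
  also have "w j * v j = 1" using insert by simp
  also have "1 * E (w j) * (\<Prod>j\<in>S. w j) = (w j * v j) * (E (w j) * (\<Prod>j\<in>S. w j))"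
    using insert by simp
  also have "\<dots> + w j * E (\<Prod>j\<in>S. w j) = (\<Prod>j\<in>insert j S. w j) * (\<Sum>j\<in>insert j S. v j * E (w j))"
    using insert.hyps IH by (simp add: algebra_simps)
  finally show ?case .
qed simp

text \<open>A derivation \<open>E\<close> sends \<open>P = \<Prod>\<^sub>j w\<^sub>j\<close> to \<open>P\<close> times the sum of the logarithmic derivatives of the
  \<open>w\<^sub>j\<close>, and the differential equation of the truncated power absorbs the factor \<open>P\<close>.\<close>

lemma E_truncated_power:
  assumes "finite S" "\<And>j. j \<in> S \<Longrightarrow> w j * v j = 1"
    and "\<And>m. m < N \<Longrightarrow> of_nat (Suc m) * b (Suc m) = (c - of_nat m) * b m" "\<And>m. E (b m) = 0"
  shows "E (\<Sum>m<Suc N. b m * ((\<Prod>j\<in>S. w j) - 1) ^ m) =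
    (c * (\<Sum>m<Suc N. b m * ((\<Prod>j\<in>S. w j) - 1) ^ m) - (c - of_nat N) * b N * ((\<Prod>j\<in>S. w j) - 1) ^ N)
      * (\<Sum>j\<in>S. v j * E (w j))"
proof -
  define T where "T = (\<Sum>j\<in>S. v j * E (w j))"
  let ?Y = "(\<Prod>j\<in>S. w j) - 1"
  have "E ?Y = (1 + ?Y) * T"
    by (simp add: E_diff E_prod[of S w v] assms(1,2) T_def)
  then have "E (b m * ?Y ^ m) = (1 + ?Y) * (of_nat m * b m * ?Y ^ (m - 1)) * T" for m
    by (simp only: E_mult E_power assms(4)) (simp add: mult_ac)
  then have "E (\<Sum>m<Suc N. b m * ?Y ^ m) =
      ((1 + ?Y) * (\<Sum>m<Suc N. of_nat m * b m * ?Y ^ (m - 1))) * T"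
    by (simp only: E_sum sum_distrib_left sum_distrib_right)
  then show ?thesis
    unfolding T_def[symmetric]
    by (simp only: truncated_binomial_deriv[of N b c, OF assms(3)])
qed

end

subsection \<open>The generating series\<close>

definition lin_factor :: "'n \<Rightarrow> ('n::{finite, linorder}, 'k::field) symh fps" where
  "lin_factor j = 1 - fps_const (symh_var j) * fps_X"

definition geom_series :: "'n \<Rightarrow> ('n::{finite, linorder}, 'k::field) symh fps" where
  "geom_series j = fps_right_inverse (lin_factor j) 1"

text \<open>The truncated power \<open>P\<^sup>c\<close> with \<open>P = \<Prod>\<^sub>j (1 - x\<^sub>j z)\<close>.\<close>

definition trunc_power :: "nat \<Rightarrow> 'k \<Rightarrow> ('n::{finite, linorder}, 'k::field) symh fps" where
  "trunc_power p c = (\<Sum>m<p. fps_const (symh_const (binom c m)) * ((\<Prod>j\<in>UNIV. lin_factor j) - 1) ^ m)"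

lemma F_series_eq: "F_series p c i = geom_series i * trunc_power p c"
  by (simp add: F_series_def geom_series_def trunc_power_def lin_factor_def)

lemma lin_factor_geom_series: "lin_factor j * geom_series j = 1"
  unfolding geom_series_def by (rule fps_right_inverse) (simp add: lin_factor_def)

lemma geom_series_unique: "lin_factor j * g = 1 \<Longrightarrow> g = geom_series j"
  by (metis lin_factor_geom_series mult.commute mult.left_commute mult.right_neutral)

lemma binom_Suc:
  assumes "of_nat (fact (Suc m)) \<noteq> (0 :: 'k::field)"
  shows "of_nat (Suc m) * binom c (Suc m) = (c - of_nat m) * (binom c m :: 'k)"
proof -
  have e: "of_nat (fact (Suc m)) = of_nat (Suc m) * (of_nat (fact m) :: 'k)"
    by (simp only: fact_Suc of_nat_mult of_nat_id)
  have "of_nat (Suc m) \<noteq> (0 :: 'k)" using assms unfolding e by auto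
  then show ?thesis
    unfolding binom_def e by (simp add: mult_ac del: of_nat_Suc)
qed

lemma of_nat_fact_nonzero:
  assumes "CHAR('k::field) = p" "prime p" "m < p"
  shows "of_nat (fact m) \<noteq> (0 :: 'k)"
  using assms by (simp add: of_nat_eq_0_iff_char_dvd prime_dvd_fact_iff)

lemma fps_op_lin_factor:
  fixes L :: "('n::{finite, linorder}, 'k::field) symh \<Rightarrow> ('n, 'k) symh"
  assumes "\<And>a b. L (a - b) = L a - L b"
  shows "fps_op L (lin_factor j) = fps_const (L 1) - fps_const (L (symh_var j)) * fps_X"
proof (rule fps_ext)
  fix k
  have L0: "L 0 = 0" using assms[of 0 0] by simp
  show "fps_op L (lin_factor j) $ k = (fps_const (L 1) - fps_const (L (symh_var j)) * fps_X) $ k"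
    using assms[of 1 0] assms[of 0 "symh_var j"]
    by (cases k; cases "k - 1") (simp_all add: lin_factor_def L0)
qed

context
  fixes \<sigma> :: "'n::{finite, linorder} perm"
begin

lemma fps_perm_mult:
  "fps_op (symh_perm \<sigma>) (F * G) = fps_op (symh_perm \<sigma>) F * fps_op (symh_perm \<sigma>) G"
  by (rule fps_op_hom_mult) simp_all

lemma fps_perm_const: "fps_op (symh_perm \<sigma>) (fps_const a) = fps_const (symh_perm \<sigma> a)"
  by (rule fps_ext) simp

lemma fps_perm_1: "fps_op (symh_perm \<sigma>) (1 :: ('n, 'k::field) symh fps) = 1"
  using fps_perm_const[of "1 :: ('n, 'k) symh"] by simp

lemma fps_perm_lin_factor: "fps_op (symh_perm \<sigma>) (lin_factor j) = lin_factor (\<sigma> \<langle>$\<rangle> j)"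
  by (subst fps_op_lin_factor) (simp_all add: lin_factor_def)

lemma fps_perm_geom_series:
  "fps_op (symh_perm \<sigma>) (geom_series j) = (geom_series (\<sigma> \<langle>$\<rangle> j) :: ('n, 'k::field) symh fps)"
proof (rule geom_series_unique)
  show "lin_factor (\<sigma> \<langle>$\<rangle> j) * fps_op (symh_perm \<sigma>) (geom_series j :: ('n, 'k) symh fps) = 1"
    using fps_perm_mult[of "lin_factor j" "geom_series j :: ('n, 'k) symh fps"]
    by (simp add: lin_factor_geom_series fps_perm_1 fps_perm_lin_factor)
qed

lemma fps_perm_sum: "fps_op (symh_perm \<sigma>) (sum f S) = (\<Sum>s\<in>S. fps_op (symh_perm \<sigma>) (f s))"
  by (rule fps_ext) (simp add: fps_sum_nth)

lemma fps_perm_diff: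
  "fps_op (symh_perm \<sigma>) (F - G) = fps_op (symh_perm \<sigma>) F - fps_op (symh_perm \<sigma>) G"
  by (rule fps_ext) simp

lemma fps_perm_power: "fps_op (symh_perm \<sigma>) (F ^ m) = fps_op (symh_perm \<sigma>) F ^ m"
  by (induction m) (simp_all add: fps_perm_1 fps_perm_mult)

lemma fps_perm_prod: "fps_op (symh_perm \<sigma>) (prod f S) = (\<Prod>s\<in>S. fps_op (symh_perm \<sigma>) (f s))"
  by (induction S rule: infinite_finite_induct) (simp_all add: fps_perm_1 fps_perm_mult)

lemma fps_perm_trunc_power:
  "fps_op (symh_perm \<sigma>) (trunc_power p c) = (trunc_power p c :: ('n, 'k::field) symh fps)"
proof -
  have "(\<Prod>j\<in>UNIV. lin_factor (\<sigma> \<langle>$\<rangle> j)) = (\<Prod>j\<in>UNIV. lin_factor j :: ('n, 'k) symh fps)"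
    by (rule prod.reindex_bij_betw) (rule bij_apply)
  then show ?thesis
    by (simp add: trunc_power_def fps_perm_sum fps_perm_mult fps_perm_const fps_perm_power
        fps_perm_diff fps_perm_1 fps_perm_prod fps_perm_lin_factor)
qed

lemma symh_perm_f_poly: "symh_perm \<sigma> (f_poly p c i) = f_poly p c (\<sigma> \<langle>$\<rangle> i)"
proof -
  have "fps_op (symh_perm \<sigma>) (F_series p c i) = F_series p c (\<sigma> \<langle>$\<rangle> i)"
    by (simp add: F_series_eq fps_perm_mult fps_perm_geom_series fps_perm_trunc_power)
  then show ?thesis
    unfolding f_poly_def by (metis fps_op_nth)
qed

end

context
  fixes m l :: "'n::{finite, linorder}"
  assumes ml: "m \<noteq> l"
begin

lemma ddiff_diff: "ddiff m l (a - b :: ('n, 'k::field) symh) = ddiff m l a - ddiff m l b"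
  by (metis add_diff_cancel_right' diff_add_cancel ddiff_add[OF ml])

lemma fps_ddiff_mult:
  "fps_op (ddiff m l) (F * G :: ('n, 'k::field) symh fps) =
    fps_op (ddiff m l) F * G + fps_op (symh_perm \<langle>m \<leftrightarrow> l\<rangle>) F * fps_op (ddiff m l) G"
  by (rule fps_op_twisted_mult) (simp_all add: ddiff_add ddiff_mult ml)

lemma fps_ddiff_lin_factor:
  "fps_op (ddiff m l) (lin_factor j :: ('n, 'k::field) symh fps) =
    (of_bool (j = l) - of_bool (j = m)) * fps_X"
proof -
  have "fps_op (ddiff m l) (lin_factor j :: ('n, 'k) symh fps) =
      - fps_const (of_bool (j = m) - of_bool (j = l)) * fps_X"
    by (subst fps_op_lin_factor) (simp_all add: ddiff_diff ddiff_var ml)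
  also have "- fps_const (of_bool (j = m) - of_bool (j = l)) =
      (of_bool (j = l) - of_bool (j = m) :: ('n, 'k) symh fps)"
    using ml by (cases "j = l"; cases "j = m") (simp_all flip: fps_const_neg)
  finally show ?thesis .
qed

lemma fps_ddiff_geom_series:
  "fps_op (ddiff m l) (geom_series j :: ('n, 'k::field) symh fps) =
    (of_bool (j = m) - of_bool (j = l)) * fps_X * geom_series j * geom_series (\<langle>m \<leftrightarrow> l\<rangle> \<langle>$\<rangle> j)"
proof -
  let ?T = "fps_op (ddiff m l) :: ('n, 'k) symh fps \<Rightarrow> _"
  have T1: "?T 1 = 0" by (rule fps_ext) (simp add: ml)
  have "?T (geom_series j * lin_factor j) = 0"
    using T1 lin_factor_geom_series[of j] by (metis mult.commute)
  then have "?T (geom_series j) * lin_factor j =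
    geom_series (\<langle>m \<leftrightarrow> l\<rangle> \<langle>$\<rangle> j) * (of_bool (j = m) - of_bool (j = l)) * fps_X"
    by (simp add: fps_ddiff_mult fps_perm_geom_series fps_ddiff_lin_factor algebra_simps
        eq_neg_iff_add_eq_0)
  then have "?T (geom_series j) * lin_factor j * geom_series j =
    (of_bool (j = m) - of_bool (j = l)) * fps_X * geom_series j * geom_series (\<langle>m \<leftrightarrow> l\<rangle> \<langle>$\<rangle> j)"
    by (simp add: mult_ac)
  then show ?thesis by (simp add: mult.assoc lin_factor_geom_series)
qed

text \<open>The truncated power is a polynomial in \<open>P\<close>, so it is enough that \<open>P\<close> is killed. Symmetry of
  \<open>P\<close> would not suffice, since \<open>x\<^sub>m - x\<^sub>l\<close> can be a zero divisor; instead the factors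
  other than the \<open>m\<close>-th and the \<open>l\<close>-th are killed and fixed one by one, and these two as a
  pair.\<close>

lemma fps_ddiff_trunc_power:
  "fps_op (ddiff m l) (trunc_power p c :: ('n, 'k::field) symh fps) = 0"
proof -
  let ?T = "fps_op (ddiff m l) :: ('n, 'k) symh fps \<Rightarrow> _"
  let ?S = "fps_op (symh_perm \<langle>m \<leftrightarrow> l\<rangle>) :: ('n, 'k) symh fps \<Rightarrow> _"
  define C where "C = {F. ?T F = 0 \<and> ?S F = F}"
  have C_mult: "F * G \<in> C" if "F \<in> C" "G \<in> C" for F G
    using that by (simp add: C_def fps_ddiff_mult fps_perm_mult)
  have C_const: "fps_const (symh_const r) \<in> C" for r
    by (auto simp: C_def fps_perm_const fps_eq_iff ml)
  have C_1: "1 \<in> C"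
    using C_const[of 1] by (simp add: symh_const_hom)
  have C_diff: "F - G \<in> C" if "F \<in> C" "G \<in> C" for F G
    using that by (auto simp: C_def fps_eq_iff ddiff_diff)
  have C_add: "F + G \<in> C" if "F \<in> C" "G \<in> C" for F G
    using that by (auto simp: C_def fps_eq_iff ddiff_add ml)
  have C_0: "0 \<in> C" using C_diff[OF C_1 C_1] by simp
  have C_prod: "prod f S \<in> C" if "\<And>s. s \<in> S \<Longrightarrow> f s \<in> C" for f :: "'n \<Rightarrow> _" and S
    using that by (induction S rule: infinite_finite_induct) (auto intro: C_1 C_mult)
  have C_sum: "sum f S \<in> C" if "\<And>s. s \<in> S \<Longrightarrow> f s \<in> C" for f :: "nat \<Rightarrow> _" and S
    using that by (induction S rule: infinite_finite_induct) (auto intro: C_0 C_add)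
  have C_power: "F ^ k \<in> C" if "F \<in> C" for F k
    using that by (induction k) (auto intro: C_1 C_mult)
  have "lin_factor m * lin_factor l \<in> C"
    using ml by (simp add: C_def fps_ddiff_mult fps_perm_mult fps_perm_lin_factor
        fps_ddiff_lin_factor mult_ac)
  moreover have "(\<Prod>j\<in>UNIV - {m, l}. lin_factor j) \<in> C"
    by (rule C_prod) (auto simp: C_def fps_perm_lin_factor fps_ddiff_lin_factor)
  ultimately have "lin_factor m * lin_factor l * (\<Prod>j\<in>UNIV - {m, l}. lin_factor j) \<in> C"
    by (rule C_mult)
  also have "lin_factor m * lin_factor l * (\<Prod>j\<in>UNIV - {m, l}. lin_factor j) =
      (\<Prod>j\<in>UNIV. lin_factor j :: ('n, 'k) symh fps)"
    using ml by (subst (2) prod.subset_diff[of "{m, l}"]) (auto simp: mult_ac)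
  finally have "trunc_power p c \<in> C"
    unfolding trunc_power_def by (intro C_sum C_mult C_const C_power C_diff C_1)
  then show ?thesis by (simp add: C_def)
qed

end

subsection \<open>Singularity\<close>

lemma fps_nth_eqI_mod:
  assumes "fps_X ^ Suc k dvd F - (G :: 'a::comm_ring_1 fps)"
  shows "F $ k = G $ k"
proof -
  from assms obtain H where "F - G = fps_X ^ Suc k * H" by (elim dvdE)
  then have "(F - G) $ k = 0" by (simp add: fps_X_power_mult_nth del: power_Suc)
  then show ?thesis by simp
qed

lemma fps_X_dvdI:
  fixes F :: "'a::comm_ring_1 fps"
  assumes "\<And>i. i < k \<Longrightarrow> F $ i = 0"
  shows "fps_X ^ k dvd F"
proof
  show "F = fps_X ^ k * Abs_fps (\<lambda>i. F $ (i + k))"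
    by (rule fps_ext) (simp add: fps_X_power_mult_nth assms)
qed

lemma prod_lin_factor_nth:
  assumes "finite S"
  shows "(\<Prod>j\<in>S. lin_factor j :: ('n::{finite, linorder}, 'k::field) symh fps) $ 0 = 1 \<and>
    (\<Prod>j\<in>S. lin_factor j :: ('n, 'k) symh fps) $ 1 = - (\<Sum>j\<in>S. symh_var j)"
  using assms
  by (induction S rule: finite_induct) (auto simp: fps_mult_nth_1 lin_factor_def)

text \<open>The linear coefficient is \<open>-(x\<^sub>1 + \<dots> + x\<^sub>n) = 0\<close> in \<open>A\<close>.\<close>

lemma fps_X_dvd_prod_lin_factor:
  "fps_X ^ 2 dvd (\<Prod>j\<in>UNIV. lin_factor j) - (1 :: ('n::{finite, linorder}, 'k::field) symh fps)"
proof (rule fps_X_dvdI)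
  fix i :: nat assume "i < 2"
  then consider "i = 0" | "i = 1" by linarith
  then show "((\<Prod>j\<in>UNIV. lin_factor j) - (1 :: ('n, 'k) symh fps)) $ i = 0"
    by cases (use prod_lin_factor_nth[of "UNIV :: 'n set", where ?'k = 'k] in
      \<open>simp_all add: sum_symh_var\<close>)
qed

text \<open>To order \<open>z\<^sup>p\<close> the truncated power behaves like the power \<open>P\<^sup>c\<close> under every derivation \<open>E\<close>
  that kills \<open>k\<close> and maps the linear factors to multiples of \<open>z\<close>. The error term of the differential
  equation contains \<open>(P - 1)\<^sup>p\<^sup>-\<^sup>1\<close>, of order at least \<open>2 (p - 1)\<close>, and one more factor \<open>z\<close>
  from \<open>E\<close>, and \<open>2 p - 1 \<ge> p + 1\<close>.\<close>

lemma deriv_trunc_power: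
  fixes E :: "('n::{finite, linorder}, 'k::field) symh fps \<Rightarrow> ('n, 'k) symh fps"
  assumes p: "CHAR('k) = p" "prime p"
    and E: "derivation E" "\<And>r. E (fps_const (symh_const r)) = 0"
    and dvd: "\<And>j. fps_X dvd E (lin_factor j)"
  shows "fps_X ^ Suc p dvd E (trunc_power p c) -
    fps_const (symh_const c) * trunc_power p c * (\<Sum>j\<in>UNIV. geom_series j * E (lin_factor j))"
proof -
  interpret derivation E by (rule E)
  obtain N where N: "p = Suc N" "N \<ge> 1"
    using prime_ge_2_nat[OF p(2)] by (cases p) auto
  let ?b = "\<lambda>m. fps_const (symh_const (binom c m)) :: ('n, 'k) symh fps"
  let ?Y = "(\<Prod>j\<in>UNIV. lin_factor j) - 1 :: ('n, 'k) symh fps"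
  let ?T = "\<Sum>j\<in>UNIV. geom_series j * E (lin_factor j)"
  have b: "of_nat (Suc m) * ?b (Suc m) = (fps_const (symh_const c) - of_nat m) * ?b m" if "m < N" for m
  proof -
    have "of_nat (Suc m) * binom c (Suc m) = (c - of_nat m) * binom c m"
      by (rule binom_Suc, rule of_nat_fact_nonzero[OF p]) (use that N in simp)
    then have "fps_const (symh_const (of_nat (Suc m) * binom c (Suc m)) :: ('n, 'k) symh) =
        fps_const (symh_const ((c - of_nat m) * binom c m))"
      by (rule arg_cong)
    then show ?thesis
      by (simp only: symh_const_hom fps_of_nat flip: fps_const_mult fps_const_sub)
  qed
  have "E (trunc_power p c) = (fps_const (symh_const c) * trunc_power p c -
      (fps_const (symh_const c) - of_nat N) * ?b N * ?Y ^ N) * ?T"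
    unfolding trunc_power_def N(1)
    by (rule E_truncated_power) (simp_all only: b E(2) lin_factor_geom_series finite)
  then have eq: "E (trunc_power p c) - fps_const (symh_const c) * trunc_power p c * ?T =
      - ((fps_const (symh_const c) - of_nat N) * ?b N) * (?Y ^ N * ?T)"
    by (simp add: algebra_simps)
  have "fps_X ^ Suc p dvd ?Y ^ N * ?T"
  proof -
    have "(fps_X ^ 2) ^ N dvd ?Y ^ N"
      by (rule dvd_power_same[OF fps_X_dvd_prod_lin_factor])
    moreover have "fps_X dvd ?T"
      by (intro dvd_sum dvd_mult dvd)
    ultimately have "(fps_X ^ 2) ^ N * fps_X dvd ?Y ^ N * ?T"
      by (rule mult_dvd_mono)
    moreover have "(fps_X ^ 2) ^ N * fps_X = (fps_X ^ (2 * N + 1) :: ('n, 'k) symh fps)"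
      by (simp add: power_mult)
    ultimately have "fps_X ^ (2 * N + 1) dvd ?Y ^ N * ?T" by (simp only:)
    moreover have "(fps_X ^ Suc p :: ('n, 'k) symh fps) dvd fps_X ^ (2 * N + 1)"
      using N by (intro le_imp_power_dvd) simp
    ultimately show ?thesis by (rule dvd_trans[rotated])
  qed
  then show ?thesis unfolding eq by (rule dvd_mult)
qed

lemma fps_op_dunkl:
  fixes F :: "('n::{finite, linorder}, 'k::field) symh fps"
  shows "fps_op (dunkl c u) F = fps_op (dir_deriv u) F -
    (\<Sum>(m, l) | m < l. fps_const (symh_const (c * (u m - u l))) * fps_op (ddiff m l) F)"
  by (rule fps_ext)
    (simp add: dunkl_def symh_scale_def fps_sum_nth case_prod_unfold)

definition euler :: "'a::comm_ring_1 fps \<Rightarrow> 'a fps" where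
  "euler F = fps_X * fps_deriv F"

lemma derivation_euler: "derivation (euler :: 'a::comm_ring_1 fps \<Rightarrow> 'a fps)"
  by unfold_locales (simp_all add: euler_def algebra_simps)

lemma euler_nth: "euler F $ k = of_nat k * F $ k"
  by (cases k) (simp_all add: euler_def)

lemma euler_lin_factor: "euler (lin_factor j) = lin_factor j - (1 :: ('n::{finite, linorder}, 'k::field) symh fps)"
  by (rule fps_ext) (auto simp: euler_nth lin_factor_def le_Suc_eq)

context
  fixes p :: nat and c :: "'k::field"
  assumes p: "CHAR('k) = p" "prime p" and n: "p dvd CARD('n::{finite, linorder})"
begin

lemma of_nat_card_0: "of_nat CARD('n) = (0 :: ('n, 'k) symh fps)"
proof -
  have "of_nat CARD('n) = (0 :: 'k)"
    using p n by (simp add: of_nat_eq_0_iff_char_dvd)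
  then have "(of_nat CARD('n) :: ('n, 'k) symh) = 0"
    by (metis symh_const_of_nat symh_scale_simps(3))
  then have "fps_const (of_nat CARD('n) :: ('n, 'k) symh) = 0" by simp
  then show ?thesis by (simp only: fps_of_nat)
qed

text \<open>The derivation \<open>z d/dz\<close> sends \<open>1 - x\<^sub>j z\<close> to \<open>(1 - x\<^sub>j z) - 1\<close>, so the logarithmic derivative
  of \<open>P\<close> is \<open>n - \<Sum>\<^sub>j 1/(1 - x\<^sub>j z)\<close>, where \<open>n = 0\<close> in \<open>k\<close>.\<close>

lemma euler_trunc_power:
  "fps_X ^ Suc p dvd euler (trunc_power p c) +
    fps_const (symh_const c) * trunc_power p c * (\<Sum>j\<in>UNIV. geom_series j :: ('n, 'k) symh fps)"
proof -
  have "(\<Sum>j\<in>UNIV. geom_series j * euler (lin_factor j) :: ('n, 'k) symh fps) =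
    (\<Sum>j\<in>UNIV. 1 - geom_series j)"
    by (rule sum.cong) (simp_all add: euler_lin_factor right_diff_distrib mult.commute[of "geom_series _"] lin_factor_geom_series)
  also have "\<dots> = - (\<Sum>j\<in>UNIV. geom_series j)"
    by (simp only: sum_subtractf sum_constant of_nat_card_0) simp
  finally have T: "(\<Sum>j\<in>UNIV. geom_series j * euler (lin_factor j) :: ('n, 'k) symh fps) = \<dots>" .
  have "fps_X ^ Suc p dvd euler (trunc_power p c) - fps_const (symh_const c) * trunc_power p c *
     (\<Sum>j\<in>UNIV. geom_series j * euler (lin_factor j) :: ('n, 'k) symh fps)"
  proof (rule deriv_trunc_power[OF p derivation_euler])
    show "euler (fps_const (symh_const r) :: ('n, 'k) symh fps) = 0" for r
      by (rule fps_ext) (simp add: euler_nth)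
    show "fps_X dvd euler (lin_factor j :: ('n, 'k) symh fps)" for j
      by (simp add: euler_def)
  qed
  then show ?thesis unfolding T by simp
qed

text \<open>Apply \<open>z d/dz\<close> to the truncated power \<open>G\<close>: to order \<open>z\<^sup>p\<close> the result is
  \<open>- c G \<Sum>\<^sub>j 1/(1 - x\<^sub>j z) = - c \<Sum>\<^sub>j F\<^sub>j\<close>, because \<open>n = 0\<close> in \<open>k\<close>; but \<open>z d/dz\<close> multiplies the
  coefficient of \<open>z\<^sup>p\<close> by \<open>p = 0\<close>.\<close>

lemma sum_f_poly: "symh_const c * (\<Sum>i\<in>UNIV. f_poly p c i :: ('n, 'k) symh) = 0"
proof -
  have "(- euler (trunc_power p c)) $ p = (fps_const (symh_const c) * trunc_power p c *
      (\<Sum>j\<in>UNIV. geom_series j :: ('n, 'k) symh fps)) $ p"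
  proof (rule fps_nth_eqI_mod)
    have "- euler (trunc_power p c) - fps_const (symh_const c) * trunc_power p c *
        (\<Sum>j\<in>UNIV. geom_series j :: ('n, 'k) symh fps) =
      - (euler (trunc_power p c) + fps_const (symh_const c) * trunc_power p c *
        (\<Sum>j\<in>UNIV. geom_series j))" by simp
    then show "fps_X ^ Suc p dvd - euler (trunc_power p c) - fps_const (symh_const c) * trunc_power p c *
        (\<Sum>j\<in>UNIV. geom_series j :: ('n, 'k) symh fps)"
      using euler_trunc_power by (metis dvd_minus_iff)
  qed
  moreover have "of_nat p = (0 :: ('n, 'k) symh)"
    using p(1) by (metis of_nat_CHAR symh_const_of_nat symh_scale_simps(3))
  moreover have "fps_const (symh_const c) * trunc_power p c * (\<Sum>j\<in>UNIV. geom_series j :: ('n, 'k) symh fps)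
    = fps_const (symh_const c) * (\<Sum>i\<in>UNIV. F_series p c i)"
    unfolding F_series_eq sum_distrib_right[symmetric] by (simp only: mult_ac)
  ultimately show ?thesis
    by (simp add: euler_nth f_poly_def fps_sum_nth)
qed

text \<open>With \<open>g\<^sub>j = 1/(1 - x\<^sub>j z)\<close> and \<open>G\<close> the truncated power, \<open>\<partial>\<^sub>u\<close> contributes
  \<open>u\<^sub>i z g\<^sub>i\<^sup>2 G - c z g\<^sub>i G \<Sum>\<^sub>j u\<^sub>j g\<^sub>j\<close> and the divided differences contribute
  \<open>- c z g\<^sub>i G \<Sum>\<^sub>j (u\<^sub>i - u\<^sub>j) g\<^sub>j\<close>. The terms \<open>u\<^sub>j g\<^sub>j\<close> cancel, and what is left is \<open>u\<^sub>i z\<close> times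
  a series that does not involve \<open>u\<close>; comparison with \<open>z d/dz F\<^sub>i\<close> identifies it.\<close>

lemma fps_op_dunkl_F_series:
  fixes u :: "'n \<Rightarrow> 'k"
  assumes u: "sum u UNIV = 0"
  shows "fps_X ^ Suc p dvd fps_op (dunkl c u) (F_series p c i) -
    fps_const (symh_const (u i)) * fps_X * (euler (F_series p c i) + F_series p c i)"
proof -
  let ?D = "fps_op (dir_deriv u) :: ('n, 'k) symh fps \<Rightarrow> _"
  let ?G = "trunc_power p c :: ('n, 'k) symh fps"
  let ?g = "geom_series :: 'n \<Rightarrow> ('n, 'k) symh fps"
  define k :: "'k \<Rightarrow> ('n, 'k) symh fps" where "k r = fps_const (symh_const r)" for r
  have k_hom: "k (r + s) = k r + k s" "k (r - s) = k r - k s" "k (r * s) = k r * k s" "k 0 = 0" for r s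
    unfolding k_def symh_const_hom by simp_all
  have "fps_op (\<lambda>a. a) F = F" for F :: "('n, 'k) symh fps" by (rule fps_ext) simp
  then have D: "derivation ?D"
    by unfold_locales (use fps_op_twisted_mult[of "dir_deriv u :: ('n, 'k) symh \<Rightarrow> _" "\<lambda>a. a"] in
      \<open>simp_all add: dir_deriv_add dir_deriv_mult u fps_op_add\<close>)
  interpret D: derivation ?D by (rule D)
  interpret Z: derivation "euler :: ('n, 'k) symh fps \<Rightarrow> _" by (rule derivation_euler)
  have D_diff: "dir_deriv u (a - b) = dir_deriv u a - dir_deriv u b" for a b :: "('n, 'k) symh"
    by (metis add_diff_cancel_right' diff_add_cancel dir_deriv_add[OF u])
  have D_lin: "?D (lin_factor j) = - (k (u j) * fps_X)" for j
    by (subst fps_op_lin_factor) (simp_all add: k_def D_diff u dir_deriv_spec)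
  define S where "S = (\<Sum>j\<in>UNIV. ?g j)"
  define U where "U = (\<Sum>j\<in>UNIV. k (u j) * ?g j)"
  have "(\<Sum>j\<in>UNIV. ?g j * ?D (lin_factor j)) = - (fps_X * U)"
    by (simp add: D_lin U_def sum_negf sum_distrib_left mult_ac)
  moreover have "fps_X ^ Suc p dvd ?D ?G - k c * ?G * (\<Sum>j\<in>UNIV. ?g j * ?D (lin_factor j))"
  unfolding k_def
  proof (rule deriv_trunc_power[OF p D])
    show "?D (fps_const (symh_const r)) = 0" for r
      by (rule fps_ext) (simp add: u)
    show "fps_X dvd ?D (lin_factor j)" for j by (simp add: D_lin)
  qed
  ultimately obtain H1 where H1: "?D ?G = fps_X ^ Suc p * H1 - k c * ?G * (fps_X * U)"
    by (elim dvdE) (simp add: eq_diff_eq)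
  from euler_trunc_power obtain H2 where H2: "euler ?G = fps_X ^ Suc p * H2 - k c * ?G * S"
    unfolding S_def k_def by (elim dvdE) (simp add: eq_diff_eq)
  have D_g: "?D (?g i) = ?g i ^ 2 * k (u i) * fps_X"
    using D.E_inverse[OF lin_factor_geom_series, of i] by (simp add: D_lin mult_ac)
  have Z_g: "euler (?g i) = ?g i ^ 2 - ?g i"
  proof -
    have "euler (?g i) = ?g i ^ 2 - ?g i * (lin_factor i * ?g i)"
      using Z.E_inverse[OF lin_factor_geom_series, of i]
      by (simp only: euler_lin_factor) (simp add: algebra_simps power2_eq_square)
    then show ?thesis by (simp add: lin_factor_geom_series)
  qed
  define d :: "'n \<Rightarrow> 'n \<Rightarrow> ('n, 'k) symh fps" where "d m l = of_bool (i = m) - of_bool (i = l)" for m l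
  let ?K = "\<lambda>m l. k (c * (u m - u l)) * (d m l * ?g (\<langle>m \<leftrightarrow> l\<rangle> \<langle>$\<rangle> i))"
  have "(\<Sum>(m, l) | m < l. k (c * (u m - u l)) * fps_op (ddiff m l) (F_series p c i)) =
     (\<Sum>(m, l) | m < l. (fps_X * ?g i * ?G) * ?K m l)"
    by (rule sum.cong[OF refl])
      (auto simp: F_series_eq fps_ddiff_mult fps_ddiff_trunc_power fps_ddiff_geom_series d_def mult_ac)
  also have "\<dots> = (fps_X * ?g i * ?G) * (\<Sum>(m, l) | m < l. ?K m l)"
    by (simp add: sum_distrib_left case_prod_unfold)
  also have "(\<Sum>(m, l) | m < l. ?K m l) = (\<Sum>t | t \<noteq> i. ?K i t)"
  proof (rule sum_pairs_at)
    fix m l :: 'n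
    have "d l m = - d m l" by (simp add: d_def)
    moreover have "d m l * ?g (\<langle>m \<leftrightarrow> l\<rangle> \<langle>$\<rangle> i) = d m l * ?g (\<langle>l \<leftrightarrow> m\<rangle> \<langle>$\<rangle> i)"
      by (simp only: swap_sym[of l m])
    ultimately show "?K m l = ?K l m"
      by (simp add: k_hom algebra_simps)
  qed (simp add: d_def)
  also have "\<dots> = (\<Sum>t | t \<noteq> i. k (c * (u i - u t)) * ?g t)"
    by (rule sum.cong) (auto simp: d_def)
  also have "\<dots> = (\<Sum>t\<in>UNIV. k (c * (u i - u t)) * ?g t)"
    by (rule sum.mono_neutral_left) (auto simp: k_hom)
  also have "\<dots> = k c * (k (u i) * S - U)"
    unfolding k_hom S_def U_def right_diff_distrib left_diff_distrib sum_subtractf sum_distrib_left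
    by (simp only: mult_ac)
  finally have "fps_op (dunkl c u) (F_series p c i) =
     ?D (F_series p c i) - fps_X * ?g i * ?G * (k c * (k (u i) * S - U))"
    by (simp only: fps_op_dunkl k_def)
  also have "\<dots> = k (u i) * fps_X * (?g i ^ 2 * ?G - k c * ?g i * ?G * S) + ?g i * fps_X ^ Suc p * H1"
    unfolding F_series_eq D.E_mult H1 D_g by (simp add: algebra_simps)
  also have "\<dots> = k (u i) * fps_X * (euler (F_series p c i) + F_series p c i)
      + fps_X ^ Suc p * (?g i * H1 - k (u i) * fps_X * ?g i * H2)"
    unfolding F_series_eq Z.E_mult H2 Z_g by (simp add: algebra_simps)
  finally show ?thesis by (simp add: k_def)
qed

text \<open>The coefficient of \<open>z\<^sup>p\<close> in \<open>u\<^sub>i z (z d/dz + 1) F\<^sub>i\<close> is \<open>u\<^sub>i ((p - 1) + 1)\<close> times a coefficient of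
  \<open>F\<^sub>i\<close>.\<close>

lemma dunkl_f_poly:
  fixes u :: "'n \<Rightarrow> 'k"
  assumes u: "sum u UNIV = 0"
  shows "dunkl c u (f_poly p c i) = 0"
proof -
  obtain N where N: "p = Suc N" using prime_gt_0_nat[OF p(2)] by (cases p) auto
  have p0: "of_nat (Suc N) = (0 :: ('n, 'k) symh)"
    using p(1) unfolding N by (metis of_nat_CHAR symh_const_of_nat symh_scale_simps(3))
  have "dunkl c u (f_poly p c i) = fps_op (dunkl c u) (F_series p c i) $ p"
    by (simp add: f_poly_def)
  also have "\<dots> = (fps_const (symh_const (u i)) * fps_X * (euler (F_series p c i) + F_series p c i)) $ p"
    by (rule fps_nth_eqI_mod, rule fps_op_dunkl_F_series[OF u])
  also have "\<dots> = symh_const (u i) * (of_nat (Suc N) * F_series p c i $ N)"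
    unfolding N by (simp add: euler_nth mult.assoc algebra_simps)
  also have "\<dots> = 0" by (simp only: p0) simp
  finally show ?thesis .
qed

end

section \<open>Monomials and grading\<close>

subsection \<open>Exponents\<close>

definition mdeg :: "('n::finite \<Rightarrow>\<^sub>0 nat) \<Rightarrow> nat" where
  "mdeg b = (\<Sum>i\<in>UNIV. lookup b i)"

lemma mdeg_add: "mdeg (b + b') = mdeg b + mdeg b'"
  by (simp add: mdeg_def lookup_add sum.distrib)

lemma mdeg_single: "mdeg (single i k) = k"
proof -
  have "lookup (single i k) j = (if j = i then k else 0)" for j
    by (simp add: lookup_single when_def)
  then show ?thesis by (simp add: mdeg_def)
qed

lemma mdeg_0: "mdeg 0 = 0"
  by (simp add: mdeg_def)

lemma mdeg_eq_0: "mdeg b = 0 \<longleftrightarrow> b = 0"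
  by (auto simp: mdeg_def intro: poly_mapping_eqI)

lemma homogeneous_iff: "homogeneous d f \<longleftrightarrow> (\<forall>b\<in>keys f. mdeg b = d)"
proof -
  have "(\<Sum>i\<in>keys b. lookup b i) = mdeg b" for b :: "'a \<Rightarrow>\<^sub>0 nat"
    unfolding mdeg_def by (rule sum.mono_neutral_left) (auto simp: in_keys_iff)
  then show ?thesis by (simp add: homogeneous_def)
qed

lemma homogeneous_0: "homogeneous d (0 :: ('n::finite, 'k::comm_ring_1) mpoly)"
  by (simp add: homogeneous_iff)

lemma homogeneous_add:
  fixes f g :: "('n::finite, 'k::comm_ring_1) mpoly"
  shows "homogeneous d f \<Longrightarrow> homogeneous d g \<Longrightarrow> homogeneous d (f + g)"
  unfolding homogeneous_iff using Poly_Mapping.keys_add[of f g] by blast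

lemma homogeneous_mult:
  fixes f g :: "('n::finite, 'k::comm_ring_1) mpoly"
  shows "homogeneous d f \<Longrightarrow> homogeneous e g \<Longrightarrow> homogeneous (d + e) (f * g)"
  unfolding homogeneous_iff using keys_mult[of f g] by (fastforce simp: mdeg_add)

lemma homogeneous_const: "homogeneous 0 (PConst r :: ('n::finite, 'k::comm_ring_1) mpoly)"
  by (auto simp: homogeneous_iff mdeg_0 split: if_splits)

lemma homogeneous_uminus:
  fixes f :: "('n::finite, 'k::comm_ring_1) mpoly"
  shows "homogeneous d f \<Longrightarrow> homogeneous d (- f)"
  by (simp add: homogeneous_iff in_keys_iff)

lemma homogeneous_var: "homogeneous (Suc 0) (PVar i :: ('n::finite, 'k::comm_ring_1) mpoly)"
  by (auto simp: homogeneous_iff PVar_def mdeg_single)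

lemma homogeneous_sum:
  fixes f :: "'s \<Rightarrow> ('n::finite, 'k::comm_ring_1) mpoly"
  shows "(\<And>s. s \<in> S \<Longrightarrow> homogeneous d (f s)) \<Longrightarrow> homogeneous d (sum f S)"
  by (induction S rule: infinite_finite_induct) (auto intro: homogeneous_0 homogeneous_add)

lemma homogeneous_power:
  fixes f :: "('n::finite, 'k::comm_ring_1) mpoly"
  shows "homogeneous d f \<Longrightarrow> homogeneous (k * d) (f ^ k)"
  by (induction k) (auto intro: homogeneous_mult homogeneous_const simp flip: single_one)

lemma homogeneous_prod:
  fixes f :: "'s \<Rightarrow> ('n::finite, 'k::comm_ring_1) mpoly"
  shows "(\<And>s. s \<in> S \<Longrightarrow> homogeneous (d s) (f s)) \<Longrightarrow> homogeneous (sum d S) (prod f S)"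
  by (induction S rule: infinite_finite_induct)
    (auto intro: homogeneous_mult homogeneous_const simp flip: single_one)

subsection \<open>Elimination of the last variable\<close>

lemma homogeneous_peval:
  fixes f :: "('n::finite, 'k::comm_ring_1) mpoly"
    and g :: "'n \<Rightarrow> ('m::finite, 'k) mpoly"
  assumes f: "homogeneous d f" and g: "\<And>i. homogeneous (Suc 0) (g i)"
  shows "homogeneous d (peval PConst g f)"
  unfolding peval_def
proof (rule homogeneous_sum)
  fix b assume b: "b \<in> keys f"
  have "homogeneous (\<Sum>i\<in>keys b. lookup b i * Suc 0)
      (\<Prod>i\<in>keys b. g i ^ lookup b i)"
    by (rule homogeneous_prod, rule homogeneous_power, rule g)
  also have "(\<Sum>i\<in>keys b. lookup b i * Suc 0) = d"
    using f b by (simp add: homogeneous_def)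
  finally show "homogeneous d (PConst (lookup f b) *
      (\<Prod>i\<in>keys b. g i ^ lookup b i))"
    using homogeneous_mult[OF homogeneous_const] by (metis add_0)
qed

lemma peval_PVar: "peval PConst PVar f = f"
  by (induction f rule: mpoly_induct)
    (simp_all add: coeff_hom_PConst.peval_const coeff_hom_PConst.peval_var
      coeff_hom_PConst.peval_add coeff_hom_PConst.peval_mult)

lemma peval_cong:
  assumes "\<And>b i. b \<in> keys f \<Longrightarrow> i \<in> keys b \<Longrightarrow> g i = g' i"
  shows "peval h g f = peval h g' f"
  unfolding peval_def using assms by (intro sum.cong refl arg_cong2[of _ _ _ _ "(*)"] prod.cong) auto

lemma carrier_poly_ring: "carrier (poly_ring W) = {f. \<forall>m\<in>keys f. keys m \<subseteq> W}"
  by (simp add: poly_ring_def)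

lemma carrier_poly_ring_add:
  "f \<in> carrier (poly_ring W) \<Longrightarrow> g \<in> carrier (poly_ring W) \<Longrightarrow> f + g \<in> carrier (poly_ring W)"
  unfolding carrier_poly_ring using Poly_Mapping.keys_add[of f g] by blast

lemma carrier_poly_ring_uminus:
  "f \<in> carrier (poly_ring W) \<Longrightarrow> - f \<in> carrier (poly_ring W)"
  by (simp add: carrier_poly_ring in_keys_iff)

lemma carrier_poly_ring_mult:
  assumes "f \<in> carrier (poly_ring W)" "g \<in> carrier (poly_ring W)"
  shows "f * g \<in> carrier (poly_ring W)"
proof -
  have "keys (a + b) \<subseteq> W" if "keys a \<subseteq> W" "keys b \<subseteq> W"
    for a b :: "_ \<Rightarrow>\<^sub>0 nat"
    using Poly_Mapping.keys_add[of a b] that by blast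
  then show ?thesis
    using assms keys_mult[of f g] unfolding carrier_poly_ring by blast
qed

lemma carrier_poly_ring_const: "PConst r \<in> carrier (poly_ring W)"
  by (auto simp: carrier_poly_ring split: if_splits)

lemma carrier_poly_ring_var: "i \<in> W \<Longrightarrow> PVar i \<in> carrier (poly_ring W)"
  by (auto simp: carrier_poly_ring PVar_def)

lemma carrier_poly_ring_0: "0 \<in> carrier (poly_ring W)"
  by (simp add: carrier_poly_ring)

lemma carrier_poly_ring_sum:
  "(\<And>s. s \<in> S \<Longrightarrow> f s \<in> carrier (poly_ring W)) \<Longrightarrow> sum f S \<in> carrier (poly_ring W)"
  by (induction S rule: infinite_finite_induct) (auto intro: carrier_poly_ring_0 carrier_poly_ring_add)

lemma elim_last_hom:
  "elim_last (a + b) = elim_last a + elim_last b"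
  "elim_last (a * b) = elim_last a * elim_last b"
  "elim_last (a - b) = elim_last a - elim_last b"
  "elim_last (symh_const r) = PConst r"
proof -
  show "elim_last (a + b) = elim_last a + elim_last b" "elim_last (a * b) = elim_last a * elim_last b"
    "elim_last (a - b) = elim_last a - elim_last b"
    by (induction a rule: symh.abs_induct; induction b rule: symh.abs_induct;
      simp only: plus_symh.abs_eq times_symh.abs_eq minus_symh.abs_eq elim_last.abs_eq
        coeff_hom_PConst.peval_add coeff_hom_PConst.peval_mult coeff_hom_PConst.peval_diff)+
  show "elim_last (symh_const r) = PConst r"
    by (simp only: symh_const.abs_eq elim_last.abs_eq coeff_hom_PConst.peval_const)
qed

lemma elim_last_0 [simp]: "elim_last 0 = 0"
  by (metis elim_last_hom(3) diff_self)

lemma elim_last_1 [simp]: "elim_last 1 = 1"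
  by (metis elim_last_hom(4) single_one symh_scale_simps(4))

lemma elim_last_sum: "elim_last (sum f S) = (\<Sum>s\<in>S. elim_last (f s))"
  by (induction S rule: infinite_finite_induct) (simp_all add: elim_last_hom)

lemma elim_last_var:
  "elim_last (symh_var i) =
    (if i \<in> initial_indices then PVar i else - (\<Sum>j\<in>initial_indices. PVar j))"
  by (simp only: symh_var.abs_eq elim_last.abs_eq coeff_hom_PConst.peval_var)

lemma elim_last_carrier: "elim_last a \<in> carrier (poly_ring initial_indices)"
proof (induction a rule: symh_induct)
  case (var i)
  show ?case
    unfolding elim_last_var
    by (auto intro!: carrier_poly_ring_uminus carrier_poly_ring_sum carrier_poly_ring_var)
qed (simp_all only: elim_last_hom carrier_poly_ring_const carrier_poly_ring_add carrier_poly_ring_mult)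

lemma elim_last_abs:
  assumes "f \<in> carrier (poly_ring initial_indices)"
  shows "elim_last (abs_symh f) = f"
proof -
  have "elim_last (abs_symh f) = peval PConst PVar f"
    unfolding elim_last.abs_eq by (rule peval_cong) (use assms in \<open>auto simp: carrier_poly_ring\<close>)
  then show ?thesis by (simp add: peval_PVar)
qed

lemma initial_indices_eq: "initial_indices = (UNIV - {Max UNIV} :: 'n::{finite, linorder} set)"
  by (auto simp: initial_indices_def order.not_eq_order_implies_strict)

lemma card_initial_indices: "card (initial_indices :: 'n::{finite, linorder} set) = CARD('n) - 1"
  by (simp add: initial_indices_eq)

lemma symh_var_last:
  "symh_var (Max UNIV) = - (\<Sum>j\<in>initial_indices. symh_var j :: ('n::{finite, linorder}, 'k::field) symh)"
proof -
  have "(\<Sum>i\<in>UNIV. symh_var i :: ('n, 'k) symh) =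
      symh_var (Max UNIV) + (\<Sum>j\<in>initial_indices. symh_var j)"
    unfolding initial_indices_eq by (rule sum.remove) auto
  then show ?thesis by (simp add: sum_symh_var eq_neg_iff_add_eq_0)
qed

lemma abs_symh_sum: "abs_symh (sum f S) = (\<Sum>s\<in>S. abs_symh (f s))"
  by (induction S rule: infinite_finite_induct) (simp_all add: zero_symh_def flip: plus_symh.abs_eq)

lemma abs_elim_last: "abs_symh (elim_last a) = a"
proof (induction a rule: symh_induct)
  case (const r)
  show ?case by (subst elim_last_hom(4)) (rule symh_const.abs_eq[symmetric])
next
  case (var i)
  show ?case
  proof (cases "i \<in> initial_indices")
    case True
    then show ?thesis by (subst elim_last_var) (simp add: symh_var.abs_eq)
  next
    case False
    then have "i = Max UNIV" by (simp add: initial_indices_eq)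
    then have "abs_symh (elim_last (symh_var i)) = abs_symh (- (\<Sum>j\<in>initial_indices. PVar j))"
      using False by (simp add: elim_last_var)
    also have "\<dots> = - (\<Sum>j\<in>initial_indices. symh_var j :: ('a, 'b) symh)"
      by (simp add: symh_var.abs_eq abs_symh_sum flip: uminus_symh.abs_eq)
    also have "\<dots> = symh_var i"
      using symh_var_last[where ?'n = 'a and ?'k = 'b] \<open>i = Max UNIV\<close> by simp
    finally show ?thesis .
  qed
next
  case (add a b)
  then show ?case by (simp add: elim_last_hom flip: plus_symh.abs_eq)
next
  case (mult a b)
  then show ?case by (simp add: elim_last_hom flip: times_symh.abs_eq)
qed

lemma inj_elim_last: "inj elim_last"
  by (metis abs_elim_last injI)

subsection \<open>The grading\<close>

text \<open>Elimination of \<open>x\<^sub>n\<close> is linear in the variables, so it preserves degrees and the graded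
  pieces of \<open>A\<close> can be read off in the polynomial ring.\<close>

lemma symh_degree_iff: "a \<in> symh_degree d \<longleftrightarrow> homogeneous d (elim_last a)"
proof
  assume "a \<in> symh_degree d"
  then obtain f where f: "a = abs_symh f" "homogeneous d f"
    by (auto simp: symh_degree_def)
  show "homogeneous d (elim_last a)"
    unfolding f(1) elim_last.abs_eq
    by (rule homogeneous_peval[OF f(2)])
      (simp add: homogeneous_var homogeneous_uminus homogeneous_sum)
next
  assume "homogeneous d (elim_last a)"
  then show "a \<in> symh_degree d"
    unfolding symh_degree_def by (metis abs_elim_last image_eqI mem_Collect_eq)
qed

lemma symh_degree_0: "0 \<in> symh_degree d"
  by (simp add: symh_degree_iff homogeneous_0)

lemma symh_degree_add: "a \<in> symh_degree d \<Longrightarrow> b \<in> symh_degree d \<Longrightarrow> a + b \<in> symh_degree d"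
  by (simp add: symh_degree_iff homogeneous_add elim_last_hom)

lemma symh_degree_diff: "a \<in> symh_degree d \<Longrightarrow> b \<in> symh_degree d \<Longrightarrow> a - b \<in> symh_degree d"
  using homogeneous_add[of d "elim_last a" "- elim_last b"]
  by (simp add: symh_degree_iff homogeneous_uminus elim_last_hom)

lemma symh_degree_mult: "a \<in> symh_degree d \<Longrightarrow> b \<in> symh_degree e \<Longrightarrow> a * b \<in> symh_degree (d + e)"
  by (simp add: symh_degree_iff homogeneous_mult elim_last_hom)

lemma symh_degree_const: "symh_const r \<in> symh_degree 0"
  by (simp add: symh_degree_iff homogeneous_const elim_last_hom)

lemma symh_degree_1: "1 \<in> symh_degree 0"
  using symh_degree_const[of 1] by (simp add: symh_scale_simps)

lemma symh_degree_var: "symh_var i \<in> symh_degree (Suc 0)"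
  by (auto simp: symh_degree_def symh_var_def intro!: imageI homogeneous_var)

lemma symh_degree_sum:
  "(\<And>s. s \<in> S \<Longrightarrow> f s \<in> symh_degree d) \<Longrightarrow> sum f S \<in> symh_degree d"
  by (induction S rule: infinite_finite_induct) (auto intro: symh_degree_0 symh_degree_add)

subsection \<open>The basis of monomials\<close>

definition symh_mono :: "('n \<Rightarrow>\<^sub>0 nat) \<Rightarrow> ('n::{finite, linorder}, 'k::field) symh" where
  "symh_mono b = abs_symh (single b 1)"

definition symh_coeff :: "('n::{finite, linorder}, 'k::field) symh \<Rightarrow> ('n \<Rightarrow>\<^sub>0 nat) \<Rightarrow> 'k" where
  "symh_coeff a = lookup (elim_last a)"

abbreviation lincomb ::
    "('n \<Rightarrow>\<^sub>0 nat) set \<Rightarrow> (('n \<Rightarrow>\<^sub>0 nat) \<Rightarrow> 'k) \<Rightarrow> ('n::{finite, linorder}, 'k::field) symh" where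
  "lincomb S \<alpha> \<equiv> (\<Sum>b\<in>S. symh_const (\<alpha> b) * symh_mono b)"

lemma symh_mono_0 [simp]: "symh_mono 0 = 1"
  by (simp add: symh_mono_def one_symh_def)

lemma symh_mono_add: "symh_mono (b + b') = symh_mono b * symh_mono b'"
  by (simp add: symh_mono_def mult_single times_symh.abs_eq)

lemma symh_mono_single_1: "symh_mono (single i (Suc 0)) = symh_var i"
  by (simp add: symh_mono_def symh_var_def PVar_def)

lemma symh_mono_single:
  "symh_mono (single i k) = (symh_var i ^ k :: ('n::{finite, linorder}, 'k::field) symh)"
proof (induction k)
  case (Suc k)
  have "symh_mono (single i (Suc k)) = (symh_mono (single i (Suc 0) + single i k) :: ('n, 'k) symh)"
    by (simp flip: single_add)
  then show ?case
    by (simp add: symh_mono_add Suc symh_mono_single_1)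
qed simp

lemma elim_last_mono:
  "keys b \<subseteq> initial_indices \<Longrightarrow> elim_last (symh_mono b) = single b 1"
  unfolding symh_mono_def by (rule elim_last_abs) (auto simp: carrier_poly_ring)

lemma symh_coeff_mono:
  "keys b \<subseteq> initial_indices \<Longrightarrow> symh_coeff (symh_mono b) b' = of_bool (b = b')"
  by (simp add: symh_coeff_def elim_last_mono lookup_single when_def)

lemma symh_coeff_add: "symh_coeff (a + a') b = symh_coeff a b + symh_coeff a' b"
  by (simp add: symh_coeff_def elim_last_hom lookup_add)

lemma lookup_PConst_mult: "lookup (PConst r * f) b = r * lookup f b"
proof (induction f rule: update_induct)
  case (update f m a)
  then show ?case
    by (simp add: update_eq_add distrib_left lookup_add mult_single lookup_single when_def)
qed simp

lemma symh_coeff_scale: "symh_coeff (symh_const r * a) b = r * symh_coeff a b"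
  by (simp add: symh_coeff_def elim_last_hom lookup_PConst_mult)

lemma symh_coeff_sum: "symh_coeff (sum f S) b = (\<Sum>s\<in>S. symh_coeff (f s) b)"
  by (simp add: symh_coeff_def elim_last_sum lookup_sum)

lemma symh_eqI: "(\<And>b. symh_coeff a b = symh_coeff a' b) \<Longrightarrow> a = a'"
  by (rule injD[OF inj_elim_last]) (auto simp: symh_coeff_def intro: poly_mapping_eqI)

lemma symh_coeff_outside:
  "\<not> keys b \<subseteq> initial_indices \<Longrightarrow> symh_coeff a b = 0"
  using elim_last_carrier[of a] by (auto simp: symh_coeff_def carrier_poly_ring in_keys_iff)

definition exponents :: "nat \<Rightarrow> ('n::{finite, linorder} \<Rightarrow>\<^sub>0 nat) set" where
  "exponents d = {b. keys b \<subseteq> initial_indices \<and> mdeg b = d}"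

lemma finite_bounded_exponents: "finite {b :: 'n::finite \<Rightarrow>\<^sub>0 nat. \<forall>i. lookup b i \<le> k}"
proof (rule finite_imageD[of lookup])
  have "finite (Pi\<^sub>E (UNIV :: 'n set) (\<lambda>_. {..k}))"
    by (rule finite_PiE) auto
  then show "finite (lookup ` {b :: 'n \<Rightarrow>\<^sub>0 nat. \<forall>i. lookup b i \<le> k})"
    by (rule finite_subset[rotated]) auto
  show "inj_on lookup {b :: 'n \<Rightarrow>\<^sub>0 nat. \<forall>i. lookup b i \<le> k}"
    by (intro inj_onI poly_mapping_eqI) simp
qed

lemma lookup_le_mdeg: "lookup b i \<le> mdeg b"
  unfolding mdeg_def by (rule member_le_sum) auto

lemma finite_exponents: "finite (exponents d)"
  by (rule finite_subset[OF _ finite_bounded_exponents[of d]])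
    (use lookup_le_mdeg in \<open>auto simp: exponents_def\<close>)

lemma symh_degree_mono: "symh_mono b \<in> symh_degree (mdeg b)"
  unfolding symh_degree_def symh_mono_def by (intro imageI) (simp add: homogeneous_iff)

lemma symh_expand:
  assumes "finite S" "\<And>b. symh_coeff a b \<noteq> 0 \<Longrightarrow> b \<in> S"
  shows "a = lincomb S (symh_coeff a)"
proof (rule symh_eqI)
  fix b'
  have "symh_coeff (symh_const (symh_coeff a b) * symh_mono b) b' =
      (if b = b' then symh_coeff a b else 0)" for b
    using symh_coeff_outside[of b a] symh_coeff_mono[of b b']
    by (cases "keys b \<subseteq> initial_indices") (auto simp: symh_coeff_scale)
  then show "symh_coeff a b' = symh_coeff (lincomb S (symh_coeff a)) b'"
    using assms by (auto simp: symh_coeff_sum)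
qed

lemma symh_expand_degree:
  assumes "a \<in> symh_degree d"
  shows "a = lincomb (exponents d) (symh_coeff a)"
proof (rule symh_expand[OF finite_exponents])
  fix b assume b: "symh_coeff a b \<noteq> 0"
  then have "b \<in> keys (elim_last a)"
    by (simp add: symh_coeff_def in_keys_iff)
  moreover have "keys b \<subseteq> initial_indices"
    using b symh_coeff_outside by blast
  ultimately show "b \<in> exponents d"
    using assms by (simp add: symh_degree_iff homogeneous_iff exponents_def)
qed

lemma symh_mono_span: "\<exists>S \<alpha>. finite S \<and> S \<subseteq> {b. keys b \<subseteq> initial_indices} \<and>
    a = lincomb S \<alpha>"
proof (intro exI conjI)
  let ?S = "keys (elim_last a)"
  show "finite ?S" by simp
  show "?S \<subseteq> {b. keys b \<subseteq> initial_indices}"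
    using elim_last_carrier[of a] unfolding carrier_poly_ring by blast
  show "a = lincomb ?S (symh_coeff a)"
    by (rule symh_expand) (auto simp: symh_coeff_def in_keys_iff)
qed

subsection \<open>The augmentation\<close>

definition augmentation :: "('n::{finite, linorder}, 'k::field) symh \<Rightarrow> 'k" where
  "augmentation a = peval id (\<lambda>_. 0) (elim_last a)"

interpretation coeff_hom_id: coeff_hom "id :: 'k::comm_ring_1 \<Rightarrow> 'k"
  by unfold_locales simp_all

lemma augmentation_hom:
  "augmentation (a + b) = augmentation a + augmentation b"
  "augmentation (a * b) = augmentation a * augmentation b"
  "augmentation (symh_const r) = r"
  by (simp_all add: augmentation_def elim_last_hom coeff_hom_id.peval_add coeff_hom_id.peval_mult
      coeff_hom_id.peval_const)

lemma augmentation_0: "augmentation 0 = 0"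
  using augmentation_hom(3)[of 0] by (simp add: symh_scale_simps)

lemma augmentation_1: "augmentation 1 = 1"
  using augmentation_hom(3)[of 1] by (simp add: symh_scale_simps)

lemma augmentation_sum: "augmentation (sum f S) = (\<Sum>s\<in>S. augmentation (f s))"
  by (induction S rule: infinite_finite_induct) (simp_all add: augmentation_0 augmentation_hom)

lemma augmentation_power: "augmentation (a ^ k) = augmentation a ^ k"
  by (induction k) (simp_all add: augmentation_1 augmentation_hom)

lemma augmentation_degree:
  assumes "a \<in> symh_degree d" "d > 0"
  shows "augmentation a = 0"
  unfolding augmentation_def peval_def
proof (rule sum.neutral, rule ballI)
  fix b assume "b \<in> keys (elim_last a)"
  then have "mdeg b = d" using assms(1) by (simp add: symh_degree_iff homogeneous_iff)
  then have "b \<noteq> 0" using assms(2) by (auto simp: mdeg_0)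
  then have "\<exists>i. lookup b i \<noteq> 0" by (auto intro: poly_mapping_eqI)
  then obtain i where "i \<in> keys b" by (auto simp: in_keys_iff)
  then have "(\<Prod>i\<in>keys b. 0 ^ lookup b i :: 'b) = 0"
    by (intro prod_zero bexI[of _ i]) (auto simp: in_keys_iff)
  then show "id (lookup (elim_last a) b) *
      (\<Prod>i\<in>keys b. 0 ^ lookup b i) = 0" by simp
qed

lemma augmentation_var: "augmentation (symh_var i) = 0"
  using augmentation_degree[OF symh_degree_var] by simp

lemma symh_degree_0_const:
  assumes "a \<in> symh_degree 0"
  shows "a = symh_const (augmentation a)"
proof -
  have "exponents 0 = {0 :: 'a \<Rightarrow>\<^sub>0 nat}"
    by (auto simp: exponents_def mdeg_eq_0)
  then obtain r where "a = symh_const r"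
    using symh_expand_degree[OF assms] by auto
  then show ?thesis by (simp add: augmentation_hom)
qed

section \<open>Genericity\<close>

text \<open>A matrix of polynomials whose value at \<open>0\<close> is an invertible diagonal matrix is invertible at
  all but finitely many points. Gaussian elimination without division proves this by induction:
  after elimination of the first row and column with pivot \<open>M s s\<close>, the remaining matrix \<open>M'\<close> is
  again diagonal and invertible at \<open>0\<close>, and only the zeros of the pivot have to be excluded.\<close>

lemma generic_solvable_poly:
  fixes M :: "'s \<Rightarrow> 's \<Rightarrow> 'k::field poly"
  assumes "finite S"
    and "\<And>a. a \<in> S \<Longrightarrow> poly (M a a) 0 \<noteq> 0"
    and "\<And>a b. a \<in> S \<Longrightarrow> b \<in> S \<Longrightarrow> a \<noteq> b \<Longrightarrow> poly (M a b) 0 = 0"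
  shows "\<exists>C. finite C \<and> (\<forall>c. c \<notin> C \<longrightarrow>
    (\<forall>\<beta>. \<exists>\<alpha>. \<forall>b\<in>S. (\<Sum>a\<in>S. \<alpha> a * poly (M a b) c) = \<beta> b))"
  using assms
proof (induction S arbitrary: M rule: finite_induct)
  case empty
  show ?case by (intro exI[of _ "{}"]) simp
next
  case (insert s S)
  (* the Schur complement of the pivot, multiplied by the pivot *)
  define M' where "M' a b = M s s * M a b - M a s * M s b" for a b
  have "\<exists>C. finite C \<and> (\<forall>c. c \<notin> C \<longrightarrow>
    (\<forall>\<beta>. \<exists>\<alpha>. \<forall>b\<in>S. (\<Sum>a\<in>S. \<alpha> a * poly (M' a b) c) = \<beta> b))"
  proof (rule insert.IH)
    fix a assume a: "a \<in> S"
    then have "poly (M a s) 0 = 0" "poly (M a a) 0 \<noteq> 0" "poly (M s s) 0 \<noteq> 0"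
      using insert.prems insert.hyps by (metis insertCI)+
    then show "poly (M' a a) 0 \<noteq> 0" by (simp add: M'_def)
  next
    fix a b assume ab: "a \<in> S" "b \<in> S" "a \<noteq> b"
    then have "poly (M a s) 0 = 0" "poly (M a b) 0 = 0"
      using insert.prems insert.hyps by (metis insertCI)+
    then show "poly (M' a b) 0 = 0" by (simp add: M'_def)
  qed
  then obtain C where C: "finite C" "\<And>c \<beta>. c \<notin> C \<Longrightarrow>
    \<exists>\<alpha>. \<forall>b\<in>S. (\<Sum>a\<in>S. \<alpha> a * poly (M' a b) c) = \<beta> b" by blast
  have "M s s \<noteq> 0" using insert.prems(1)[of s] by auto
  then have fin: "finite (C \<union> {c. poly (M s s) c = 0})"
    using C(1) poly_roots_finite by blast
  moreover have "\<exists>\<alpha>. \<forall>b\<in>insert s S. (\<Sum>a\<in>insert s S. \<alpha> a * poly (M a b) c) = \<beta> b"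
    if c: "c \<notin> C \<union> {c. poly (M s s) c = 0}" for c \<beta>
  proof -
    let ?m = "\<lambda>a b. poly (M a b) c"
    have nz: "?m s s \<noteq> 0" using c by simp
    obtain \<alpha> where \<alpha>: "\<And>b. b \<in> S \<Longrightarrow>
        (\<Sum>a\<in>S. \<alpha> a * poly (M' a b) c) = ?m s s * \<beta> b - ?m s b * \<beta> s"
      using C(2)[of c "\<lambda>b. ?m s s * \<beta> b - ?m s b * \<beta> s"] c by blast
    (* the equation for column s determines the coefficient of the pivot row *)
    define x where "x = (\<beta> s - (\<Sum>a\<in>S. \<alpha> a * ?m a s)) / ?m s s"
    define \<alpha>' where "\<alpha>' = (\<lambda>a. if a = s then x else \<alpha> a)"
    have x: "?m s s * x = \<beta> s - (\<Sum>a\<in>S. \<alpha> a * ?m a s)"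
      using nz by (simp add: x_def)
    have sum: "(\<Sum>a\<in>insert s S. \<alpha>' a * ?m a b) = x * ?m s b + (\<Sum>a\<in>S. \<alpha> a * ?m a b)" for b
    proof -
      have "(\<Sum>a\<in>S. \<alpha>' a * ?m a b) = (\<Sum>a\<in>S. \<alpha> a * ?m a b)"
        using insert.hyps by (intro sum.cong) (auto simp: \<alpha>'_def)
      then show ?thesis using insert.hyps by (simp add: \<alpha>'_def)
    qed
    have "(\<Sum>a\<in>insert s S. \<alpha>' a * ?m a b) = \<beta> b" if "b \<in> insert s S" for b
    proof (cases "b = s")
      case True
      then show ?thesis using x by (simp add: sum mult.commute)
    next
      case False
      with that have b: "b \<in> S" by simp
      have "?m s s * (\<Sum>a\<in>S. \<alpha> a * ?m a b) =
          (\<Sum>a\<in>S. \<alpha> a * poly (M' a b) c) + ?m s b * (\<Sum>a\<in>S. \<alpha> a * ?m a s)"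
        unfolding sum_distrib_left sum.distrib[symmetric]
        by (rule sum.cong) (simp_all add: M'_def algebra_simps)
      also have "\<dots> = ?m s s * \<beta> b - ?m s b * (?m s s * x)"
        unfolding \<alpha>[OF b] x by (simp add: algebra_simps)
      finally have "?m s s * (x * ?m s b + (\<Sum>a\<in>S. \<alpha> a * ?m a b)) = ?m s s * \<beta> b"
        by (simp add: algebra_simps)
      then show ?thesis using nz by (simp add: sum)
    qed
    then show ?thesis by blast
  qed
  ultimately show ?case by blast
qed

lemma generic_solvable:
  fixes M :: "'k::field \<Rightarrow> 's \<Rightarrow> 's \<Rightarrow> 'k"
  assumes S: "finite S" and M: "\<And>a b. \<exists>q. \<forall>c. M c a b = poly q c"
    and diag: "\<And>a. a \<in> S \<Longrightarrow> M 0 a a \<noteq> 0"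
    and off: "\<And>a b. a \<in> S \<Longrightarrow> b \<in> S \<Longrightarrow> a \<noteq> b \<Longrightarrow> M 0 a b = 0"
  shows "\<exists>C. finite C \<and> (\<forall>c. c \<notin> C \<longrightarrow> (\<forall>\<beta>. \<exists>\<alpha>. \<forall>b\<in>S. (\<Sum>a\<in>S. \<alpha> a * M c a b) = \<beta> b))"
proof -
  from M obtain Q where Q: "\<And>a b c. M c a b = poly (Q a b) c" by metis
  show ?thesis unfolding Q
    by (rule generic_solvable_poly[OF S]) (use diag off in \<open>simp_all add: Q\<close>)
qed

text \<open>The coefficients of the polynomial lie in \<open>A\<close>, so that linear operators can be applied to
  them one by one.\<close>

definition poly_family :: "('k::field \<Rightarrow> ('n::{finite, linorder}, 'k) symh) \<Rightarrow> bool" where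
  "poly_family g \<longleftrightarrow> (\<exists>P. \<forall>c. g c = poly P (symh_const c))"

lemma poly_family_const: "poly_family (\<lambda>_. a)"
  unfolding poly_family_def by (rule exI[of _ "[:a:]"]) simp

lemma poly_family_param: "poly_family symh_const"
  unfolding poly_family_def by (rule exI[of _ "[:0, 1:]"]) simp

lemma poly_family_add: "poly_family g \<Longrightarrow> poly_family h \<Longrightarrow> poly_family (\<lambda>c. g c + h c)"
  unfolding poly_family_def by (metis poly_add)

lemma poly_family_diff: "poly_family g \<Longrightarrow> poly_family h \<Longrightarrow> poly_family (\<lambda>c. g c - h c)"
  unfolding poly_family_def by (metis poly_diff)

lemma poly_family_mult: "poly_family g \<Longrightarrow> poly_family h \<Longrightarrow> poly_family (\<lambda>c. g c * h c)"
  unfolding poly_family_def by (metis poly_mult)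

lemma poly_family_sum:
  "(\<And>s. s \<in> S \<Longrightarrow> poly_family (g s)) \<Longrightarrow> poly_family (\<lambda>c. \<Sum>s\<in>S. g s c)"
  by (induction S rule: infinite_finite_induct) (auto intro: poly_family_const poly_family_add)

lemma poly_family_prod:
  "(\<And>s. s \<in> S \<Longrightarrow> poly_family (g s)) \<Longrightarrow> poly_family (\<lambda>c. \<Prod>s\<in>S. g s c)"
  by (induction S rule: infinite_finite_induct) (auto intro: poly_family_const poly_family_mult)

lemma poly_family_linear:
  fixes L :: "('n::{finite, linorder}, 'k::field) symh \<Rightarrow> ('n, 'k) symh"
  assumes L: "\<And>a b. L (a + b) = L a + L b" "\<And>r a. L (symh_const r * a) = symh_const r * L a"
    and g: "poly_family g"
  shows "poly_family (\<lambda>c. L (g c))"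
proof -
  have L0: "L 0 = 0" using L(1)[of 0 0] by simp
  have Lsum: "L (sum f S) = (\<Sum>s\<in>S. L (f s))" for f and S :: "nat set"
    by (induction S rule: infinite_finite_induct) (simp_all add: L0 L)
  from g obtain P where P: "\<And>c. g c = poly P (symh_const c)" by (auto simp: poly_family_def)
  have "L (g c) = (\<Sum>i\<le>degree P. L (coeff P i) * symh_const c ^ i)" for c
    unfolding P poly_altdef Lsum
    using L(2) by (intro sum.cong) (simp_all add: mult.commute[of "coeff P _"] mult.commute[of "L _"]
        flip: symh_const_power)
  then show ?thesis
    unfolding poly_family_def
    by (intro exI[of _ "\<Sum>i\<le>degree P. monom (L (coeff P i)) i"])
      (simp add: poly_sum poly_monom)
qed

lemma poly_family_functional:
  fixes \<phi> :: "('n::{finite, linorder}, 'k::field) symh \<Rightarrow> 'k"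
  assumes \<phi>: "\<And>a b. \<phi> (a + b) = \<phi> a + \<phi> b" "\<And>r a. \<phi> (symh_const r * a) = r * \<phi> a"
    and g: "poly_family g"
  shows "\<exists>q. \<forall>c. \<phi> (g c) = poly q c"
proof -
  have \<phi>0: "\<phi> 0 = 0" using \<phi>(2)[of 0 0] by simp
  have \<phi>sum: "\<phi> (sum f S) = (\<Sum>s\<in>S. \<phi> (f s))" for f and S :: "nat set"
    by (induction S rule: infinite_finite_induct) (simp_all add: \<phi>0 \<phi>)
  from g obtain P where P: "\<And>c. g c = poly P (symh_const c)" by (auto simp: poly_family_def)
  have "\<phi> (g c) = (\<Sum>i\<le>degree P. \<phi> (coeff P i) * c ^ i)" for c
    unfolding P poly_altdef \<phi>sum
    using \<phi>(2) by (intro sum.cong) (simp_all add: mult.commute[of "coeff P _"] mult.commute[of "\<phi> _"]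
        flip: symh_const_power)
  then show ?thesis
    by (intro exI[of _ "\<Sum>i\<le>degree P. monom (\<phi> (coeff P i)) i"])
      (simp add: poly_sum poly_monom)
qed

lemma poly_family_dunkl:
  fixes g :: "'k::field \<Rightarrow> ('n::{finite, linorder}, 'k) symh"
  assumes u: "sum u UNIV = 0" and g: "poly_family g"
  shows "poly_family (\<lambda>c. dunkl c u (g c))"
proof -
  have "poly_family (\<lambda>c. symh_const c * symh_const (u (fst x) - u (snd x)) * ddiff (fst x) (snd x) (g c))"
    if "x \<in> {(m, l). m < l}" for x :: "'n \<times> 'n"
  proof -
    have "fst x \<noteq> snd x" using that by auto
    then show ?thesis
      by (intro poly_family_mult poly_family_param poly_family_const poly_family_linear[OF _ _ g])
        (simp_all add: ddiff_add ddiff_mult)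
  qed
  then have "poly_family (\<lambda>c. dir_deriv u (g c) - (\<Sum>x\<in>{(m, l). m < l}.
      symh_const c * symh_const (u (fst x) - u (snd x)) * ddiff (fst x) (snd x) (g c)))"
    by (intro poly_family_diff poly_family_sum poly_family_linear[OF _ _ g])
      (simp_all add: dir_deriv_add dir_deriv_mult u)
  then show ?thesis
    by (simp add: dunkl_def case_prod_unfold symh_scale_def symh_const_hom)
qed

lemma geom_series_nth: "geom_series j $ k = symh_var j ^ k"
proof -
  have "lin_factor j * Abs_fps (\<lambda>k. symh_var j ^ k) = (1 :: ('a, 'b) symh fps)"
  proof (rule fps_ext)
    fix k
    show "(lin_factor j * Abs_fps (\<lambda>k. symh_var j ^ k)) $ k = (1 :: ('a, 'b) symh fps) $ k"
      by (cases k) (simp_all add: lin_factor_def left_diff_distrib mult.assoc)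
  qed
  from geom_series_unique[OF this] show ?thesis by (metis fps_nth_Abs_fps)
qed

text \<open>The parameter enters \<open>f\<^sub>i\<close> only through the binomial coefficients.\<close>

lemma f_poly_expand:
  "f_poly p c i = (\<Sum>m<p. symh_const (binom c m) *
    (geom_series i * ((\<Prod>j\<in>UNIV. lin_factor j) - 1) ^ m) $ p)"
  by (simp add: f_poly_def F_series_eq trunc_power_def sum_distrib_left fps_sum_nth
      mult.left_commute[of "geom_series i"])

lemma poly_family_f_poly:
  "poly_family (\<lambda>c::'k::field. f_poly p c i :: ('n::{finite, linorder}, 'k) symh)"
proof -
  have "symh_const (binom c m) = symh_const (inverse (of_nat (fact m))) *
      (\<Prod>i<m. symh_const c - symh_const (of_nat i) :: ('n, 'k) symh)" for c :: 'k and m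
  proof -
    have prod: "symh_const (prod h S) = (\<Prod>s\<in>S. symh_const (h s) :: ('n, 'k) symh)" for h and S :: "nat set"
      by (induction S rule: infinite_finite_induct) (simp_all add: symh_const_hom)
    have "binom c m = inverse (of_nat (fact m)) * (\<Prod>i<m. c - of_nat i)"
      by (simp add: binom_def divide_inverse mult.commute)
    then show ?thesis by (simp only: symh_const_hom prod)
  qed
  then show ?thesis
    unfolding f_poly_expand
    by (auto intro!: poly_family_sum poly_family_mult poly_family_prod poly_family_diff
        poly_family_const poly_family_param)
qed

text \<open>At \<open>c = 0\<close> only the summand \<open>m = 0\<close> survives and \<open>F\<^sub>i = 1/(1 - x\<^sub>i z)\<close>.\<close>

lemma f_poly_0:
  assumes "p > 0"
  shows "f_poly p (0 :: 'k::field) i = (symh_var i ^ p :: ('n::{finite, linorder}, 'k) symh)"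
proof -
  have "binom (0 :: 'k) m = of_bool (m = 0)" for m
  proof (cases m)
    case (Suc k)
    then have "(\<Prod>i<m. 0 - of_nat i :: 'k) = 0"
      by (intro prod_zero bexI[of _ 0]) auto
    then show ?thesis using Suc by (simp add: binom_def)
  qed (simp add: binom_def)
  then have "f_poly p (0 :: 'k) i = (\<Sum>m<p. if m = 0 then (geom_series i :: ('n, 'k) symh fps) $ p else 0)"
    unfolding f_poly_expand by (intro sum.cong) (auto simp: symh_const_hom)
  then show ?thesis using assms by (simp add: geom_series_nth)
qed

definition graded_fps :: "('n::{finite, linorder}, 'k::field) symh fps \<Rightarrow> bool" where
  "graded_fps F \<longleftrightarrow> (\<forall>k. F $ k \<in> symh_degree k)"

lemma graded_fps_mult:
  assumes "graded_fps F" "graded_fps G"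
  shows "graded_fps (F * G)"
  unfolding graded_fps_def fps_mult_nth
proof (intro allI symh_degree_sum)
  fix k i :: nat assume "i \<in> {0..k}"
  then have "i + (k - i) = k" by simp
  then show "F $ i * G $ (k - i) \<in> symh_degree k"
    using assms symh_degree_mult[of "F $ i" i "G $ (k - i)" "k - i"] by (simp add: graded_fps_def)
qed

lemma graded_fps_1: "graded_fps 1"
  by (auto simp: graded_fps_def symh_degree_1 symh_degree_0 fps_one_nth)

lemma graded_fps_lin_factor: "graded_fps (lin_factor j)"
  unfolding graded_fps_def
proof
  fix k :: nat
  have *: "lin_factor j $ k = (if k = 0 then 1 else if k = Suc 0 then 0 - symh_var j else 0)"
    by (auto simp: lin_factor_def)
  show "lin_factor j $ k \<in> symh_degree k"
    unfolding * using symh_degree_diff[OF symh_degree_0 symh_degree_var[of j]]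
    by (auto intro: symh_degree_1 symh_degree_0)
qed

lemma graded_fps_geom_series: "graded_fps (geom_series j)"
  unfolding graded_fps_def geom_series_nth
proof
  fix k :: nat
  show "symh_var j ^ k \<in> symh_degree k"
    using symh_degree_mult[OF symh_degree_var] by (induction k) (auto intro: symh_degree_1)
qed

lemma graded_fps_prod: "(\<And>s. s \<in> S \<Longrightarrow> graded_fps (g s)) \<Longrightarrow> graded_fps (prod g S)"
  by (induction S rule: infinite_finite_induct) (auto intro: graded_fps_1 graded_fps_mult)

lemma graded_fps_diff: "graded_fps F \<Longrightarrow> graded_fps G \<Longrightarrow> graded_fps (F - G)"
  by (simp add: graded_fps_def symh_degree_diff)

lemma graded_fps_power: "graded_fps g \<Longrightarrow> graded_fps (g ^ k)"
  by (induction k) (auto intro: graded_fps_1 graded_fps_mult)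

lemma f_poly_degree: "f_poly p c i \<in> symh_degree p"
proof -
  have "graded_fps ((\<Prod>j\<in>UNIV. lin_factor j) - (1 :: ('a, 'b) symh fps))"
    by (intro graded_fps_diff graded_fps_prod graded_fps_1 graded_fps_lin_factor)
  then have "graded_fps (geom_series i * ((\<Prod>j\<in>UNIV. lin_factor j) - (1 :: ('a, 'b) symh fps)) ^ m)" for m
    by (intro graded_fps_mult graded_fps_geom_series graded_fps_power)
  then have "symh_const (binom c m) *
      (geom_series i * ((\<Prod>j\<in>UNIV. lin_factor j) - (1 :: ('a, 'b) symh fps)) ^ m) $ p \<in> symh_degree (0 + p)" for m
    by (intro symh_degree_mult symh_degree_const) (auto simp: graded_fps_def)
  then show ?thesis
    unfolding f_poly_expand by (intro symh_degree_sum) simp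
qed

section \<open>The ideal of singular vectors\<close>

lemma genideal_type_algebra_image:
  fixes f :: "'s \<Rightarrow> 'a::comm_ring_1"
  assumes "finite S"
  shows "Idl\<^bsub>ring_of_type_algebra\<^esub> (f ` S) = {\<Sum>i\<in>S. g i * f i | g. True}" (is "?L = ?R")
proof
  have mem: "(\<Sum>i\<in>S. g i * f i) \<in> ?R" for g by blast
  have "ideal ?R ring_of_type_algebra"
    unfolding ideal_of_type_algebra_iff
  proof (intro conjI ballI allI)
    show "0 \<in> ?R" using mem[of "\<lambda>_. 0"] by simp
  next
    fix x y assume "x \<in> ?R" "y \<in> ?R"
    then obtain g h where "x = (\<Sum>i\<in>S. g i * f i)" "y = (\<Sum>i\<in>S. h i * f i)" by auto
    then have "x + y = (\<Sum>i\<in>S. (g i + h i) * f i)"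
      by (simp add: distrib_right sum.distrib)
    then show "x + y \<in> ?R" using mem[of "\<lambda>i. g i + h i"] by (simp only:)
  next
    fix x r assume "x \<in> ?R"
    then obtain g where "x = (\<Sum>i\<in>S. g i * f i)" by auto
    then have "r * x = (\<Sum>i\<in>S. (r * g i) * f i)"
      by (simp add: sum_distrib_left mult_ac)
    then show "r * x \<in> ?R" using mem[of "\<lambda>i. r * g i"] by (simp only:)
    then show "x * r \<in> ?R" by (subst mult.commute)
  qed
  moreover have "f ` S \<subseteq> ?R"
  proof
    fix x assume "x \<in> f ` S"
    then obtain s where s: "s \<in> S" "x = f s" by auto
    have "(\<Sum>i\<in>S. of_bool (i = s) * f i) = (\<Sum>i\<in>S. if i = s then f i else 0)"
      by (intro sum.cong) auto
    then have "x = (\<Sum>i\<in>S. of_bool (i = s) * f i)"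
      using s assms by simp
    then show "x \<in> ?R" using mem[of "\<lambda>i. of_bool (i = s)"] by (simp only:)
  qed
  ultimately show "?L \<subseteq> ?R" unfolding genideal_def by blast
next
  show "?R \<subseteq> ?L"
  proof (clarsimp simp: genideal_def)
    fix g I assume I: "ideal I ring_of_type_algebra" "f ` S \<subseteq> I"
    have "(\<Sum>i\<in>T. g i * f i) \<in> I" if "T \<subseteq> S" for T
      using that I by (induction T rule: infinite_finite_induct) (auto simp: ideal_of_type_algebra_iff)
    then show "(\<Sum>i\<in>S. g i * f i) \<in> I" by simp
  qed
qed

definition f_ideal :: "nat \<Rightarrow> 'k \<Rightarrow> ('n::{finite, linorder}, 'k::field) symh set" where
  "f_ideal p c = Idl\<^bsub>ring_of_type_algebra\<^esub> (f_poly p c ` initial_indices)"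

lemma f_ideal_eq: "f_ideal p c = {\<Sum>i\<in>initial_indices. g i * f_poly p c i | g. True}"
  unfolding f_ideal_def by (rule genideal_type_algebra_image) simp

lemma f_ideal_ideal: "ideal (f_ideal p c) ring_of_type_algebra"
proof -
  interpret ring "ring_of_type_algebra :: ('a, 'b) symh ring" by (rule ring_ring_of_type_algebra)
  show ?thesis unfolding f_ideal_def by (rule genideal_ideal) simp
qed

lemma f_ideal_closed:
  "0 \<in> f_ideal p c" "a \<in> f_ideal p c \<Longrightarrow> b \<in> f_ideal p c \<Longrightarrow> a + b \<in> f_ideal p c"
  "a \<in> f_ideal p c \<Longrightarrow> r * a \<in> f_ideal p c"
  using f_ideal_ideal[of p c] unfolding ideal_of_type_algebra_iff by blast+

lemma f_ideal_diff: "a \<in> f_ideal p c \<Longrightarrow> b \<in> f_ideal p c \<Longrightarrow> a - b \<in> f_ideal p c"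
  using f_ideal_closed(2)[of a p c "- 1 * b"] f_ideal_closed(3)[of b p c "- 1"] by simp

lemma f_ideal_sum:
  "(\<And>s. s \<in> S \<Longrightarrow> f s \<in> f_ideal p c) \<Longrightarrow> sum f S \<in> f_ideal p c"
  by (induction S rule: infinite_finite_induct) (auto intro: f_ideal_closed)

lemma f_poly_in_f_ideal: "i \<in> initial_indices \<Longrightarrow> f_poly p c i \<in> f_ideal p c"
  unfolding f_ideal_def genideal_def by blast

lemma augmentation_f_ideal:
  assumes "p > 0" "a \<in> f_ideal p c"
  shows "augmentation a = 0"
proof -
  obtain g where "a = (\<Sum>i\<in>initial_indices. g i * f_poly p c i)"
    using assms(2) by (auto simp: f_ideal_eq)
  moreover have "augmentation (f_poly p c i :: ('a, 'b) symh) = 0" for i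
    by (rule augmentation_degree[OF f_poly_degree assms(1)])
  ultimately show ?thesis by (simp add: augmentation_sum augmentation_hom)
qed

subsection \<open>The ideal is a graded submodule\<close>

text \<open>The generators leave out the last index; since \<open>c \<Sum>\<^sub>i f\<^sub>i = 0\<close>, the last \<open>f\<^sub>i\<close> is a combination
  of them once \<open>c \<noteq> 0\<close>. This makes the ideal stable under all permutations.\<close>

lemma all_f_poly_in_f_ideal:
  fixes c :: "'k::field" and i :: "'n::{finite, linorder}"
  assumes p: "CHAR('k) = p" "prime p" "p dvd CARD('n)" and c: "c \<noteq> 0"
  shows "f_poly p c i \<in> f_ideal p c"
proof (cases "i \<in> initial_indices")
  case True
  then show ?thesis by (rule f_poly_in_f_ideal)
next
  case False
  then have i: "i = Max UNIV" by (simp add: initial_indices_eq)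
  have "(\<Sum>i\<in>UNIV. f_poly p c i :: ('n, 'k) symh) =
      symh_const (inverse c) * (symh_const c * (\<Sum>i\<in>UNIV. f_poly p c i))"
    using c by (simp flip: mult.assoc symh_scale_simps(2)) (simp add: symh_scale_simps)
  also have "\<dots> = 0" by (simp add: sum_f_poly p)
  finally have "f_poly p c (Max UNIV) + (\<Sum>i\<in>initial_indices. f_poly p c i :: ('n, 'k) symh) = 0"
    unfolding initial_indices_eq by (subst (asm) sum.remove[of _ "Max UNIV"]) auto
  then have "f_poly p c i = 0 - (\<Sum>i\<in>initial_indices. f_poly p c i :: ('n, 'k) symh)"
    by (simp add: i eq_neg_iff_add_eq_0)
  then show ?thesis
    by (simp only:) (intro f_ideal_diff f_ideal_closed(1) f_ideal_sum f_poly_in_f_ideal)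
qed

text \<open>In the product rule for \<open>D\<^sub>y (g f\<^sub>i)\<close> the only term in which \<open>f\<^sub>i\<close> is not just permuted is
  \<open>g D\<^sub>y f\<^sub>i = 0\<close>.\<close>

lemma cherednik_submodule_f_ideal:
  fixes c :: "'k::field"
  assumes p: "CHAR('k) = p" "prime p" "p dvd CARD('n::{finite, linorder})" and c: "c \<noteq> 0"
  shows "cherednik_submodule c (f_ideal p c :: ('n, 'k) symh set)"
proof (rule cherednik_submoduleI)
  let ?I = "f_ideal p c :: ('n, 'k) symh set"
  note f = all_f_poly_in_f_ideal[OF p c]
  fix a assume "a \<in> ?I"
  then obtain g where g: "a = (\<Sum>i\<in>initial_indices. g i * f_poly p c i)"
    by (auto simp: f_ideal_eq)
  show "symh_perm \<sigma> a \<in> ?I" for \<sigma>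
    unfolding g symh_perm_sum symh_perm_mult symh_perm_f_poly
    by (intro f_ideal_sum f_ideal_closed(3) f)
  show "dunkl c (y_diff j k) a \<in> ?I" for j k
    unfolding g dunkl_sum[OF sum_y_diff]
  proof (rule f_ideal_sum)
    fix i :: 'n
    let ?u = "y_diff j k :: 'n \<Rightarrow> 'k"
    have "(\<Sum>(m, l) | m < l. symh_scale (c * (?u m - ?u l))
        (ddiff m l (g i) * symh_perm \<langle>m \<leftrightarrow> l\<rangle> (f_poly p c i))) \<in> ?I"
      unfolding case_prod_unfold symh_scale_def symh_perm_f_poly
      by (intro f_ideal_sum f_ideal_closed(3) f)
    moreover have "dir_deriv ?u (g i) * f_poly p c i \<in> ?I"
      by (intro f_ideal_closed(3) f)
    ultimately show "dunkl c ?u (g i * f_poly p c i) \<in> ?I"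
      unfolding dunkl_mult[OF sum_y_diff] dunkl_f_poly[OF p sum_y_diff]
      by (simp add: f_ideal_diff)
  qed
qed (auto intro: f_ideal_closed)

text \<open>A sum of homogeneous elements of \<open>M\<close>, in any order and with repeated degrees, is regrouped
  into the form that \<open>graded_subset\<close> asks for.\<close>

lemma graded_sum_decomposition:
  assumes "0 \<in> M" "\<And>a b. a \<in> M \<Longrightarrow> b \<in> M \<Longrightarrow> a + b \<in> M"
    and "finite S" "\<And>s. s \<in> S \<Longrightarrow> \<exists>d. h s \<in> M \<inter> symh_degree d"
  shows "\<exists>N b. (\<forall>j<N. b j \<in> M \<inter> symh_degree j) \<and> sum h S = (\<Sum>j<N. b j)"
proof -
  from assms(4) obtain d where d: "\<And>s. s \<in> S \<Longrightarrow> h s \<in> M \<inter> symh_degree (d s)" by metis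
  (* any number above all degrees will do *)
  define N where "N = Suc (\<Sum>s\<in>S. d s)"
  have dN: "d s < N" if "s \<in> S" for s
    using member_le_sum[of s S d] that assms(3) by (simp add: N_def)
  have M_sum: "sum f T \<in> M" if "\<And>s. s \<in> T \<Longrightarrow> f s \<in> M" for f and T :: "'c set"
    using that assms(1,2) by (induction T rule: infinite_finite_induct) auto
  show ?thesis
  proof (intro exI conjI allI impI)
    show "(\<Sum>s | s \<in> S \<and> d s = j. h s) \<in> M \<inter> symh_degree j" for j
      using d by (auto intro!: M_sum symh_degree_sum)
    show "sum h S = (\<Sum>j<N. \<Sum>s | s \<in> S \<and> d s = j. h s)"
      using sum.group[of S "{..<N}" d h] assms(3) dN by (simp add: image_subset_iff)
  qed
qed

lemma graded_f_ideal: "graded_subset (f_ideal p c :: ('n::{finite, linorder}, 'k::field) symh set)"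
  unfolding graded_subset_def
proof
  let ?I = "f_ideal p c :: ('n, 'k) symh set"
  fix a assume "a \<in> ?I"
  then obtain g where g: "a = (\<Sum>i\<in>initial_indices. g i * f_poly p c i)"
    by (auto simp: f_ideal_eq)
  have "\<forall>i. \<exists>x. finite (fst x) \<and> g i = lincomb (fst x) (snd x)"
  proof
    fix i
    obtain S \<alpha> where "finite S" "g i = lincomb S \<alpha>"
      using symh_mono_span[of "g i"] by blast
    then show "\<exists>x. finite (fst x) \<and> g i = lincomb (fst x) (snd x)"
      by (intro exI[of _ "(S, \<alpha>)"]) simp
  qed
  from choice[OF this] obtain x where x: "\<And>i. finite (fst (x i))"
    "\<And>i. g i = (\<Sum>b\<in>fst (x i). symh_const (snd (x i) b) * symh_mono b)" by blast
  define S \<alpha> where "S i = fst (x i)" and "\<alpha> i = snd (x i)" for i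
  have S: "\<And>i. finite (S i)" "\<And>i. g i = lincomb (S i) (\<alpha> i)"
    using x by (simp_all add: S_def \<alpha>_def)
  let ?h = "\<lambda>(i, b). symh_const (\<alpha> i b) * symh_mono b * f_poly p c i"
  have "a = sum ?h (Sigma initial_indices S)"
    unfolding g S(2) sum_distrib_right by (rule sum.Sigma) (auto simp: S(1))
  moreover have "\<exists>N b. (\<forall>j<N. b j \<in> ?I \<inter> symh_degree j) \<and> sum ?h (Sigma initial_indices S) = (\<Sum>j<N. b j)"
  proof (rule graded_sum_decomposition)
    fix x assume "x \<in> Sigma initial_indices S"
    then obtain i b where x: "x = (i, b)" "i \<in> initial_indices" by auto
    have "?h x \<in> ?I" using x by (simp add: f_ideal_closed(3) f_poly_in_f_ideal)
    moreover have "?h x \<in> symh_degree (0 + mdeg b + p)"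
      using symh_degree_mult[OF symh_degree_mult[OF symh_degree_const[of "\<alpha> i b"]
          symh_degree_mono[of b]] f_poly_degree[of p c i]]
      by (simp only: x(1) prod.case)
    ultimately show "\<exists>d. ?h x \<in> ?I \<inter> symh_degree d" by blast
  qed (auto simp: f_ideal_closed S(1))
  ultimately show "\<exists>N b. (\<forall>j<N. b j \<in> ?I \<inter> symh_degree j) \<and> a = (\<Sum>j<N. b j)" by simp
qed

lemma proper_graded_f_ideal:
  fixes c :: "'k::field"
  assumes p: "CHAR('k) = p" "prime p" "p dvd CARD('n::{finite, linorder})" and c: "c \<noteq> 0"
  shows "proper_graded_submodule c (f_ideal p c :: ('n, 'k) symh set)"
proof -
  have "1 \<notin> (f_ideal p c :: ('n, 'k) symh set)"
    using augmentation_f_ideal[of p "1 :: ('n, 'k) symh" c] prime_gt_0_nat[OF p(2)]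
    by (auto simp: augmentation_1)
  then show ?thesis
    using cherednik_submodule_f_ideal[OF assms] graded_f_ideal
    by (auto simp: proper_graded_submodule_def)
qed

subsection \<open>Reduced monomials span the quotient\<close>

lemma f_ideal_span_combination:
  fixes x :: "('n::{finite, linorder}, 'k::field) symh"
  assumes mono: "\<And>b. b \<in> S \<Longrightarrow>
      \<exists>\<alpha>. symh_mono b - lincomb E \<alpha> \<in> f_ideal p c"
    and x: "x = lincomb S \<beta>"
  shows "\<exists>\<alpha>. x - lincomb E \<alpha> \<in> f_ideal p c"
proof -
  have "\<forall>b. \<exists>\<alpha>. b \<in> S \<longrightarrow> symh_mono b - lincomb E \<alpha> \<in> f_ideal p c"
  proof
    fix b
    show "\<exists>\<alpha>. b \<in> S \<longrightarrow> symh_mono b - lincomb E \<alpha> \<in> f_ideal p c"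
      using mono[of b] by (cases "b \<in> S") simp_all
  qed
  from choice[OF this] obtain A where A: "\<And>b. b \<in> S \<Longrightarrow>
      symh_mono b - lincomb E (A b) \<in> f_ideal p c" by blast
  have "(\<Sum>b\<in>S. symh_const (\<beta> b) * lincomb E (A b)) =
      (\<Sum>b\<in>S. \<Sum>a\<in>E. symh_const (\<beta> b * A b a) * symh_mono a :: ('n, 'k) symh)"
    by (simp add: sum_distrib_left symh_scale_simps(2) mult.assoc)
  also have "\<dots> = (\<Sum>a\<in>E. \<Sum>b\<in>S. symh_const (\<beta> b * A b a) * symh_mono a)"
    by (rule sum.swap)
  also have "\<dots> = lincomb E (\<lambda>a. \<Sum>b\<in>S. \<beta> b * A b a)"
    by (simp add: symh_const_sum sum_distrib_right)
  finally have swap: "(\<Sum>b\<in>S. symh_const (\<beta> b) * lincomb E (A b)) =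
      (lincomb E (\<lambda>a. \<Sum>b\<in>S. \<beta> b * A b a) :: ('n, 'k) symh)" .
  have "(\<Sum>b\<in>S. symh_const (\<beta> b) * (symh_mono b -
      (lincomb E (A b)))) \<in> f_ideal p c"
    by (intro f_ideal_sum f_ideal_closed(3) A)
  then have "x - lincomb E (\<lambda>a. \<Sum>b\<in>S. \<beta> b * A b a) \<in> f_ideal p c"
    by (simp only: x right_diff_distrib sum_subtractf swap)
  then show ?thesis by (intro exI[of _ "\<lambda>a. \<Sum>b\<in>S. \<beta> b * A b a"])
qed

text \<open>The exponents of the basis of \<open>k[x\<^sub>1, \<dots>, x\<^sub>n\<^sub>-\<^sub>1]/(x\<^sub>1\<^sup>p, \<dots>, x\<^sub>n\<^sub>-\<^sub>1\<^sup>p)\<close>.\<close>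

definition reduced :: "nat \<Rightarrow> ('n::{finite, linorder} \<Rightarrow>\<^sub>0 nat) set" where
  "reduced p = {b. keys b \<subseteq> initial_indices \<and> (\<forall>i. lookup b i < p)}"

lemma finite_reduced: "finite (reduced p)"
  by (rule finite_subset[OF _ finite_bounded_exponents[of p]])
    (auto simp: reduced_def less_imp_le)

lemma reduced_mdeg:
  fixes b :: "'n::{finite, linorder} \<Rightarrow>\<^sub>0 nat"
  assumes "b \<in> reduced p"
  shows "mdeg b \<le> card (initial_indices :: 'n set) * (p - 1)"
proof -
  have "mdeg b = (\<Sum>i\<in>initial_indices. lookup b i)"
    unfolding mdeg_def
    by (rule sum.mono_neutral_right) (use assms in \<open>auto simp: reduced_def in_keys_iff\<close>)
  also have "\<dots> \<le> (\<Sum>i\<in>(initial_indices :: 'n set). p - 1)"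
  proof (rule sum_mono)
    fix i
    have "lookup b i < p" using assms by (simp add: reduced_def)
    then show "lookup b i \<le> p - 1" by simp
  qed
  finally show ?thesis by simp
qed

lemma not_reduced_split:
  assumes "b \<in> exponents d" "b \<notin> reduced p" "p > 0"
  shows "\<exists>i b'. i \<in> initial_indices \<and> keys b' \<subseteq> initial_indices \<and> p + mdeg b' = d \<and>
    b = single i p + b'"
proof -
  from assms obtain i where i: "p \<le> lookup b i"
    by (auto simp: exponents_def reduced_def not_less)
  define b' where "b' = b - single i p"
  have b: "b = single i p + b'"
    unfolding b'_def
    by (rule poly_mapping_eqI) (use i in \<open>auto simp: lookup_add lookup_minus lookup_single when_def\<close>)
  have "i \<in> keys b" using i assms(3) by (auto simp: in_keys_iff)
  moreover have "keys b' \<subseteq> keys b"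
    by (auto simp: b in_keys_iff lookup_add)
  moreover have "mdeg b = p + mdeg b'"
    by (subst b) (simp add: mdeg_add mdeg_single)
  ultimately show ?thesis using assms b by (auto simp: exponents_def)
qed

text \<open>Replace every monomial of degree \<open>d\<close> that is not reduced, say \<open>x\<^sub>i\<^sup>p x\<^sup>b\<close>, by \<open>f\<^sub>i x\<^sup>b\<close>. At \<open>c = 0\<close>
  this changes nothing, so the new family is a basis of the graded piece for generic \<open>c\<close>; and its
  new members lie in the ideal.\<close>

lemma generic_span_degree:
  assumes "p > 0"
  shows "\<exists>C :: 'k::field set. finite C \<and> (\<forall>c. c \<notin> C \<longrightarrow>
    (\<forall>b\<in>exponents d :: ('n::{finite, linorder} \<Rightarrow>\<^sub>0 nat) set. \<exists>\<alpha>.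
      symh_mono b - lincomb (exponents d \<inter> reduced p) \<alpha> \<in> f_ideal p c))"
proof -
  let ?S = "exponents d :: ('n \<Rightarrow>\<^sub>0 nat) set"
  have "\<forall>a. \<exists>x. a \<in> ?S - reduced p \<longrightarrow> fst x \<in> initial_indices \<and>
      keys (snd x) \<subseteq> initial_indices \<and> p + mdeg (snd x) = d \<and>
      a = single (fst x) p + snd x"
    using not_reduced_split[OF _ _ assms] by fastforce
  then obtain x where x: "\<And>a. a \<in> ?S - reduced p \<Longrightarrow> fst (x a) \<in> initial_indices"
    "\<And>a. a \<in> ?S - reduced p \<Longrightarrow> p + mdeg (snd (x a)) = d"
    "\<And>a. a \<in> ?S - reduced p \<Longrightarrow> a = single (fst (x a)) p + snd (x a)" by metis
  (* x splits a nonreduced exponent as p times a unit vector plus a remainder *)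
  define v :: "'k \<Rightarrow> ('n \<Rightarrow>\<^sub>0 nat) \<Rightarrow> ('n, 'k) symh" where
    "v c a = (if a \<in> reduced p then symh_mono a else f_poly p c (fst (x a)) * symh_mono (snd (x a)))" for c a
  have v_degree: "v c a \<in> symh_degree d" if "a \<in> ?S" for c a
  proof (cases "a \<in> reduced p")
    case True
    then show ?thesis using that symh_degree_mono[of a] by (simp add: v_def exponents_def)
  next
    case False
    then show ?thesis
      using that symh_degree_mult[OF f_poly_degree[of p c "fst (x a)"] symh_degree_mono[of "snd (x a)"]] x(2)[of a]
      by (simp add: v_def)
  qed
  have v_0: "v 0 a = symh_mono a" if "a \<in> ?S" for a
  proof (cases "a \<in> reduced p")
    case False
    then have "symh_mono a = (symh_mono (single (fst (x a)) p + snd (x a)) :: ('n, 'k) symh)"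
      using that x(3)[of a] by simp
    then show ?thesis
      using False assms by (simp add: v_def f_poly_0 symh_mono_add symh_mono_single)
  qed (simp add: v_def)
  have "\<exists>C. finite C \<and> (\<forall>c. c \<notin> C \<longrightarrow> (\<forall>\<beta>. \<exists>\<alpha>. \<forall>b\<in>?S. (\<Sum>a\<in>?S. \<alpha> a * symh_coeff (v c a) b) = \<beta> b))"
  proof (rule generic_solvable[OF finite_exponents])
    fix a b
    have "poly_family (\<lambda>c. v c a)"
      unfolding v_def
      by (cases "a \<in> reduced p")
        (simp_all add: poly_family_const poly_family_mult poly_family_f_poly)
    then show "\<exists>q. \<forall>c. symh_coeff (v c a) b = poly q c"
      by (intro poly_family_functional[of "\<lambda>a. symh_coeff a b"])
        (simp_all add: symh_coeff_add symh_coeff_scale)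
  qed (auto simp: v_0 symh_coeff_mono exponents_def)
  then obtain C where C: "finite C" "\<And>c \<beta>. c \<notin> C \<Longrightarrow>
    \<exists>\<alpha>. \<forall>b\<in>?S. (\<Sum>a\<in>?S. \<alpha> a * symh_coeff (v c a) b) = \<beta> b" by blast
  show ?thesis
  proof (intro exI[of _ C] conjI allI impI ballI C(1))
    fix c b assume c: "c \<notin> C" and b: "b \<in> ?S"
    then obtain \<alpha> where \<alpha>: "\<And>b'. b' \<in> ?S \<Longrightarrow> (\<Sum>a\<in>?S. \<alpha> a * symh_coeff (v c a) b') = of_bool (b = b')"
      using C(2)[of c "\<lambda>b'. of_bool (b = b')"] by blast
    define w where "w = (\<Sum>a\<in>?S. symh_const (\<alpha> a) * v c a)"
    have "w \<in> symh_degree d"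
      unfolding w_def using symh_degree_mult[OF symh_degree_const v_degree]
      by (intro symh_degree_sum) simp
    then have "w = (\<Sum>b'\<in>?S. symh_const (symh_coeff w b') * symh_mono b')"
      by (rule symh_expand_degree)
    also have "\<dots> = (\<Sum>b'\<in>?S. if b' = b then symh_mono b' else 0)"
      by (intro sum.cong)
        (auto simp: w_def symh_coeff_sum symh_coeff_scale \<alpha> symh_const_hom)
    also have "\<dots> = symh_mono b" using b by (simp add: finite_exponents)
    also have "w = (\<Sum>a\<in>?S \<inter> reduced p. symh_const (\<alpha> a) * v c a) +
        (\<Sum>a\<in>?S - reduced p. symh_const (\<alpha> a) * v c a)"
      unfolding w_def by (rule sum.Int_Diff[OF finite_exponents])
    finally have "symh_mono b - (\<Sum>a\<in>?S \<inter> reduced p. symh_const (\<alpha> a) * v c a) =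
        (\<Sum>a\<in>?S - reduced p. symh_const (\<alpha> a) * v c a)" by (simp add: diff_eq_eq add.commute)
    also have "(\<Sum>a\<in>?S \<inter> reduced p. symh_const (\<alpha> a) * v c a) =
        (lincomb (?S \<inter> reduced p) \<alpha>)"
      by (intro sum.cong) (auto simp: v_def)
    also have "(\<Sum>a\<in>?S - reduced p. symh_const (\<alpha> a) * v c a) \<in> f_ideal p c"
    proof (intro f_ideal_sum f_ideal_closed(3))
      fix a assume a: "a \<in> ?S - reduced p"
      then have "v c a = symh_mono (snd (x a)) * f_poly p c (fst (x a))"
        by (simp add: v_def mult.commute)
      then show "v c a \<in> f_ideal p c"
        by (simp add: f_ideal_closed(3) f_poly_in_f_ideal x(1)[OF a])
    qed
    finally show "\<exists>\<alpha>. symh_mono b - lincomb (?S \<inter> reduced p) \<alpha> \<in> f_ideal p c"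
      by blast
  qed
qed

text \<open>A union over all degrees of finite exceptional sets need not be finite. Beyond degree
  \<open>(n - 1)(p - 1)\<close> there are no reduced monomials, so in the first such degree \<open>D\<close> the ideal
  contains all monomials, hence it contains those of larger degree as well; the degrees up to \<open>D\<close>
  suffice.\<close>

lemma generic_span:
  assumes "p > 0"
  shows "\<exists>C :: 'k::field set. finite C \<and> (\<forall>c. c \<notin> C \<longrightarrow>
    (\<forall>b :: 'n::{finite, linorder} \<Rightarrow>\<^sub>0 nat. keys b \<subseteq> initial_indices \<longrightarrow> (\<exists>\<alpha>.
      symh_mono b - lincomb (exponents (mdeg b) \<inter> reduced p) \<alpha>
        \<in> f_ideal p c)))"
proof -
  define D where "D = Suc (card (initial_indices :: 'n set) * (p - 1))"
  have red: "exponents d \<inter> reduced p = ({} :: ('n \<Rightarrow>\<^sub>0 nat) set)" if "D \<le> d" for d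
    using reduced_mdeg[of _ p] that by (fastforce simp: exponents_def D_def)
  obtain C where C: "\<And>d. finite (C d)" "\<And>c d b. c \<notin> C d \<Longrightarrow> b \<in> (exponents d :: ('n \<Rightarrow>\<^sub>0 nat) set) \<Longrightarrow>
      \<exists>\<alpha>. symh_mono b - lincomb (exponents d \<inter> reduced p) \<alpha> \<in> f_ideal p (c :: 'k)"
    using generic_span_degree[OF assms, where ?'k = 'k and ?'n = 'n] by metis
  show ?thesis
  proof (intro exI[of _ "\<Union>d\<le>D. C d"] conjI allI impI)
    show "finite (\<Union>d\<le>D. C d)" using C(1) by blast
    fix c and b :: "'n \<Rightarrow>\<^sub>0 nat"
    assume c: "c \<notin> (\<Union>d\<le>D. C d)" and b: "keys b \<subseteq> initial_indices"
    have high: "symh_mono b \<in> f_ideal p c" if "mdeg b = D + k" "keys b \<subseteq> initial_indices"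
      for k and b :: "'n \<Rightarrow>\<^sub>0 nat"
      using that
    proof (induction k arbitrary: b)
      case 0
      then have "b \<in> exponents D" by (simp add: exponents_def)
      moreover have "c \<notin> C D" using c by auto
      ultimately show ?case using C(2)[of c D b] red[of D] by simp
    next
      case (Suc k)
      then have "mdeg b \<noteq> 0" by simp
      then have "\<exists>i. lookup b i \<noteq> 0" by (auto simp: mdeg_def)
      then obtain i where i: "lookup b i \<noteq> 0" by blast
      define b' where "b' = b - single i 1"
      have bb: "b = single i 1 + b'"
        unfolding b'_def
        by (rule poly_mapping_eqI) (use i in \<open>auto simp: lookup_add lookup_minus lookup_single when_def\<close>)
      have "mdeg b = Suc (mdeg b')"
        by (subst bb) (simp add: mdeg_add mdeg_single)
      moreover have "keys b' \<subseteq> keys b"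
        by (auto simp: bb in_keys_iff lookup_add)
      ultimately have "symh_mono b' \<in> f_ideal p c"
        using Suc by (intro Suc.IH) auto
      then show ?case
        by (subst bb) (simp only: symh_mono_add f_ideal_closed(3))
    qed
    show "\<exists>\<alpha>. symh_mono b - lincomb (exponents (mdeg b) \<inter> reduced p) \<alpha>
        \<in> f_ideal p c"
    proof (cases "mdeg b \<le> D")
      case True
      then show ?thesis using C(2)[of c "mdeg b" b] c b by (auto simp: exponents_def)
    next
      case False
      then have "symh_mono b \<in> f_ideal p c"
        using high[of b "mdeg b - D"] b by simp
      then show ?thesis using red[of "mdeg b"] False by simp
    qed
  qed
qed

section \<open>The ideal is the maximal graded submodule\<close>

subsection \<open>The contravariant pairing\<close>

text \<open>The operator \<open>D\<^sup>b\<close>, the product of the powers \<open>D\<^sub>i\<^bsup>b i\<^esup>\<close> with \<open>D\<^sub>i\<close> the Dunkl operator for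
  \<open>y\<^sub>i - y\<^sub>n\<close>. On the polynomial ring in the initial variables, \<open>y\<^sub>i - y\<^sub>n\<close> is dual to \<open>x\<^sub>i\<close>.
  The list of indices fixes the order of the factors.\<close>

fun iter_dunkl ::
    "'k \<Rightarrow> 'n list \<Rightarrow> ('n \<Rightarrow>\<^sub>0 nat) \<Rightarrow> ('n::{finite, linorder}, 'k::field) symh \<Rightarrow> ('n, 'k) symh" where
  "iter_dunkl c [] b a = a"
| "iter_dunkl c (i # is) b a =
    iter_dunkl c is b ((dunkl c (y_diff i (Max UNIV)) ^^ lookup b i) a)"

lemma dunkl_funpow_add:
  fixes c :: "'k::field"
  assumes "sum u UNIV = (0 :: 'k)"
  shows "(dunkl c u ^^ k) (a + b) = (dunkl c u ^^ k) a + (dunkl c u ^^ k) b"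
  by (induction k) (simp_all add: dunkl_add assms)

lemma dunkl_funpow_scale:
  fixes c :: "'k::field"
  assumes "sum u UNIV = (0 :: 'k)"
  shows "(dunkl c u ^^ k) (symh_const r * a) = symh_const r * (dunkl c u ^^ k) a"
  using dunkl_scale[OF assms] by (induction k) (simp_all add: symh_scale_def)

lemma iter_dunkl_add: "iter_dunkl c is b (a + a') = iter_dunkl c is b a + iter_dunkl c is b a'"
  by (induction "is" arbitrary: a a') (simp_all add: dunkl_funpow_add sum_y_diff)

lemma iter_dunkl_scale: "iter_dunkl c is b (symh_const r * a) = symh_const r * iter_dunkl c is b a"
  by (induction "is" arbitrary: a) (simp_all add: dunkl_funpow_scale sum_y_diff)

lemma iter_dunkl_sum:
  fixes f :: "'s \<Rightarrow> ('n::{finite, linorder}, 'k::field) symh"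
  shows "iter_dunkl c is b (sum f S) = (\<Sum>s\<in>S. iter_dunkl c is b (f s))"
proof -
  have "iter_dunkl c is b (0 :: ('n, 'k) symh) = 0"
    using iter_dunkl_add[of c "is" b "0 :: ('n, 'k) symh" 0] by simp
  then show ?thesis
    by (induction S rule: infinite_finite_induct) (simp_all add: iter_dunkl_add)
qed

lemma iter_dunkl_submodule:
  assumes "cherednik_submodule c M" "a \<in> M"
  shows "iter_dunkl c is b a \<in> M"
  using assms(2)
proof (induction "is" arbitrary: a)
  case (Cons i "is")
  have "(dunkl c (y_diff i (Max UNIV)) ^^ k) a \<in> M" for k
    using Cons.prems by (induction k) (simp_all add: cherednik_submoduleD(2)[OF assms(1)])
  then show ?case using Cons.IH by simp
qed simp

lemma poly_family_iter_dunkl: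
  "poly_family g \<Longrightarrow> poly_family (\<lambda>c. iter_dunkl c is b (g c))"
proof (induction "is" arbitrary: g)
  case (Cons i "is")
  have "poly_family (\<lambda>c. (dunkl c (y_diff i (Max UNIV)) ^^ k) (g c))" for k
    using Cons.prems by (induction k) (simp_all add: poly_family_dunkl sum_y_diff)
  then show ?case using Cons.IH by simp
qed simp

lemma dunkl_param_0: "dunkl 0 u = dir_deriv u"
  by (rule ext) (simp add: dunkl_def case_prod_unfold)

lemma dir_deriv_funpow_mult:
  fixes u :: "'n::{finite, linorder} \<Rightarrow> 'k::field"
  assumes u: "sum u UNIV = 0" and r: "dir_deriv u r = 0"
  shows "(dir_deriv u ^^ k) (q * r) = (dir_deriv u ^^ k) q * r"
  by (induction k) (simp_all add: dir_deriv_mult u r)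

lemma dir_deriv_funpow_power:
  fixes u :: "'n::{finite, linorder} \<Rightarrow> 'k::field"
  assumes u: "sum u UNIV = 0" and i: "u i = 1"
  shows "(dir_deriv u ^^ k) (symh_var i ^ m) = of_nat (\<Prod>t<k. m - t) * symh_var i ^ (m - k)"
proof (induction k)
  case (Suc k)
  interpret derivation "dir_deriv u :: ('n, 'k) symh \<Rightarrow> _"
    by unfold_locales (simp_all add: dir_deriv_add dir_deriv_mult u)
  have nat: "dir_deriv u (of_nat r :: ('n, 'k) symh) = 0" for r
    by (metis dir_deriv_const[OF u] symh_const_of_nat)
  have var: "dir_deriv u (symh_var i) = (1 :: ('n, 'k) symh)"
    by (simp add: dir_deriv_spec u i symh_scale_simps)
  show ?case
    by (simp add: Suc E_mult nat E_power var mult_ac del: of_nat_prod)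
qed simp

text \<open>At \<open>c = 0\<close> the operators are partial derivatives, and the constant term of \<open>\<partial>\<^sup>b x\<^sup>a\<close> is \<open>\<Prod>\<^sub>i a\<^sub>i!\<close>
  if \<open>a = b\<close> and zero otherwise. The factor \<open>r\<close> collects, in the induction, what the operators already
  applied have left of their variables.\<close>

lemma augmentation_iter_deriv:
  fixes r :: "('n::{finite, linorder}, 'k::field) symh"
  assumes "distinct is" "set is \<subseteq> initial_indices"
    and "\<And>i. i \<in> set is \<Longrightarrow> dir_deriv (y_diff i (Max UNIV)) r = 0"
  shows "augmentation (iter_dunkl 0 is b (r * (\<Prod>i\<in>set is. symh_var i ^ lookup a i))) =
    augmentation r * (\<Prod>i\<in>set is. of_bool (lookup a i = lookup b i) *
      of_nat (fact (lookup a i)))"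
  using assms
proof (induction "is" arbitrary: r)
  case (Cons i "is")
  let ?d = "\<lambda>j. dir_deriv (y_diff j (Max UNIV)) :: ('n, 'k) symh \<Rightarrow> _"
  let ?k = "lookup b i" and ?m = "lookup a i"
  define Q where "Q = (\<Prod>j\<in>set is. symh_var j ^ lookup a j :: ('n, 'k) symh)"
  (* what is left of x_i^m after differentiating b_i times, times the old factor *)
  define r' where "r' = of_nat (\<Prod>t<?k. ?m - t) * symh_var i ^ (?m - ?k) * r"
  have d: "derivation (?d j)" for j
    by unfold_locales (simp_all add: dir_deriv_add dir_deriv_mult sum_y_diff)
  have i: "i \<in> initial_indices" "i \<notin> set is" using Cons.prems by auto
  have last: "j \<noteq> Max UNIV" if "j \<in> initial_indices" for j :: 'n
    using that by (simp add: initial_indices_eq)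
  have d_var: "?d j (symh_var l) = 0" if "l \<noteq> j" "l \<in> initial_indices" for j l
  proof -
    have "?d j (symh_var l) = symh_const (y_diff j (Max UNIV) l)"
      by (rule dir_deriv_spec(2)[OF sum_y_diff])
    then show ?thesis using that last[of l] by (simp add: y_diff_def symh_scale_simps)
  qed
  have d_Q: "?d i Q = 0"
  proof -
    have "?d i (\<Prod>j\<in>T. symh_var j ^ lookup a j) = 0" if "T \<subseteq> set is" for T
      using that
    proof (induction T rule: infinite_finite_induct)
      case (insert j T)
      have "?d i (symh_var j) = 0"
        using insert i Cons.prems by (intro d_var) auto
      then show ?case
        using insert by (simp add: derivation.E_mult[OF d] derivation.E_power[OF d])
    qed (simp_all add: derivation.E_1[OF d])
    then show ?thesis by (simp add: Q_def)
  qed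
  have dr: "?d j r' = 0" if "j \<in> set is" for j
  proof -
    have "?d j (symh_var i) = 0" using that i by (intro d_var) auto
    moreover have "?d j (of_nat l) = 0" for l
      by (metis dir_deriv_const[OF sum_y_diff] symh_const_of_nat)
    moreover have "?d j r = 0" using that Cons.prems by simp
    ultimately show ?thesis
      by (simp add: r'_def derivation.E_mult[OF d] derivation.E_power[OF d] del: of_nat_prod)
  qed
  have "r * (\<Prod>i\<in>set (i # is). symh_var i ^ lookup a i) = symh_var i ^ ?m * (r * Q)"
    using i by (simp add: Q_def mult_ac)
  moreover have "(?d i ^^ ?k) (symh_var i ^ ?m * (r * Q)) = r' * Q"
  proof -
    have "?d i (r * Q) = 0"
      using Cons.prems(3)[of i] by (simp add: derivation.E_mult[OF d] d_Q)
    then have "(?d i ^^ ?k) (symh_var i ^ ?m * (r * Q)) = (?d i ^^ ?k) (symh_var i ^ ?m) * (r * Q)"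
      by (rule dir_deriv_funpow_mult[OF sum_y_diff])
    also have "(?d i ^^ ?k) (symh_var i ^ ?m) = of_nat (\<Prod>t<?k. ?m - t) * symh_var i ^ (?m - ?k)"
      using last[OF i(1)] by (intro dir_deriv_funpow_power[OF sum_y_diff]) (simp add: y_diff_def)
    finally show ?thesis by (simp add: r'_def mult_ac)
  qed
  ultimately have "augmentation (iter_dunkl 0 (i # is) b (r * (\<Prod>i\<in>set (i # is). symh_var i ^ lookup a i)))
      = augmentation (iter_dunkl 0 is b (r' * Q))"
    by (simp only: iter_dunkl.simps dunkl_param_0)
  also have "\<dots> = augmentation r' * (\<Prod>i\<in>set is. of_bool (lookup a i = lookup b i) *
      of_nat (fact (lookup a i)))"
    unfolding Q_def using Cons.prems dr by (intro Cons.IH) auto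
  also have "augmentation r' = augmentation r * (of_bool (?m = ?k) * of_nat (fact ?m))"
  proof -
    have aug: "augmentation r' = of_nat (\<Prod>t<?k. ?m - t) * 0 ^ (?m - ?k) * augmentation r"
    proof -
      have "augmentation (of_nat l :: ('n, 'k) symh) = of_nat l" for l
        by (metis augmentation_hom(3) symh_const_of_nat)
      then show ?thesis
        by (simp add: r'_def augmentation_hom augmentation_power augmentation_var del: of_nat_prod)
    qed
    consider "?m < ?k" | "?m = ?k" | "?m > ?k" by linarith
    then show ?thesis
    proof cases
      case 1
      then have "(\<Prod>t<?k. ?m - t) = 0" by (auto intro!: bexI[of _ ?m])
      with 1 show ?thesis by (simp only: aug) simp
    next
      case 2
      have "(\<Prod>t<?m. ?m - t) = fact ?m"
        by (simp add: fact_prod_rev atLeast0LessThan)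
      with 2 show ?thesis by (simp only: aug) simp
    next
      case 3
      then show ?thesis by (simp only: aug) simp
    qed
  qed
  finally show ?case using i by (simp add: mult_ac)
qed simp

lemma symh_mono_prod:
  assumes "keys b \<subseteq> S" "finite S"
  shows "symh_mono b = (\<Prod>i\<in>S. symh_var i ^ lookup b i :: ('n::{finite, linorder}, 'k::field) symh)"
proof -
  have "symh_mono (sum f T) = (\<Prod>i\<in>T. symh_mono (f i) :: ('n, 'k) symh)"
    for f :: "'n \<Rightarrow> 'n \<Rightarrow>\<^sub>0 nat" and T
    by (induction T rule: infinite_finite_induct) (simp_all add: symh_mono_add)
  from this[of "\<lambda>i. single i (lookup b i)" S]
  have "symh_mono (\<Sum>i\<in>S. single i (lookup b i)) =
    (\<Prod>i\<in>S. symh_var i ^ lookup b i :: ('n, 'k) symh)"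
    by (simp add: symh_mono_single)
  moreover have "(\<Sum>i\<in>S. single i (lookup b i)) = b"
  proof (rule poly_mapping_eqI)
    fix j
    have "lookup (\<Sum>i\<in>S. single i (lookup b i)) j =
      (\<Sum>i\<in>S. if i = j then lookup b j else 0)"
      unfolding lookup_sum by (intro sum.cong) (auto simp: lookup_single when_def)
    also have "\<dots> = lookup b j"
      using assms by (auto simp: in_keys_iff)
    finally show "lookup (\<Sum>i\<in>S. single i (lookup b i)) j =
      lookup b j" .
  qed
  ultimately show ?thesis by simp
qed

text \<open>Solvability for the transposed matrix: pair a vector in the kernel with the solutions for the
  unit vectors.\<close>

lemma generic_injective:
  fixes M :: "'k::field \<Rightarrow> 's \<Rightarrow> 's \<Rightarrow> 'k"
  assumes S: "finite S" and M: "\<And>a b. \<exists>q. \<forall>c. M c a b = poly q c"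
    and diag: "\<And>a. a \<in> S \<Longrightarrow> M 0 a a \<noteq> 0"
    and off: "\<And>a b. a \<in> S \<Longrightarrow> b \<in> S \<Longrightarrow> a \<noteq> b \<Longrightarrow> M 0 a b = 0"
  shows "\<exists>C. finite C \<and> (\<forall>c. c \<notin> C \<longrightarrow>
    (\<forall>\<alpha>. (\<forall>b\<in>S. (\<Sum>a\<in>S. \<alpha> a * M c a b) = 0) \<longrightarrow> (\<forall>a\<in>S. \<alpha> a = 0)))"
proof -
  have "\<exists>C. finite C \<and> (\<forall>c. c \<notin> C \<longrightarrow> (\<forall>\<beta>. \<exists>\<gamma>. \<forall>a\<in>S. (\<Sum>b\<in>S. \<gamma> b * M c a b) = \<beta> a))"
    by (rule generic_solvable[of S "\<lambda>c b a. M c a b", OF S M]) (auto simp: diag off)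
  then obtain C where C: "finite C" "\<And>c \<beta>. c \<notin> C \<Longrightarrow> \<exists>\<gamma>. \<forall>a\<in>S. (\<Sum>b\<in>S. \<gamma> b * M c a b) = \<beta> a"
    by blast
  show ?thesis
  proof (intro exI[of _ C] conjI allI impI ballI C(1))
    fix c \<alpha> a0 assume c: "c \<notin> C" and zero: "\<forall>b\<in>S. (\<Sum>a\<in>S. \<alpha> a * M c a b) = 0" and a0: "a0 \<in> S"
    obtain \<gamma> where \<gamma>: "\<And>a. a \<in> S \<Longrightarrow> (\<Sum>b\<in>S. \<gamma> b * M c a b) = of_bool (a = a0)"
      using C(2)[OF c, of "\<lambda>a. of_bool (a = a0)"] by blast
    have "\<alpha> a0 = (\<Sum>a\<in>S. if a = a0 then \<alpha> a else 0)" using a0 S by simp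
    also have "\<dots> = (\<Sum>a\<in>S. \<alpha> a * (\<Sum>b\<in>S. \<gamma> b * M c a b))"
      by (intro sum.cong) (auto simp: \<gamma>)
    also have "\<dots> = (\<Sum>a\<in>S. \<Sum>b\<in>S. \<gamma> b * (\<alpha> a * M c a b))"
      by (simp add: sum_distrib_left mult_ac)
    also have "\<dots> = (\<Sum>b\<in>S. \<gamma> b * (\<Sum>a\<in>S. \<alpha> a * M c a b))"
      by (subst sum.swap) (simp add: sum_distrib_left)
    also have "\<dots> = 0" using zero by simp
    finally show "\<alpha> a0 = 0" .
  qed
qed

definition dunkl_order :: "'n::{finite, linorder} list" where
  "dunkl_order = sorted_list_of_set initial_indices"

lemma dunkl_order: "distinct dunkl_order" "set dunkl_order = (initial_indices :: 'n::{finite, linorder} set)"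
  by (simp_all add: dunkl_order_def)

text \<open>The matrix of constant terms of \<open>D\<^sup>b x\<^sup>a\<close>, for reduced \<open>a\<close> and \<open>b\<close>, is diagonal at \<open>c = 0\<close> with
  entries \<open>\<Prod>\<^sub>i a\<^sub>i!\<close>, which are nonzero because \<open>a\<^sub>i < p\<close>.\<close>

lemma generic_pairing:
  assumes p: "CHAR('k::field) = p" "prime p"
  shows "\<exists>C :: 'k set. finite C \<and> (\<forall>c. c \<notin> C \<longrightarrow>
    (\<forall>\<alpha> :: ('n::{finite, linorder} \<Rightarrow>\<^sub>0 nat) \<Rightarrow> 'k.
      (\<forall>b\<in>reduced p. augmentation (iter_dunkl c dunkl_order b
        (lincomb (reduced p) \<alpha>)) = 0) \<longrightarrow> (\<forall>a\<in>reduced p. \<alpha> a = 0)))"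
proof -
  define M :: "'k \<Rightarrow> ('n \<Rightarrow>\<^sub>0 nat) \<Rightarrow> ('n \<Rightarrow>\<^sub>0 nat) \<Rightarrow> 'k"
    where "M c a b = augmentation (iter_dunkl c dunkl_order b (symh_mono a))" for c a b
  have M_0: "M 0 a b = (\<Prod>i\<in>initial_indices. of_bool (lookup a i = lookup b i) *
      of_nat (fact (lookup a i)))" if "a \<in> reduced p" for a b
  proof -
    have "symh_mono a = (1 * (\<Prod>i\<in>initial_indices. symh_var i ^ lookup a i) :: ('n, 'k) symh)"
      using that by (subst symh_mono_prod[of a initial_indices]) (auto simp: reduced_def)
    then show ?thesis
      using augmentation_iter_deriv[of dunkl_order "1 :: ('n, 'k) symh" b a]
      by (simp add: M_def dunkl_order sum_y_diff augmentation_1)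
  qed
  have "\<exists>C. finite C \<and> (\<forall>c. c \<notin> C \<longrightarrow>
    (\<forall>\<alpha>. (\<forall>b\<in>reduced p. (\<Sum>a\<in>reduced p. \<alpha> a * M c a b) = 0) \<longrightarrow> (\<forall>a\<in>reduced p. \<alpha> a = 0)))"
  proof (rule generic_injective[OF finite_reduced])
    show "\<exists>q. \<forall>c. M c a b = poly q c" for a b
      unfolding M_def
      by (rule poly_family_functional[OF _ _ poly_family_iter_dunkl[OF poly_family_const]])
        (simp_all add: augmentation_hom)
  next
    fix a :: "'n \<Rightarrow>\<^sub>0 nat" assume a: "a \<in> reduced p"
    then have "of_nat (fact (lookup a i)) \<noteq> (0 :: 'k)" for i
      by (intro of_nat_fact_nonzero[OF p]) (simp add: reduced_def)
    then show "M 0 a a \<noteq> 0" by (simp add: M_0[OF a])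
  next
    fix a b :: "'n \<Rightarrow>\<^sub>0 nat" assume ab: "a \<in> reduced p" "b \<in> reduced p" "a \<noteq> b"
    then obtain i where i: "lookup a i \<noteq> lookup b i"
      by (meson poly_mapping_eqI)
    then have "i \<in> keys a \<or> i \<in> keys b"
      by (auto simp: in_keys_iff)
    then have "i \<in> initial_indices" using ab by (auto simp: reduced_def)
    then show "M 0 a b = 0"
      unfolding M_0[OF ab(1)] using i by (intro prod_zero bexI[of _ i]) auto
  qed
  moreover have "augmentation (iter_dunkl c dunkl_order b
      (lincomb (reduced p) \<alpha>)) = (\<Sum>a\<in>reduced p. \<alpha> a * M c a b)" for c b \<alpha>
    by (simp add: M_def iter_dunkl_sum iter_dunkl_scale augmentation_sum augmentation_hom)
  ultimately show ?thesis by simp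
qed

text \<open>In a graded submodule the constant term of an element is the degree zero component of that
  element, so it belongs to the submodule; if it is nonzero, it generates \<open>A\<close>.\<close>

lemma augmentation_proper_graded:
  assumes M: "proper_graded_submodule c M" and a: "a \<in> M"
  shows "augmentation a = 0"
proof (rule ccontr)
  assume nz: "augmentation a \<noteq> 0"
  have sub: "cherednik_submodule c M" "graded_subset M" "M \<noteq> UNIV"
    using M by (auto simp: proper_graded_submodule_def)
  obtain N b where b: "\<And>j. j < N \<Longrightarrow> b j \<in> M \<inter> symh_degree j" "a = (\<Sum>j<N. b j)"
    using sub(2) a unfolding graded_subset_def by blast
  have "\<exists>j<N. augmentation (b j) \<noteq> 0"
    using nz unfolding b(2) augmentation_sum by (metis lessThan_iff sum.neutral)
  then obtain j where j: "j < N" "augmentation (b j) \<noteq> 0" by blast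
  then have "j = 0" using augmentation_degree[of "b j" j] b(1)[of j] by auto
  then have "b 0 \<in> M" "b 0 = symh_const (augmentation (b 0))" "augmentation (b 0) \<noteq> 0"
    using j b(1)[of 0] symh_degree_0_const by auto
  then have "1 = symh_const (inverse (augmentation (b 0))) * b 0"
    by (metis left_inverse symh_scale_simps(2,4))
  then have "1 \<in> M" using cherednik_submoduleD(1)[OF sub(1) \<open>b 0 \<in> M\<close>] by metis
  then have "x \<in> M" for x using cherednik_submoduleD(1)[OF sub(1), of 1 x] by simp
  then show False using sub(3) by auto
qed

text \<open>The reduced monomials span \<open>A\<close> modulo the ideal, degree by degree; the pairing on them is
  nondegenerate; the \<open>f\<^sub>i\<close> are linearly independent. Each holds for generic \<open>c\<close>, and together they
  are all that the rest of the proof uses of a generic parameter besides \<open>c \<noteq> 0\<close>. The second argument fixes the type of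
  the indices, which the parameter does not determine.\<close>

definition good_param :: "nat \<Rightarrow> 'n::{finite, linorder} itself \<Rightarrow> 'k::field \<Rightarrow> bool" where
  "good_param p _ c \<longleftrightarrow>
    (\<forall>b :: 'n \<Rightarrow>\<^sub>0 nat. keys b \<subseteq> initial_indices \<longrightarrow> (\<exists>\<alpha>.
      symh_mono b - lincomb (exponents (mdeg b) \<inter> reduced p) \<alpha>
        \<in> f_ideal p c)) \<and>
    (\<forall>\<alpha> :: ('n \<Rightarrow>\<^sub>0 nat) \<Rightarrow> 'k. (\<forall>b\<in>reduced p. augmentation (iter_dunkl c dunkl_order b
        (lincomb (reduced p) \<alpha>)) = 0) \<longrightarrow> (\<forall>a\<in>reduced p. \<alpha> a = 0)) \<and>
    (\<forall>\<alpha>. (\<Sum>i\<in>initial_indices. symh_scale (\<alpha> i) (f_poly p c i :: ('n, 'k) symh)) = 0 \<longrightarrow>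
      (\<forall>i\<in>initial_indices. \<alpha> i = 0))"

lemma generic_f_poly_independent:
  assumes "p > 0"
  shows "\<exists>C :: 'k::field set. finite C \<and> (\<forall>c. c \<notin> C \<longrightarrow>
    (\<forall>\<alpha>. (\<Sum>i\<in>initial_indices. symh_scale (\<alpha> i) (f_poly p c i :: ('n::{finite, linorder}, 'k) symh)) = 0 \<longrightarrow>
      (\<forall>i\<in>initial_indices. \<alpha> i = 0)))"
proof -
  let ?M = "\<lambda>c i j. symh_coeff (f_poly p c i :: ('n, 'k) symh) (single j p)"
  have M_0: "?M 0 i j = of_bool (i = j)" if "i \<in> initial_indices" for i j
  proof -
    have "?M 0 i j = symh_coeff (symh_mono (single i p) :: ('n, 'k) symh) (single j p)"
      by (simp add: f_poly_0 assms symh_mono_single)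
    also have "\<dots> = of_bool (single i p = single j p)"
      using that by (intro symh_coeff_mono) auto
    also have "\<dots> = of_bool (i = j)"
    proof (cases "i = j")
      case False
      then have "lookup (single i p) i \<noteq> lookup (single j p) i"
        using assms by (simp add: lookup_single when_def)
      then have "single i p \<noteq> single j p" by metis
      then show ?thesis using False by simp
    qed simp
    finally show ?thesis .
  qed
  have "\<exists>C. finite C \<and> (\<forall>c. c \<notin> C \<longrightarrow> (\<forall>\<alpha>. (\<forall>j\<in>initial_indices.
      (\<Sum>i\<in>initial_indices. \<alpha> i * ?M c i j) = 0) \<longrightarrow> (\<forall>i\<in>initial_indices. \<alpha> i = 0)))"
  proof (rule generic_injective)
    show "\<exists>q. \<forall>c. ?M c i j = poly q c" for i j
      by (rule poly_family_functional[of "\<lambda>a. symh_coeff a (single j p)",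
            OF _ _ poly_family_f_poly])
        (simp_all add: symh_coeff_add symh_coeff_scale)
  qed (auto simp: M_0)
  then obtain C where C: "finite C" "\<And>c \<alpha>. c \<notin> C \<Longrightarrow> (\<forall>j\<in>initial_indices.
      (\<Sum>i\<in>initial_indices. \<alpha> i * ?M c i j) = 0) \<Longrightarrow> (\<forall>i\<in>initial_indices. \<alpha> i = 0)" by blast
  show ?thesis
  proof (intro exI[of _ C] conjI allI impI C(1))
    fix c \<alpha> assume c: "c \<notin> C"
      and zero: "(\<Sum>i\<in>initial_indices. symh_scale (\<alpha> i) (f_poly p c i :: ('n, 'k) symh)) = 0"
    have eq: "(\<Sum>i\<in>initial_indices. \<alpha> i * ?M c i j) =
        symh_coeff (\<Sum>i\<in>initial_indices. symh_scale (\<alpha> i) (f_poly p c i :: ('n, 'k) symh)) (single j p)" for j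
      by (simp add: symh_coeff_sum symh_scale_def symh_coeff_scale)
    have "(\<Sum>i\<in>initial_indices. \<alpha> i * ?M c i j) = 0" for j
      unfolding eq zero by (simp add: symh_coeff_def)
    then show "\<forall>i\<in>initial_indices. \<alpha> i = 0"
      by (rule C(2)[OF c, OF ballI])
  qed
qed

lemma generic_good_param:
  assumes p: "CHAR('k::field) = p" "prime p"
  shows "\<exists>C :: 'k set. finite C \<and> (\<forall>c. c \<notin> C \<longrightarrow> c \<noteq> 0 \<and> good_param p TYPE('n::{finite, linorder}) c)"
proof -
  have p0: "p > 0" using p(2) by (rule prime_gt_0_nat)
  from generic_span[OF p0, where ?'k = 'k and ?'n = 'n] obtain C1 :: "'k set" where C1: "finite C1"
    "\<And>c. c \<notin> C1 \<Longrightarrow> (\<forall>b :: 'n \<Rightarrow>\<^sub>0 nat. keys b \<subseteq> initial_indices \<longrightarrow> (\<exists>\<alpha>.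
      symh_mono b - lincomb (exponents (mdeg b) \<inter> reduced p) \<alpha>
        \<in> f_ideal p c))" by blast
  from generic_pairing[OF p, where ?'n = 'n] obtain C2 :: "'k set" where C2: "finite C2"
    "\<And>c. c \<notin> C2 \<Longrightarrow> (\<forall>\<alpha> :: ('n \<Rightarrow>\<^sub>0 nat) \<Rightarrow> 'k. (\<forall>b\<in>reduced p. augmentation (iter_dunkl c dunkl_order b
        (lincomb (reduced p) \<alpha>)) = 0) \<longrightarrow> (\<forall>a\<in>reduced p. \<alpha> a = 0))"
    by blast
  from generic_f_poly_independent[OF p0, where ?'k = 'k and ?'n = 'n]
  obtain C3 :: "'k set" where C3: "finite C3"
    "\<And>c. c \<notin> C3 \<Longrightarrow> (\<forall>\<alpha>. (\<Sum>i\<in>initial_indices. symh_scale (\<alpha> i) (f_poly p c i :: ('n, 'k) symh)) = 0 \<longrightarrow>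
      (\<forall>i\<in>initial_indices. \<alpha> i = 0))" by blast
  have "good_param p TYPE('n) c" if "c \<notin> {0} \<union> C1 \<union> C2 \<union> C3" for c
    unfolding good_param_def using that C1(2)[of c] C2(2)[of c] C3(2)[of c] by blast
  then show ?thesis
    by (intro exI[of _ "{0} \<union> C1 \<union> C2 \<union> C3"]) (use C1(1) C2(1) C3(1) in simp)
qed

context
  fixes p :: nat and c :: "'k::field"
  assumes p: "CHAR('k) = p" "prime p" and c: "c \<noteq> 0" "good_param p TYPE('n::{finite, linorder}) c"
begin

lemma reduced_span:
  fixes a :: "('n, 'k) symh"
  shows "\<exists>\<alpha>. a - lincomb (reduced p) \<alpha> \<in> f_ideal p c"
proof -
  have mono: "\<exists>\<alpha>. symh_mono b - lincomb (reduced p) \<alpha> \<in> f_ideal p c"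
    if b: "keys b \<subseteq> initial_indices" for b :: "'n \<Rightarrow>\<^sub>0 nat"
  proof -
    obtain \<alpha> where \<alpha>: "symh_mono b - lincomb (exponents (mdeg b) \<inter> reduced p) \<alpha>
        \<in> f_ideal p c"
      using c(2) b unfolding good_param_def by blast
    have "(lincomb (exponents (mdeg b) \<inter> reduced p) \<alpha> :: ('n, 'k) symh) =
      (\<Sum>a\<in>reduced p. symh_const (if a \<in> exponents (mdeg b) then \<alpha> a else 0) * symh_mono a)"
      by (rule sum.mono_neutral_cong_left) (auto simp: finite_reduced symh_scale_simps)
    with \<alpha> show ?thesis
      by (intro exI[of _ "\<lambda>a. if a \<in> exponents (mdeg b) then \<alpha> a else 0"]) (simp only:)
  qed
  obtain S \<beta> where S: "finite S" "S \<subseteq> {b. keys b \<subseteq> initial_indices}"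
    "a = lincomb S \<beta>"
    using symh_mono_span[of a] by blast
  show ?thesis
    by (rule f_ideal_span_combination[OF _ S(3)]) (use mono S(2) in blast)
qed

text \<open>Write \<open>a \<in> M\<close> as an element of the ideal plus a combination \<open>r\<close> of reduced monomials. All \<open>D\<^sup>b\<close>
  map \<open>M\<close> and the ideal into themselves, hence into elements without constant term, so \<open>r\<close> is
  orthogonal to all \<open>D\<^sup>b\<close> and vanishes.\<close>

lemma proper_graded_submodule_le:
  assumes n: "p dvd CARD('n)" and M: "proper_graded_submodule c (M :: ('n, 'k) symh set)"
  shows "M \<subseteq> f_ideal p c"
proof
  fix a assume a: "a \<in> M"
  obtain \<alpha> where \<alpha>: "a - lincomb (reduced p) \<alpha> \<in> f_ideal p c"
    using reduced_span by blast
  let ?r = "\<Sum>b\<in>reduced p. symh_const (\<alpha> b) * symh_mono b :: ('n, 'k) symh"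
  have I: "proper_graded_submodule c (f_ideal p c :: ('n, 'k) symh set)"
    by (rule proper_graded_f_ideal[OF p n c(1)])
  have "augmentation (iter_dunkl c dunkl_order b ?r) = 0" for b
  proof -
    have zero: "augmentation (iter_dunkl c dunkl_order b x) = 0"
      if "proper_graded_submodule c N" "x \<in> N" for x :: "('n, 'k) symh" and N
      using augmentation_proper_graded[OF that(1)] iter_dunkl_submodule[of c N x] that
      by (simp add: proper_graded_submodule_def)
    have "augmentation (iter_dunkl c dunkl_order b ((a - ?r) + ?r)) = 0"
      using zero[OF M a] by simp
    then show ?thesis
      unfolding iter_dunkl_add augmentation_hom using zero[OF I \<alpha>] by simp
  qed
  then have "\<forall>b\<in>reduced p. \<alpha> b = 0"
    using c(2) unfolding good_param_def by blast
  then have "?r = 0" by (intro sum.neutral) (simp add: symh_scale_simps)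
  then show "a \<in> f_ideal p c" using \<alpha> by simp
qed

text \<open>A proper graded submodule that contains all others is the only maximal one.\<close>

lemma max_graded_submodule_eq:
  assumes n: "p dvd CARD('n)"
  shows "max_graded_submodule c = (f_ideal p c :: ('n, 'k) symh set)"
  unfolding max_graded_submodule_def
proof (rule the_equality)
  note I = proper_graded_f_ideal[OF p n c(1)]
  show "proper_graded_submodule c (f_ideal p c :: ('n, 'k) symh set) \<and>
      (\<forall>M. proper_graded_submodule c M \<longrightarrow> f_ideal p c \<subseteq> M \<longrightarrow> M = (f_ideal p c :: ('n, 'k) symh set))"
    using I proper_graded_submodule_le[OF n] by blast
  show "J = f_ideal p c" if "proper_graded_submodule c J \<and>
      (\<forall>M. proper_graded_submodule c M \<longrightarrow> J \<subseteq> M \<longrightarrow> M = J)" for J :: "('n, 'k) symh set"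
    using that I proper_graded_submodule_le[OF n, of J] by blast
qed

end

section \<open>The Hilbert series\<close>

context
  fixes p :: nat and c :: "'k::field"
  assumes p: "CHAR('k) = p" "prime p" and n: "p dvd CARD('n::{finite, linorder})"
    and c: "c \<noteq> 0" "good_param p TYPE('n) c"
begin

text \<open>The ideal is a proper graded submodule, so the pairing vanishes on it.\<close>

lemma reduced_independent:
  assumes "(lincomb (reduced p) \<alpha> :: ('n, 'k) symh) \<in> f_ideal p c"
    and "a \<in> reduced p"
  shows "\<alpha> a = 0"
proof -
  have I: "proper_graded_submodule c (f_ideal p c :: ('n, 'k) symh set)"
    by (rule proper_graded_f_ideal[OF p n c(1)])
  have "augmentation (iter_dunkl c dunkl_order b
      (lincomb (reduced p) \<alpha> :: ('n, 'k) symh)) = 0" for b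
    using augmentation_proper_graded[OF I] iter_dunkl_submodule[OF _ assms(1)] I
    by (simp add: proper_graded_submodule_def)
  then show ?thesis
    using c(2) assms(2) unfolding good_param_def by blast
qed

lemma span_degree:
  assumes a: "a \<in> (symh_degree d :: ('n, 'k) symh set)"
  shows "\<exists>\<alpha>. a - lincomb (exponents d \<inter> reduced p) \<alpha> \<in> f_ideal p c"
proof (rule f_ideal_span_combination[OF _ symh_expand_degree[OF a]])
  fix b :: "'n \<Rightarrow>\<^sub>0 nat" assume "b \<in> exponents d"
  then have "keys b \<subseteq> initial_indices" "mdeg b = d" by (auto simp: exponents_def)
  then show "\<exists>\<alpha>. symh_mono b - lincomb (exponents d \<inter> reduced p) \<alpha>
      \<in> f_ideal p c"
    using c(2) unfolding good_param_def by blast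
qed

text \<open>The classes of the reduced monomials of degree \<open>d\<close> form a basis of the degree \<open>d\<close> piece of the
  quotient.\<close>

lemma dim_quotient_degree:
  defines "R \<equiv> ring_of_type_algebra :: ('n, 'k) symh ring"
  defines "J \<equiv> f_ideal p c :: ('n, 'k) symh set"
  shows "ring.dim (R Quot J) ((\<lambda>a. J +>\<^bsub>R\<^esub> a) ` range symh_const) ((\<lambda>a. J +>\<^bsub>R\<^esub> a) ` symh_degree d) =
    card (exponents d \<inter> reduced p :: ('n \<Rightarrow>\<^sub>0 nat) set)"
proof -
  define q where "q a = J +>\<^bsub>R\<^esub> a" for a
  interpret J: ideal J R unfolding J_def R_def by (rule f_ideal_ideal)
  interpret Q: ring "R Quot J" by (rule J.quotient_is_ring)
  note Q.Span.simps [simp del]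
  have hom: "q \<in> ring_hom R (R Quot J)"
    using J.rcos_ring_hom by (simp add: q_def[abs_def])
  have q_add: "q (a + b) = q a \<oplus>\<^bsub>R Quot J\<^esub> q b" for a b
    using ring_hom_add[OF hom, of a b] by (simp add: R_def)
  have q_mult: "q (a * b) = q a \<otimes>\<^bsub>R Quot J\<^esub> q b" for a b
    using ring_hom_mult[OF hom, of a b] by (simp add: R_def)
  have q_0: "q 0 = \<zero>\<^bsub>R Quot J\<^esub>"
    using ring_hom_zero[OF hom J.ring_axioms Q.ring_axioms] by (simp add: R_def)
  have q_1: "q 1 = \<one>\<^bsub>R Quot J\<^esub>"
    using ring_hom_one[OF hom] by (simp add: R_def)
  have q_closed: "q a \<in> carrier (R Quot J)" for a
    using ring_hom_closed[OF hom, of a] by (simp add: R_def)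
  have q_set: "q a = {h + a | h. h \<in> J}" for a
    by (auto simp: q_def a_r_coset_def' R_def)
  have q_eqD: "a - b \<in> J" if "q a = q b" for a b
  proof -
    have "a \<in> q a" using f_ideal_closed(1)[of p c] by (force simp: q_set J_def)
    then show ?thesis unfolding that by (auto simp: q_set)
  qed
  have q_eqI: "q a = q b" if "a - b \<in> J" for a b
  proof -
    have "q (a - b) = q 0"
    proof -
      have "h + (a - b) \<in> J" if "h \<in> J" for h
        using that \<open>a - b \<in> J\<close> f_ideal_closed(2) unfolding J_def by blast
      moreover have "\<exists>h'. h = h' + (a - b) \<and> h' \<in> J" if "h \<in> J" for h
        using that \<open>a - b \<in> J\<close> f_ideal_diff[of h p c "a - b"] unfolding J_def
        by (intro exI[of _ "h - (a - b)"]) simp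
      ultimately show ?thesis by (auto simp: q_set)
    qed
    then have "q ((a - b) + b) = q (0 + b)" unfolding q_add by (simp only:)
    then show ?thesis by simp
  qed
  let ?K = "q ` range symh_const"
  have K: "subfield ?K (R Quot J)"
  proof -
    let ?k = "ring_of_type_algebra :: 'k ring"
    interpret k: field ?k by (rule field_from_type_algebra)
    have "ring_hom_ring ?k (R Quot J) (\<lambda>r. q (symh_const r))"
      by (rule ring_hom_ringI)
        (auto simp: k.ring_axioms Q.ring_axioms q_closed symh_scale_simps q_add q_mult q_1)
    then interpret h: ring_hom_ring ?k "R Quot J" "\<lambda>r. q (symh_const r)" .
    have "1 \<notin> J"
      using augmentation_f_ideal[of p "1 :: ('n, 'k) symh" c] prime_gt_0_nat[OF p(2)]
      by (auto simp: augmentation_1 J_def)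
    then have "\<one>\<^bsub>R Quot J\<^esub> \<noteq> \<zero>\<^bsub>R Quot J\<^esub>"
      using q_eqD[of 1 0] by (auto simp flip: q_0 q_1)
    from h.img_is_subfield(2)[OF k.carrier_is_subfield this] show ?thesis
      by (simp add: image_image)
  qed
  have combine: "Q.combine (map (\<lambda>a. q (symh_const (\<alpha> a))) us) (map (\<lambda>a. q (symh_mono a)) us) =
      q (\<Sum>a\<leftarrow>us. symh_const (\<alpha> a) * symh_mono a)" for \<alpha> us
    by (induction us) (simp_all add: q_0 q_add q_mult)
  have Span: "Q.Span ?K (map (\<lambda>a. q (symh_mono a)) us) =
      {q (lincomb (set us) \<alpha>) | \<alpha>. True}" if "distinct us" for us
  proof -
    have "(\<exists>Ks. x = Q.combine Ks (map (\<lambda>a. q (symh_mono a)) us) \<and>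
        length Ks = length (map (\<lambda>a. q (symh_mono a)) us) \<and> set Ks \<subseteq> ?K) \<longleftrightarrow>
      (\<exists>\<alpha>. x = q (lincomb (set us) \<alpha>))" for x
    proof
      assume "\<exists>Ks. x = Q.combine Ks (map (\<lambda>a. q (symh_mono a)) us) \<and>
        length Ks = length (map (\<lambda>a. q (symh_mono a)) us) \<and> set Ks \<subseteq> ?K"
      then obtain Ks where Ks: "x = Q.combine Ks (map (\<lambda>a. q (symh_mono a)) us)"
        "length Ks = length us" "set Ks \<subseteq> ?K" by auto
      from Ks(3) have "\<exists>rs. Ks = map (\<lambda>r. q (symh_const r)) rs"
        by (subst ex_map_conv) auto
      then obtain rs where rs: "Ks = map (\<lambda>r. q (symh_const r)) rs" by blast
      define \<alpha> where "\<alpha> a = the (map_of (zip us rs) a)" for a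
      have "rs = map \<alpha> us"
        using Ks(2) rs that
        by (intro nth_equalityI) (simp_all add: \<alpha>_def map_of_zip_nth)
      then have "Ks = map (\<lambda>a. q (symh_const (\<alpha> a))) us" using rs by simp
      then have "x = q (lincomb (set us) \<alpha>)"
        using Ks(1) that by (simp add: combine sum_list_distinct_conv_sum_set)
      then show "\<exists>\<alpha>. x = q (lincomb (set us) \<alpha>)" by blast
    next
      assume "\<exists>\<alpha>. x = q (lincomb (set us) \<alpha>)"
      then obtain \<alpha> where "x = q (lincomb (set us) \<alpha>)" by blast
      then show "\<exists>Ks. x = Q.combine Ks (map (\<lambda>a. q (symh_mono a)) us) \<and>
        length Ks = length (map (\<lambda>a. q (symh_mono a)) us) \<and> set Ks \<subseteq> ?K"
        using that
        by (intro exI[of _ "map (\<lambda>a. q (symh_const (\<alpha> a))) us"])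
          (auto simp: combine sum_list_distinct_conv_sum_set)
    qed
    moreover have "set (map (\<lambda>a. q (symh_mono a)) us) \<subseteq> carrier (R Quot J)"
      using q_closed by auto
    ultimately show ?thesis
      using Q.Span_eq_combine_set_length_version[OF K] by simp
  qed
  have indep: "Q.independent ?K (map (\<lambda>a. q (symh_mono a)) us)"
    if "distinct us" "set us \<subseteq> reduced p" for us
    using that
  proof (induction us)
    case (Cons u us)
    have "q (symh_mono u) \<notin> Q.Span ?K (map (\<lambda>a. q (symh_mono a)) us)"
    proof
      assume "q (symh_mono u) \<in> Q.Span ?K (map (\<lambda>a. q (symh_mono a)) us)"
      then obtain \<alpha> where "q (symh_mono u) = q (lincomb (set us) \<alpha>)"
        using Cons.prems by (auto simp: Span)
      then have diff: "symh_mono u - lincomb (set us) \<alpha> \<in> J"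
        by (rule q_eqD)
      (* a nontrivial relation between reduced monomials modulo J *)
      define \<beta> where "\<beta> a = (if a = u then 1 else if a \<in> set us then - \<alpha> a else 0)" for a
      have "(lincomb (reduced p) \<beta> :: ('n, 'k) symh) =
          (lincomb (insert u (set us)) \<beta>)"
        using Cons.prems
        by (intro sum.mono_neutral_right) (auto simp: finite_reduced \<beta>_def symh_const_hom)
      also have "\<dots> = symh_mono u + (\<Sum>a\<in>set us. - (symh_const (\<alpha> a) * symh_mono a))"
      proof -
        have "(lincomb (set us) \<beta> :: ('n, 'k) symh) =
            (\<Sum>a\<in>set us. - (symh_const (\<alpha> a) * symh_mono a))"
          using Cons.prems by (intro sum.cong) (auto simp: \<beta>_def symh_const_hom)
        moreover have "symh_const (\<beta> u) = (1 :: ('n, 'k) symh)" by (simp add: \<beta>_def symh_const_hom)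
        ultimately show ?thesis using Cons.prems by simp
      qed
      also have "\<dots> = symh_mono u - lincomb (set us) \<alpha>"
        by (simp add: sum_negf)
      finally have "(lincomb (reduced p) \<beta> :: ('n, 'k) symh) \<in> J"
        using diff by (simp only:)
      then have "\<beta> u = 0"
        using reduced_independent[of \<beta> u] Cons.prems by (simp add: J_def)
      then show False by (simp add: \<beta>_def)
    qed
    then show ?case
      using Cons q_closed by (auto intro: Q.li_Cons)
  qed auto
  let ?E = "exponents d \<inter> reduced p :: ('n \<Rightarrow>\<^sub>0 nat) set"
  obtain us where us: "set us = ?E" "distinct us"
    using finite_distinct_list[of ?E] finite_exponents by blast
  have "Q.Span ?K (map (\<lambda>a. q (symh_mono a)) us) = q ` symh_degree d"
  proof
    show "Q.Span ?K (map (\<lambda>a. q (symh_mono a)) us) \<subseteq> q ` symh_degree d"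
    proof
      fix x assume "x \<in> Q.Span ?K (map (\<lambda>a. q (symh_mono a)) us)"
      then obtain \<alpha> where x: "x = q (lincomb ?E \<alpha>)"
        by (auto simp: Span us)
      have "(lincomb ?E \<alpha>) \<in> symh_degree d"
      proof (rule symh_degree_sum)
        fix a assume "a \<in> ?E"
        then show "symh_const (\<alpha> a) * symh_mono a \<in> symh_degree d"
          using symh_degree_mult[OF symh_degree_const[of "\<alpha> a"] symh_degree_mono[of a]]
          by (simp add: exponents_def)
      qed
      then show "x \<in> q ` symh_degree d" unfolding x by (rule imageI)
    qed
    show "q ` symh_degree d \<subseteq> Q.Span ?K (map (\<lambda>a. q (symh_mono a)) us)"
    proof
      fix x assume "x \<in> q ` symh_degree d"
      then obtain a where a: "a \<in> symh_degree d" "x = q a" by auto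
      obtain \<alpha> where "a - lincomb ?E \<alpha> \<in> J"
        using span_degree[OF a(1)] unfolding J_def by blast
      then have "x = q (lincomb ?E \<alpha>)"
        unfolding a(2) by (rule q_eqI)
      then show "x \<in> Q.Span ?K (map (\<lambda>a. q (symh_mono a)) us)"
        by (auto simp: Span us)
    qed
  qed
  moreover have "Q.independent ?K (map (\<lambda>a. q (symh_mono a)) us)"
    by (rule indep) (auto simp: us)
  ultimately have "Q.dimension (length us) ?K (q ` symh_degree d)"
    using Q.dimension_independent by fastforce
  then have "Q.dim ?K (q ` symh_degree d) = length us"
    using Q.dimI[OF K] by (simp add: over_def)
  also have "length us = card ?E" using us distinct_card by metis
  finally show ?thesis by (simp add: q_def[abs_def])
qed

end

text \<open>Expand the product of the \<open>n - 1\<close> factors \<open>1 + t + \<dots> + t\<^sup>p\<^sup>-\<^sup>1\<close>.\<close>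

lemma card_reduced_degree:
  assumes "p > 0"
  shows "of_nat (card (exponents d \<inter> reduced p :: ('n::{finite, linorder} \<Rightarrow>\<^sub>0 nat) set)) =
    (((1 - fps_X ^ p) / (1 - fps_X)) ^ (CARD('n) - 1) :: rat fps) $ d"
proof -
  let ?W = "initial_indices :: 'n set"
  let ?P = "Pi\<^sub>E ?W (\<lambda>_. {..<p})"
  have nz: "1 - fps_X \<noteq> (0 :: rat fps)"
    by (metis eq_iff_diff_eq_0 fps_X_neq_one)
  have "(1 - fps_X ^ p) / (1 - fps_X) = (\<Sum>k<p. fps_X ^ k :: rat fps)"
    unfolding one_diff_power_eq by (rule nonzero_mult_div_cancel_left[OF nz])
  then have "((1 - fps_X ^ p) / (1 - fps_X)) ^ (CARD('n) - 1) = (\<Prod>i\<in>?W. \<Sum>k<p. fps_X ^ k :: rat fps)"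
    by (simp add: card_initial_indices)
  also have "\<dots> = (\<Sum>g\<in>?P. \<Prod>i\<in>?W. fps_X ^ g i)"
    by (rule prod_sum_PiE) auto
  also have "\<dots> = (\<Sum>g\<in>?P. fps_X ^ sum g ?W)"
    by (simp add: power_sum)
  finally have "(((1 - fps_X ^ p) / (1 - fps_X)) ^ (CARD('n) - 1) :: rat fps) $ d =
      (\<Sum>g\<in>?P. fps_X ^ sum g ?W) $ d" by (simp only:)
  also have "\<dots> = (\<Sum>g\<in>?P. if d = sum g ?W then 1 else 0)"
    by (simp only: fps_sum_nth fps_X_power_nth)
  also have "\<dots> = of_nat (card {g \<in> ?P. d = sum g ?W})"
    by (simp add: finite_PiE flip: sum.inter_filter)
  also have "card {g \<in> ?P. d = sum g ?W} = card (exponents d \<inter> reduced p :: ('n \<Rightarrow>\<^sub>0 nat) set)"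
  proof (rule sym, rule bij_betw_same_card)
    show "bij_betw (\<lambda>b. restrict (lookup b) ?W) (exponents d \<inter> reduced p) {g \<in> ?P. d = sum g ?W}"
    proof (rule bij_betw_imageI)
      show "inj_on (\<lambda>b. restrict (lookup b) ?W) (exponents d \<inter> reduced p)"
      proof (rule inj_onI, rule poly_mapping_eqI)
        fix b b' :: "'n \<Rightarrow>\<^sub>0 nat" and i
        assume b: "b \<in> exponents d \<inter> reduced p" "b' \<in> exponents d \<inter> reduced p"
          "restrict (lookup b) ?W = restrict (lookup b') ?W"
        show "lookup b i = lookup b' i"
        proof (cases "i \<in> ?W")
          case True
          then show ?thesis using fun_cong[OF b(3), of i] by simp
        next
          case False
          then have "i \<notin> keys b" "i \<notin> keys b'"
            using b by (auto simp: exponents_def)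
          then show ?thesis by (simp add: in_keys_iff)
        qed
      qed
      have mdeg: "mdeg b = (\<Sum>i\<in>?W. lookup b i)" if "keys b \<subseteq> ?W" for b :: "'n \<Rightarrow>\<^sub>0 nat"
        unfolding mdeg_def by (rule sum.mono_neutral_right) (use that in \<open>auto simp: in_keys_iff\<close>)
      show "(\<lambda>b. restrict (lookup b) ?W) ` (exponents d \<inter> reduced p) = {g \<in> ?P. d = sum g ?W}"
      proof
        show "(\<lambda>b. restrict (lookup b) ?W) ` (exponents d \<inter> reduced p) \<subseteq> {g \<in> ?P. d = sum g ?W}"
          by (auto simp: exponents_def reduced_def mdeg)
        show "{g \<in> ?P. d = sum g ?W} \<subseteq> (\<lambda>b. restrict (lookup b) ?W) ` (exponents d \<inter> reduced p)"
        proof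
          fix g assume g: "g \<in> {g \<in> ?P. d = sum g ?W}"
          define b where "b = Abs_poly_mapping (\<lambda>i. if i \<in> ?W then g i else 0)"
          have b: "lookup b i = (if i \<in> ?W then g i else 0)" for i
            by (simp add: b_def)
          have keys: "keys b \<subseteq> ?W" by (auto simp: in_keys_iff b split: if_splits)
          have gp: "g i < p" if "i \<in> ?W" for i using g that by (auto simp: PiE_def)
          show "g \<in> (\<lambda>b. restrict (lookup b) ?W) ` (exponents d \<inter> reduced p)"
          proof (rule image_eqI)
            show "g = restrict (lookup b) ?W"
            proof
              fix i
              show "g i = restrict (lookup b) ?W i"
                using g by (cases "i \<in> ?W") (auto simp: b PiE_def extensional_def)
            qed
            show "b \<in> exponents d \<inter> reduced p"
              using g keys gp assms mdeg[OF keys] by (auto simp: exponents_def reduced_def b)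
          qed
        qed
      qed
    qed
  qed
  finally show ?thesis ..
qed

section \<open>Complete intersection\<close>

lemma poly_ring_simps [simp]:
  "x \<otimes>\<^bsub>poly_ring W\<^esub> y = x * y" "x \<oplus>\<^bsub>poly_ring W\<^esub> y = x + y"
  "\<one>\<^bsub>poly_ring W\<^esub> = 1" "\<zero>\<^bsub>poly_ring W\<^esub> = 0"
  by (simp_all add: poly_ring_def ring_of_type_algebra_def)

lemma ring_poly_ring: "ring (poly_ring W :: ('v, 'k::field) mpoly ring)"
proof -
  interpret ring "ring_of_type_algebra :: ('v, 'k) mpoly ring" by (rule ring_ring_of_type_algebra)
  have "subring (carrier (poly_ring W)) (ring_of_type_algebra :: ('v, 'k) mpoly ring)"
    by (rule subringI)
      (auto simp: carrier_poly_ring_uminus carrier_poly_ring_add carrier_poly_ring_mult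
        intro: carrier_poly_ring_const[of 1, unfolded single_one])
  from subring_is_ring[OF this] show ?thesis
    by (simp add: poly_ring_def)
qed

lemma ideal_poly_ring_closed:
  assumes "ideal K (poly_ring W)"
  shows "0 \<in> K" "x \<in> K \<Longrightarrow> y \<in> K \<Longrightarrow> x + y \<in> K"
    "x \<in> K \<Longrightarrow> r \<in> carrier (poly_ring W) \<Longrightarrow> r * x \<in> K"
proof -
  interpret ideal K "poly_ring W" by (rule assms)
  show "0 \<in> K" using additive_subgroup.zero_closed[OF is_additive_subgroup] by simp
  show "x + y \<in> K" if "x \<in> K" "y \<in> K"
    using additive_subgroup.a_closed[OF is_additive_subgroup that] by simp
  show "r * x \<in> K" if "x \<in> K" "r \<in> carrier (poly_ring W)"
    using I_l_closed[OF that] by simp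
qed

lemma ideal_elim_last_image:
  assumes I: "ideal I (ring_of_type_algebra :: ('n::{finite, linorder}, 'k::field) symh ring)"
  shows "ideal (elim_last ` I) (poly_ring initial_indices)"
proof -
  interpret ring "poly_ring initial_indices :: ('n, 'k) mpoly ring" by (rule ring_poly_ring)
  note I' = I[unfolded ideal_of_type_algebra_iff]
  have carrier: "elim_last ` I \<subseteq> carrier (poly_ring initial_indices)"
    using elim_last_carrier by blast
  have neg: "- f \<in> elim_last ` I" if "f \<in> elim_last ` I" for f
  proof -
    from that obtain a where a: "a \<in> I" "f = elim_last a" by auto
    have "- f = elim_last (- 1 * a)"
      using elim_last_hom(3)[of 0 a] by (simp add: a)
    moreover have "- 1 * a \<in> I" using I' a by blast
    ultimately show ?thesis by blast
  qed
  have inv: "\<ominus>\<^bsub>poly_ring initial_indices\<^esub> f = - f" if "f \<in> carrier (poly_ring initial_indices)"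
    for f :: "('n, 'k) mpoly"
    using that by (intro minus_equality) (simp_all add: carrier_poly_ring_uminus)
  have mult: "r * x \<in> elim_last ` I" if x: "x \<in> elim_last ` I" and r: "r \<in> carrier (poly_ring initial_indices)" for x r
  proof -
    from x obtain a where a: "a \<in> I" "x = elim_last a" by auto
    have "r * x = elim_last (abs_symh r * a)"
      by (simp add: elim_last_hom elim_last_abs[OF r] a)
    moreover have "abs_symh r * a \<in> I" using I' a by blast
    ultimately show ?thesis by blast
  qed
  show ?thesis
  proof (rule idealI[OF ring_poly_ring])
    show "subgroup (elim_last ` I) (add_monoid (poly_ring initial_indices))"
    proof (rule add.subgroupI)
      show "elim_last ` I \<noteq> {}" using I' by blast
      show "\<ominus>\<^bsub>poly_ring initial_indices\<^esub> f \<in> elim_last ` I" if "f \<in> elim_last ` I" for f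
        using inv[of f] neg[OF that] that carrier by auto
      show "f \<oplus>\<^bsub>poly_ring initial_indices\<^esub> g \<in> elim_last ` I"
        if fg: "f \<in> elim_last ` I" "g \<in> elim_last ` I" for f g
      proof -
        from fg obtain a b where ab: "a \<in> I" "f = elim_last a" "b \<in> I" "g = elim_last b" by auto
        then have "f + g = elim_last (a + b)" "a + b \<in> I" using I' by (auto simp: elim_last_hom)
        then show ?thesis by auto
      qed
    qed (rule carrier)
    show "x \<otimes>\<^bsub>poly_ring initial_indices\<^esub> a \<in> elim_last ` I"
      if "a \<in> elim_last ` I" "x \<in> carrier (poly_ring initial_indices)" for a x
      using mult[OF that] by simp
    show "a \<otimes>\<^bsub>poly_ring initial_indices\<^esub> x \<in> elim_last ` I"
      if "a \<in> elim_last ` I" "x \<in> carrier (poly_ring initial_indices)" for a x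
      using mult[OF that] by (simp add: mult.commute)
  qed
qed

lemma genideal_elim_last:
  fixes f :: "'s \<Rightarrow> ('n::{finite, linorder}, 'k::field) symh"
  assumes "finite S"
  shows "Idl\<^bsub>poly_ring initial_indices\<^esub> ((\<lambda>i. elim_last (f i)) ` S) =
    elim_last ` (Idl\<^bsub>ring_of_type_algebra\<^esub> (f ` S))" (is "?L = ?R")
proof
  interpret ring "ring_of_type_algebra :: ('n, 'k) symh ring" by (rule ring_ring_of_type_algebra)
  have "ideal (Idl\<^bsub>ring_of_type_algebra\<^esub> (f ` S)) ring_of_type_algebra"
    by (rule genideal_ideal) simp
  then have "ideal ?R (poly_ring initial_indices)"
    by (rule ideal_elim_last_image)
  moreover have "f ` S \<subseteq> Idl\<^bsub>ring_of_type_algebra\<^esub> (f ` S)"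
    by (rule genideal_self) simp
  then have "(\<lambda>i. elim_last (f i)) ` S \<subseteq> ?R" by auto
  ultimately show "?L \<subseteq> ?R" unfolding genideal_def by blast
  show "?R \<subseteq> ?L"
  proof
    fix x assume "x \<in> ?R"
    then obtain g where x: "x = elim_last (\<Sum>i\<in>S. g i * f i)"
      unfolding genideal_type_algebra_image[OF assms] by auto
    show "x \<in> ?L"
      unfolding genideal_def
    proof clarify
      fix K :: "('n, 'k) mpoly set"
      assume K: "ideal K (poly_ring initial_indices)" "(\<lambda>i. elim_last (f i)) ` S \<subseteq> K"
      note K_closed = ideal_poly_ring_closed[OF K(1)]
      have "(\<Sum>i\<in>T. elim_last (g i) * elim_last (f i)) \<in> K" if "T \<subseteq> S" for T
        using that
      proof (induction T rule: infinite_finite_induct)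
        case (insert i T)
        have "elim_last (f i) \<in> K" using K(2) insert by auto
        then have "elim_last (g i) * elim_last (f i) \<in> K"
          using K_closed(3) elim_last_carrier by blast
        then show ?case using K_closed(2) insert by simp
      qed (simp_all add: K_closed(1))
      then show "x \<in> K" by (simp add: x elim_last_sum elim_last_hom)
    qed
  qed
qed

text \<open>Among the terms of \<open>g f\<close>, those of the degree of \<open>f\<close> come from the constant term of \<open>g\<close>.\<close>

lemma symh_coeff_mult_lowest:
  assumes f: "f \<in> symh_degree d" and b: "mdeg b = d"
  shows "symh_coeff (g * f) b = augmentation g * symh_coeff f b"
proof -
  obtain S \<alpha> where S: "finite S" "S \<subseteq> {b. keys b \<subseteq> initial_indices}"
    "g = lincomb S \<alpha>"
    using symh_mono_span[of g] by blast
  have "symh_coeff (symh_mono a * f) b = augmentation (symh_mono a) * symh_coeff f b" for a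
  proof (cases "a = 0")
    case False
    then have "mdeg a > 0" using mdeg_eq_0[of a] by simp
    moreover have "symh_mono a * f \<in> symh_degree (mdeg a + d)"
      by (rule symh_degree_mult[OF symh_degree_mono f])
    ultimately have "b \<notin> keys (elim_last (symh_mono a * f))"
      using b by (auto simp: symh_degree_iff homogeneous_iff)
    then have "symh_coeff (symh_mono a * f) b = 0"
      by (simp add: symh_coeff_def in_keys_iff)
    moreover have "augmentation (symh_mono a :: ('a, 'b) symh) = 0"
      by (rule augmentation_degree[OF symh_degree_mono]) fact
    ultimately show ?thesis by simp
  qed (simp add: augmentation_1)
  then show ?thesis
    unfolding S(3) sum_distrib_right symh_coeff_sum augmentation_sum
    by (intro sum.cong) (simp_all add: mult.assoc symh_coeff_scale augmentation_hom)
qed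

text \<open>Irreducible sets are nonempty by definition, so the empty chain is the only one.\<close>

lemma proj_has_dim_empty: "proj_has_dim W {} (- 1)"
proof -
  have "Zs = []" if "proj_chain W ({} :: ('v \<Rightarrow> 'k::field) set set) Zs" for W :: "'v set" and Zs
  proof (rule ccontr)
    assume "Zs \<noteq> []"
    then obtain Z where "Z \<in> set Zs" by (meson last_in_set)
    then have "proj_irreducible W Z" "Z = {}" using that by (auto simp: proj_chain_def)
    then show False by (simp add: proj_irreducible_def)
  qed
  then show ?thesis
    unfolding proj_has_dim_def by (auto simp: proj_chain_def intro!: exI[of _ "[]"])
qed

context
  fixes p :: nat and c :: "'k::field"
  assumes p: "prime p" and c: "good_param p TYPE('n::{finite, linorder}) c"
begin

text \<open>All generators have degree \<open>p\<close>, so a relation that expresses one of them by the others can be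
  replaced by its lowest part, which has constant coefficients, against linear independence.\<close>

lemma f_poly_minimal:
  assumes i: "i \<in> initial_indices"
  shows "f_poly p c i \<noteq> (\<Sum>j\<in>initial_indices - {i}. g j * f_poly p c j :: ('n, 'k) symh)"
proof
  let ?f = "f_poly p c :: 'n \<Rightarrow> ('n, 'k) symh"
  assume eq: "?f i = (\<Sum>j\<in>initial_indices - {i}. g j * ?f j)"
  (* the lowest part of the relation, brought to one side *)
  define \<alpha> where "\<alpha> j = (if j = i then - 1 else augmentation (g j))" for j
  have "symh_coeff (?f i) b = (\<Sum>j\<in>initial_indices - {i}. augmentation (g j) * symh_coeff (?f j) b)" for b
  proof (cases "mdeg b = p")
    case True
    show ?thesis
      by (subst eq) (simp add: symh_coeff_sum symh_coeff_mult_lowest[OF f_poly_degree True])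
  next
    case False
    then have "symh_coeff (?f j) b = 0" for j
      using f_poly_degree[of p c j]
      by (auto simp: symh_coeff_def symh_degree_iff homogeneous_iff in_keys_iff)
    then show ?thesis by simp
  qed
  then have "symh_coeff (?f i) b =
      symh_coeff (\<Sum>j\<in>initial_indices - {i}. symh_scale (augmentation (g j)) (?f j)) b" for b
    by (simp add: symh_coeff_sum symh_scale_def symh_coeff_scale)
  then have "?f i = (\<Sum>j\<in>initial_indices - {i}. symh_scale (augmentation (g j)) (?f j))"
    by (rule symh_eqI)
  also have "\<dots> = (\<Sum>j\<in>initial_indices - {i}. symh_scale (\<alpha> j) (?f j))"
    by (intro sum.cong) (auto simp: \<alpha>_def)
  finally have "(\<Sum>j\<in>initial_indices. symh_scale (\<alpha> j) (?f j)) = symh_scale (\<alpha> i) (?f i) + ?f i"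
    using sum.remove[OF _ i, of "\<lambda>j. symh_scale (\<alpha> j) (?f j)"] by simp
  also have "\<dots> = 0" by (simp add: \<alpha>_def symh_scale_def symh_const_hom)
  finally have "\<alpha> i = 0" using c i unfolding good_param_def by blast
  then show False by (simp add: \<alpha>_def)
qed

text \<open>The ideal contains a power of every variable, namely in the first degree without reduced
  monomials.\<close>

lemma proj_zeros_f_ideal:
  "proj_zeros initial_indices (elim_last ` (f_ideal p c :: ('n, 'k) symh set)) = {}"
proof -
  let ?D = "Suc (card (initial_indices :: 'n set) * (p - 1))"
  let ?e = "\<lambda>i. single i ?D :: 'n \<Rightarrow>\<^sub>0 nat"
  have "exponents ?D \<inter> reduced p = ({} :: ('n \<Rightarrow>\<^sub>0 nat) set)"
    using reduced_mdeg[of _ p] by (fastforce simp: exponents_def)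
  moreover have "\<exists>\<alpha>. symh_mono (?e i) - (\<Sum>a\<in>exponents (mdeg (?e i)) \<inter> reduced p.
      symh_const (\<alpha> a) * symh_mono a) \<in> f_ideal p c" if "i \<in> initial_indices" for i :: 'n
  proof -
    have "keys (?e i) \<subseteq> initial_indices" using that by simp
    then show ?thesis using c unfolding good_param_def by blast
  qed
  ultimately have "symh_mono (?e i) \<in> f_ideal p c" if "i \<in> initial_indices" for i :: 'n
    using that by (simp add: mdeg_single)
  then have elim: "elim_last (symh_mono (?e i)) \<in> elim_last ` (f_ideal p c :: ('n, 'k) symh set)"
    if "i \<in> initial_indices" for i :: 'n
    using that by blast
  have mem: "single (?e i) 1 \<in> elim_last ` (f_ideal p c :: ('n, 'k) symh set)"
    if "i \<in> initial_indices" for i :: 'n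
  proof -
    have "elim_last (symh_mono (?e i) :: ('n, 'k) symh) = single (?e i) 1"
      by (rule elim_last_mono) (use that in simp)
    then show ?thesis using elim[OF that] by simp
  qed
  have "v i = 0" if "i \<in> initial_indices"
    "\<forall>f\<in>elim_last ` (f_ideal p c :: ('n, 'k) symh set). peval id v f = 0" for v :: "'n \<Rightarrow> 'k" and i
  proof -
    have "peval id v (single (?e i) 1) = 0"
      using that mem by blast
    then show ?thesis by (auto simp: coeff_hom_id.peval_single)
  qed
  note vanish = this
  have "P \<notin> proj_zeros initial_indices (elim_last ` (f_ideal p c :: ('n, 'k) symh set))" for P
  proof -
    have False if P: "P \<in> proj_zeros initial_indices (elim_last ` (f_ideal p c :: ('n, 'k) symh set))"
    proof -
      obtain v where v: "P = {(\<lambda>i. t * v i) | t. t \<noteq> 0}" "\<exists>i\<in>initial_indices. v i \<noteq> 0"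
        using P by (auto simp: proj_zeros_def proj_space_def)
      have "v \<in> P" unfolding v(1) by (auto intro!: exI[of _ 1])
      then have "\<forall>f\<in>elim_last ` (f_ideal p c :: ('n, 'k) symh set). peval id v f = 0"
        using P by (auto simp: proj_zeros_def)
      then show False
        using v(2) vanish[of _ v] by blast
    qed
    then show ?thesis by blast
  qed
  then show ?thesis by blast
qed

lemma complete_intersection_f_ideal:
  "complete_intersection initial_indices (elim_last ` (f_ideal p c :: ('n, 'k) symh set))"
proof -
  let ?f = "f_poly p c :: 'n \<Rightarrow> ('n, 'k) symh"
  let ?W = "initial_indices :: 'n set"
  let ?S = "(\<lambda>i. elim_last (?f i)) ` ?W"
  have inj: "inj_on (\<lambda>i. elim_last (?f i)) ?W"
  proof (rule inj_onI, rule ccontr)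
    fix i j assume ij: "i \<in> ?W" "j \<in> ?W" "elim_last (?f i) = elim_last (?f j)" "i \<noteq> j"
    from ij(3) have "?f i = ?f j" by (rule injD[OF inj_elim_last])
    also have "\<dots> = (\<Sum>l\<in>?W - {i}. if l = j then ?f l else 0)" using ij by simp
    also have "\<dots> = (\<Sum>l\<in>?W - {i}. of_bool (l = j) * ?f l)" by (intro sum.cong) auto
    finally show False using f_poly_minimal[OF ij(1), of "\<lambda>l. of_bool (l = j)"] by contradiction
  qed
  have gen: "Idl\<^bsub>poly_ring ?W\<^esub> ?S = elim_last ` f_ideal p c"
    unfolding f_ideal_def by (rule genideal_elim_last) simp
  have minimal: "Idl\<^bsub>poly_ring ?W\<^esub> T \<noteq> elim_last ` f_ideal p c" if T: "T \<subset> ?S" for T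
  proof
    assume eq: "Idl\<^bsub>poly_ring ?W\<^esub> T = elim_last ` f_ideal p c"
    obtain i where i: "i \<in> ?W" "elim_last (?f i) \<notin> T" using T by blast
    have "T \<subseteq> (\<lambda>i. elim_last (?f i)) ` (?W - {i})" using T i by blast
    then have "Idl\<^bsub>poly_ring ?W\<^esub> T \<subseteq> Idl\<^bsub>poly_ring ?W\<^esub> ((\<lambda>i. elim_last (?f i)) ` (?W - {i}))"
      unfolding genideal_def by blast
    also have "\<dots> = elim_last ` (Idl\<^bsub>ring_of_type_algebra\<^esub> (?f ` (?W - {i})))"
      by (rule genideal_elim_last) simp
    finally have "elim_last (?f i) \<in> elim_last ` (Idl\<^bsub>ring_of_type_algebra\<^esub> (?f ` (?W - {i})))"
      using f_poly_in_f_ideal[OF i(1)] unfolding eq by blast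
    then have "?f i \<in> Idl\<^bsub>ring_of_type_algebra\<^esub> (?f ` (?W - {i}))"
      by (simp only: inj_image_mem_iff[OF inj_elim_last])
    then have "?f i \<in> {\<Sum>j\<in>?W - {i}. g j * ?f j | g. True}"
      by (subst (asm) genideal_type_algebra_image) simp_all
    then show False using f_poly_minimal[OF i(1)] by blast
  qed
  have "int (card ?W) - 1 - int (card ?S) = - 1"
    using card_image[OF inj] by simp
  then have "proj_has_dim ?W (proj_zeros ?W (elim_last ` (f_ideal p c :: ('n, 'k) symh set)))
      (int (card ?W) - 1 - int (card ?S))"
    by (simp only: proj_zeros_f_ideal proj_has_dim_empty)
  moreover have "homogeneous p (elim_last (?f i))" for i
    using f_poly_degree[of p c i] by (simp add: symh_degree_iff)
  ultimately show ?thesis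
    unfolding complete_intersection_def
    by (intro exI[of _ ?S] conjI) (use gen minimal elim_last_carrier in auto)
qed

end

theorem theorem4p1:
  fixes p :: nat
  assumes "CHAR('k::alg_closed_field) = p" and "p > 0"
    and "p dvd CARD('n::{finite, linorder})"
  shows "\<exists>C::'k set. finite C \<and> (\<forall>c. c \<notin> C \<longrightarrow>
    (let f = (f_poly p c :: 'n \<Rightarrow> ('n, 'k) symh);
         J = (max_graded_submodule c :: ('n, 'k) symh set)
     in (\<forall>a::'n \<Rightarrow> 'k. (\<Sum>i\<in>initial_indices. symh_scale (a i) (f i)) = 0 \<longrightarrow>
           (\<forall>i\<in>initial_indices. a i = 0)) \<and>
        J = Idl\<^bsub>ring_of_type_algebra\<^esub> (f ` initial_indices) \<and>
        complete_intersection initial_indices (elim_last ` J) \<and>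
        quotient_hilbert_series J = ((1 - fps_X ^ p) / (1 - fps_X)) ^ (CARD('n) - 1)))"
proof -
  have prime: "prime p"
    using assms(1,2) prime_CHAR_semidom[where ?'a = 'k] by simp
  obtain C :: "'k set" where C: "finite C" "\<And>c. c \<notin> C \<Longrightarrow> c \<noteq> 0 \<and> good_param p TYPE('n) c"
    using generic_good_param[OF assms(1) prime, where ?'n = 'n] by blast
  show ?thesis
  proof (intro exI[of _ C] conjI allI impI C(1))
    fix c assume "c \<notin> C"
    then have c: "c \<noteq> 0" "good_param p TYPE('n) c" using C(2) by auto
    have J: "max_graded_submodule c = (f_ideal p c :: ('n, 'k) symh set)"
      by (rule max_graded_submodule_eq[OF assms(1) prime c assms(3)])
    have "quotient_hilbert_series (f_ideal p c :: ('n, 'k) symh set) =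
        ((1 - fps_X ^ p) / (1 - fps_X)) ^ (CARD('n) - 1)"
      unfolding quotient_hilbert_series_def Let_def
      by (rule fps_ext)
        (simp only: fps_nth_Abs_fps dim_quotient_degree[OF assms(1) prime assms(3) c]
          card_reduced_degree[OF assms(2)])
    moreover have "\<forall>a. (\<Sum>i\<in>initial_indices. symh_scale (a i) (f_poly p c i :: ('n, 'k) symh)) = 0 \<longrightarrow>
        (\<forall>i\<in>initial_indices. a i = 0)"
      using c(2) unfolding good_param_def by blast
    ultimately show "let f = (f_poly p c :: 'n \<Rightarrow> ('n, 'k) symh);
         J = (max_graded_submodule c :: ('n, 'k) symh set)
     in (\<forall>a::'n \<Rightarrow> 'k. (\<Sum>i\<in>initial_indices. symh_scale (a i) (f i)) = 0 \<longrightarrow>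
           (\<forall>i\<in>initial_indices. a i = 0)) \<and>
        J = Idl\<^bsub>ring_of_type_algebra\<^esub> (f ` initial_indices) \<and>
        complete_intersection initial_indices (elim_last ` J) \<and>
        quotient_hilbert_series J = ((1 - fps_X ^ p) / (1 - fps_X)) ^ (CARD('n) - 1)"
      unfolding Let_def J using complete_intersection_f_ideal[OF prime c(2)]
      by (simp only: f_ideal_def)
  qed
qed

end
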